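(* Let $\mathcal{C}$ be a fusion category. (i) The map $\phi_c:\mathrm{Hom}(c,1)\to\mathrm{Hom}(1,c)^{*}$, $\phi_c(f)(h)=f\circ h\in\mathrm{End}(1)=\mathbb{C}$, for $c\in\mathcal{C}$, $f\in\mathrm{Hom}(c,1)$ and $h\in\mathrm{Hom}(1,c)$, is a natural isomorphism. (ii) The chain of isomorphisms $$\mathrm{Hom}(x,{}^{**}c)\cong\mathrm{Hom}({}^{*}c\otimes x,1)\xrightarrow{\phi}\mathrm{Hom}(1,{}^{*}c\otimes x)^{*}\cong\mathrm{Hom}(c,x)^{*}\cong\mathrm{Hom}(1,x\otimes c^{*})^{*}\xrightarrow{\phi^{-1}}\mathrm{Hom}(x\otimes c^{*},1)\cong\mathrm{Hom}(x,c^{**}),$$ in which the unlabelled isomorphisms are those given by the dualities, is natural in $c,x\in\mathcal{C}$ and defines (via the Yoneda lemma) a monoidal natural isomorphism $g_c:{}^{**}c\to c^{**}$. (iii) $g_c:{}^{**}c\to c^{**}$ is defined uniquely by the requirement that for all $x\in\mathcal{C}$, $f\in\mathrm{Hom}(x,{}^{**}c)$ and $h\in\mathrm{Hom}(c,x)$: $$\mathrm{ev}_{c^{*}}\circ\bigl((g_c\circ f\circ h)\otimes\mathrm{id}_{c^{*}}\bigr)\circ\mathrm{coev}_c=\mathrm{ev}'_{{}^{*}c}\circ\bigl(\mathrm{id}_{{}^{*}c}\otimes(f\circ h)\bigr)\circ\mathrm{coev}'_c .$$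
   Context: A fusion category is a semisimple, rigid, monoidal $\mathbb{C}$-linear abelian category with finite-dimensional Hom spaces, tensor product bilinear on morphisms, simple unit $1$ and finitely many isomorphism classes of simple objects; it is treated as strict. The right dual of $c$ is $c^{*}$ with $\mathrm{ev}_c:c^{*}\otimes c\to1$, $\mathrm{coev}_c:1\to c\otimes c^{*}$; the left dual is ${}^{*}c$ with $\mathrm{ev}'_c:c\otimes{}^{*}c\to1$, $\mathrm{coev}'_c:1\to{}^{*}c\otimes c$. The canonical isomorphisms $({}^{*}c)^{*}\cong c\cong{}^{*}(c^{*})$ are treated as identities. The double dual functors ${}^{**}(-)$ and $(-)^{**}$ are monoidal functors in the canonical way. $V^{*}$ denotes the dual of a vector space $V$. *)

theory Defs
  imports Complex_Main "HOL-Library.Function_Algebras"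
begin

section \<open>Linear maps between subspaces and dual spaces\<close>

definition linear_map_on ::
  "(complex \<Rightarrow> 'a \<Rightarrow> 'a) \<Rightarrow> (complex \<Rightarrow> 'b \<Rightarrow> 'b) \<Rightarrow> 'a::ab_group_add set \<Rightarrow> ('a \<Rightarrow> 'b::ab_group_add) \<Rightarrow> bool"
  where "linear_map_on s1 s2 V t \<longleftrightarrow>
    (\<forall>u\<in>V. \<forall>v\<in>V. t (u + v) = t u + t v) \<and> (\<forall>z. \<forall>v\<in>V. t (s1 z v) = s2 z (t v))"

definition linear_iso_on ::
  "(complex \<Rightarrow> 'a \<Rightarrow> 'a) \<Rightarrow> (complex \<Rightarrow> 'b \<Rightarrow> 'b) \<Rightarrow> 'a::ab_group_add set \<Rightarrow> 'b::ab_group_add set \<Rightarrow> ('a \<Rightarrow> 'b) \<Rightarrow> bool"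
  where "linear_iso_on s1 s2 V W t \<longleftrightarrow> linear_map_on s1 s2 V t \<and> bij_betw t V W"

text \<open>A functional on the subspace \<open>V\<close> is represented by the function that agrees with it
  on \<open>V\<close> and vanishes outside \<open>V\<close>; addition of functionals is then pointwise addition.\<close>

definition restrict0 :: "'a set \<Rightarrow> ('a \<Rightarrow> complex) \<Rightarrow> 'a \<Rightarrow> complex"
  where "restrict0 V \<psi> = (\<lambda>v. if v \<in> V then \<psi> v else 0)"

definition dual_space :: "(complex \<Rightarrow> 'a \<Rightarrow> 'a) \<Rightarrow> 'a::ab_group_add set \<Rightarrow> ('a \<Rightarrow> complex) set"
  where "dual_space s V = {\<psi>. linear_map_on s (*) V \<psi> \<and> (\<forall>v. v \<notin> V \<longrightarrow> \<psi> v = 0)}"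

definition dual_scale :: "complex \<Rightarrow> ('a \<Rightarrow> complex) \<Rightarrow> 'a \<Rightarrow> complex"
  where "dual_scale z \<psi> = (\<lambda>v. z * \<psi> v)"


section \<open>Fusion categories\<close>

text \<open>Objects are the elements of the type \<open>'o\<close>. All \<open>Hom\<close>-spaces are subspaces of one complex
  vector space \<open>'m\<close>; for a given category one may take \<open>'m\<close> to be the direct sum of all
  \<open>Hom\<close>-spaces, with composition and tensor product extended bilinearly (by 0 on
  non-composable pairs). An element of \<open>'m\<close> does not determine a source and a target, so
  notions that depend on them take the objects as additional arguments.

  \<open>dR c\<close>, \<open>evR c\<close>, \<open>coevR c\<close> stand for the right dual \<open>c*\<close> with
  \<open>ev : c* \<otimes> c \<rightarrow> 1\<close> and \<open>coev : 1 \<rightarrow> c \<otimes> c*\<close>, and \<open>dL c\<close>, \<open>evL c\<close>, \<open>coevL c\<close> for the left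
  dual \<open>*c\<close> with \<open>ev' : c \<otimes> *c \<rightarrow> 1\<close> and \<open>coev' : 1 \<rightarrow> *c \<otimes> c\<close>. The two choices are
  independent of each other: the identifications \<open>(*c)* = c = *(c*)\<close> are never used.\<close>

record ('o, 'm) fusion_data =
  scale :: "complex \<Rightarrow> 'm \<Rightarrow> 'm"
  hom :: "'o \<Rightarrow> 'o \<Rightarrow> 'm set"  ("Hom\<index>")
  ident :: "'o \<Rightarrow> 'm"  ("idm\<index>")
  comp :: "'m \<Rightarrow> 'm \<Rightarrow> 'm"  (infixl "\<cdot>\<index>" 70)
  unit_ob :: 'o  ("\<one>\<index>")
  tensor_ob :: "'o \<Rightarrow> 'o \<Rightarrow> 'o"  (infixr "\<otimes>\<^sub>o\<index>" 75)
  tensor :: "'m \<Rightarrow> 'm \<Rightarrow> 'm"  (infixr "\<otimes>\<index>" 75)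
  rdual :: "'o \<Rightarrow> 'o"  ("dR\<index>")
  ev_r :: "'o \<Rightarrow> 'm"  ("evR\<index>")
  coev_r :: "'o \<Rightarrow> 'm"  ("coevR\<index>")
  ldual :: "'o \<Rightarrow> 'o"  ("dL\<index>")
  ev_l :: "'o \<Rightarrow> 'm"  ("evL\<index>")
  coev_l :: "'o \<Rightarrow> 'm"  ("coevL\<index>")

locale linear_category =
  fixes C :: "('o, 'm::ab_group_add) fusion_data" (structure)
  assumes vector_space: "vector_space (scale C)"
    and hom_subspace: "module.subspace (scale C) (Hom x y)"
    and ident_hom: "idm x \<in> Hom x x"
    and comp_hom: "\<lbrakk>g \<in> Hom y z; f \<in> Hom x y\<rbrakk> \<Longrightarrow> g \<cdot> f \<in> Hom x z"
    and comp_assoc: "\<lbrakk>h \<in> Hom w z; g \<in> Hom y w; f \<in> Hom x y\<rbrakk> \<Longrightarrow> (h \<cdot> g) \<cdot> f = h \<cdot> (g \<cdot> f)"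
    and ident_comp: "f \<in> Hom x y \<Longrightarrow> idm y \<cdot> f = f"
    and comp_ident: "f \<in> Hom x y \<Longrightarrow> f \<cdot> idm x = f"
    and comp_linear_left: "f \<in> Hom x y \<Longrightarrow> linear_map_on (scale C) (scale C) (Hom y z) (\<lambda>g. g \<cdot> f)"
    and comp_linear_right: "g \<in> Hom y z \<Longrightarrow> linear_map_on (scale C) (scale C) (Hom x y) (\<lambda>f. g \<cdot> f)"

context
  fixes C :: "('o, 'm::ab_group_add) fusion_data" (structure)
begin

definition zero_object :: "'o \<Rightarrow> bool"
  where "zero_object x \<longleftrightarrow> (\<forall>y. Hom x y = {0} \<and> Hom y x = {0})"

definition is_iso :: "'o \<Rightarrow> 'o \<Rightarrow> 'm \<Rightarrow> bool"
  where "is_iso x y f \<longleftrightarrow> f \<in> Hom x y \<and> (\<exists>g\<in>Hom y x. g \<cdot> f = idm x \<and> f \<cdot> g = idm y)"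

definition isomorphic :: "'o \<Rightarrow> 'o \<Rightarrow> bool"
  where "isomorphic x y \<longleftrightarrow> (\<exists>f. is_iso x y f)"

definition is_mono :: "'o \<Rightarrow> 'o \<Rightarrow> 'm \<Rightarrow> bool"
  where "is_mono x y f \<longleftrightarrow> f \<in> Hom x y \<and>
    (\<forall>w. \<forall>u\<in>Hom w x. \<forall>v\<in>Hom w x. f \<cdot> u = f \<cdot> v \<longrightarrow> u = v)"

definition is_epi :: "'o \<Rightarrow> 'o \<Rightarrow> 'm \<Rightarrow> bool"
  where "is_epi x y f \<longleftrightarrow> f \<in> Hom x y \<and>
    (\<forall>w. \<forall>u\<in>Hom y w. \<forall>v\<in>Hom y w. u \<cdot> f = v \<cdot> f \<longrightarrow> u = v)"

text \<open>\<open>k : w \<rightarrow> x\<close> is a kernel, respectively \<open>q : y \<rightarrow> w\<close> a cokernel, of \<open>f : x \<rightarrow> y\<close>.\<close>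

definition is_kernel :: "'o \<Rightarrow> 'o \<Rightarrow> 'm \<Rightarrow> 'o \<Rightarrow> 'm \<Rightarrow> bool"
  where "is_kernel x y f w k \<longleftrightarrow> f \<in> Hom x y \<and> k \<in> Hom w x \<and> f \<cdot> k = 0 \<and>
    (\<forall>v. \<forall>u\<in>Hom v x. f \<cdot> u = 0 \<longrightarrow> (\<exists>!u'. u' \<in> Hom v w \<and> k \<cdot> u' = u))"

definition is_cokernel :: "'o \<Rightarrow> 'o \<Rightarrow> 'm \<Rightarrow> 'o \<Rightarrow> 'm \<Rightarrow> bool"
  where "is_cokernel x y f w q \<longleftrightarrow> f \<in> Hom x y \<and> q \<in> Hom y w \<and> q \<cdot> f = 0 \<and>
    (\<forall>v. \<forall>u\<in>Hom y v. u \<cdot> f = 0 \<longrightarrow> (\<exists>!u'. u' \<in> Hom w v \<and> u' \<cdot> q = u))"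

text \<open>\<open>x\<close> is the direct sum of \<open>s 0, \<dots>, s (n - 1)\<close> with inclusions \<open>i k\<close> and projections
  \<open>p k\<close>; for \<open>n = 0\<close> this says that \<open>x\<close> is a zero object.\<close>

definition is_direct_sum :: "'o \<Rightarrow> nat \<Rightarrow> (nat \<Rightarrow> 'o) \<Rightarrow> (nat \<Rightarrow> 'm) \<Rightarrow> (nat \<Rightarrow> 'm) \<Rightarrow> bool"
  where "is_direct_sum x n s i p \<longleftrightarrow>
    (\<forall>k<n. i k \<in> Hom (s k) x \<and> p k \<in> Hom x (s k)) \<and>
    (\<forall>k<n. \<forall>l<n. p k \<cdot> i l = (if k = l then idm (s k) else 0)) \<and>
    (\<Sum>k<n. i k \<cdot> p k) = idm x"

definition simple_object :: "'o \<Rightarrow> bool"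
  where "simple_object x \<longleftrightarrow> \<not> zero_object x \<and>
    (\<forall>y m. is_mono y x m \<longrightarrow> zero_object y \<or> is_iso y x m)"

end

locale abelian_linear_category = linear_category +
  assumes direct_sums: "\<exists>x i p. is_direct_sum C x n s i p"
    and kernels: "f \<in> Hom x y \<Longrightarrow> \<exists>w k. is_kernel C x y f w k"
    and cokernels: "f \<in> Hom x y \<Longrightarrow> \<exists>w q. is_cokernel C x y f w q"
    and mono_kernel: "is_mono C w x k \<Longrightarrow> \<exists>y f. is_kernel C x y f w k"
    and epi_cokernel: "is_epi C y w q \<Longrightarrow> \<exists>x f. is_cokernel C x y f w q"

locale strict_monoidal_linear_category = linear_category +
  assumes tensor_ob_assoc: "(x \<otimes>\<^sub>o y) \<otimes>\<^sub>o z = x \<otimes>\<^sub>o (y \<otimes>\<^sub>o z)"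
    and unit_tensor_ob: "\<one> \<otimes>\<^sub>o x = x"
    and tensor_ob_unit: "x \<otimes>\<^sub>o \<one> = x"
    and tensor_hom: "\<lbrakk>f \<in> Hom x y; g \<in> Hom x' y'\<rbrakk> \<Longrightarrow> f \<otimes> g \<in> Hom (x \<otimes>\<^sub>o x') (y \<otimes>\<^sub>o y')"
    and tensor_ident: "idm x \<otimes> idm y = idm (x \<otimes>\<^sub>o y)"
    and interchange: "\<lbrakk>f \<in> Hom x y; g \<in> Hom y z; f' \<in> Hom x' y'; g' \<in> Hom y' z'\<rbrakk> \<Longrightarrow>
      (g \<cdot> f) \<otimes> (g' \<cdot> f') = (g \<otimes> g') \<cdot> (f \<otimes> f')"
    and tensor_assoc: "\<lbrakk>f \<in> Hom x y; g \<in> Hom x' y'; h \<in> Hom x'' y''\<rbrakk> \<Longrightarrow>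
      (f \<otimes> g) \<otimes> h = f \<otimes> (g \<otimes> h)"
    and unit_tensor: "f \<in> Hom x y \<Longrightarrow> idm \<one> \<otimes> f = f"
    and tensor_unit: "f \<in> Hom x y \<Longrightarrow> f \<otimes> idm \<one> = f"
    and tensor_linear_left: "g \<in> Hom x' y' \<Longrightarrow>
      linear_map_on (scale C) (scale C) (Hom x y) (\<lambda>f. f \<otimes> g)"
    and tensor_linear_right: "f \<in> Hom x y \<Longrightarrow>
      linear_map_on (scale C) (scale C) (Hom x' y') (\<lambda>g. f \<otimes> g)"

locale rigid_linear_category = strict_monoidal_linear_category +
  assumes ev_r_hom: "evR c \<in> Hom (dR c \<otimes>\<^sub>o c) \<one>"
    and coev_r_hom: "coevR c \<in> Hom \<one> (c \<otimes>\<^sub>o dR c)"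
    and ev_l_hom: "evL c \<in> Hom (c \<otimes>\<^sub>o dL c) \<one>"
    and coev_l_hom: "coevL c \<in> Hom \<one> (dL c \<otimes>\<^sub>o c)"
    and snake_r: "(idm c \<otimes> evR c) \<cdot> (coevR c \<otimes> idm c) = idm c"
    and snake_r_dual: "(evR c \<otimes> idm (dR c)) \<cdot> (idm (dR c) \<otimes> coevR c) = idm (dR c)"
    and snake_l: "(evL c \<otimes> idm c) \<cdot> (idm c \<otimes> coevL c) = idm c"
    and snake_l_dual: "(idm (dL c) \<otimes> evL c) \<cdot> (coevL c \<otimes> idm (dL c)) = idm (dL c)"

locale fusion_category = abelian_linear_category + rigid_linear_category +
  assumes semisimple: "\<exists>n s i p. (\<forall>k<n. simple_object C (s k)) \<and> is_direct_sum C x n s i p"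
    and hom_finite_dim: "\<exists>B\<subseteq>Hom x y. finite B \<and> module.span (scale C) B = Hom x y"
    and simple_unit: "simple_object C \<one>"
    and finitely_many_simples:
      "finite (Collect (simple_object C) //
        {(x, y). simple_object C x \<and> simple_object C y \<and> isomorphic C x y})"


section \<open>The double dual functors\<close>

context
  fixes C :: "('o, 'm::ab_group_add) fusion_data" (structure)
begin

text \<open>For \<open>f : c \<rightarrow> d\<close> these are \<open>f* : d* \<rightarrow> c*\<close> and \<open>*f : *d \<rightarrow> *c\<close>.\<close>

definition rdual_mor :: "'o \<Rightarrow> 'o \<Rightarrow> 'm \<Rightarrow> 'm"
  where "rdual_mor c d f =
    (evR d \<otimes> idm (dR c)) \<cdot> (idm (dR d) \<otimes> f \<otimes> idm (dR c)) \<cdot> (idm (dR d) \<otimes> coevR c)"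

definition ldual_mor :: "'o \<Rightarrow> 'o \<Rightarrow> 'm \<Rightarrow> 'm"
  where "ldual_mor c d f =
    (idm (dL c) \<otimes> evL d) \<cdot> (idm (dL c) \<otimes> f \<otimes> idm (dL d)) \<cdot> (coevL c \<otimes> idm (dL d))"

definition rdual2 :: "'o \<Rightarrow> 'o"
  where "rdual2 c = dR (dR c)"

definition ldual2 :: "'o \<Rightarrow> 'o"
  where "ldual2 c = dL (dL c)"

definition rdual2_mor :: "'o \<Rightarrow> 'o \<Rightarrow> 'm \<Rightarrow> 'm"
  where "rdual2_mor c d f = rdual_mor (dR d) (dR c) (rdual_mor c d f)"

definition ldual2_mor :: "'o \<Rightarrow> 'o \<Rightarrow> 'm \<Rightarrow> 'm"
  where "ldual2_mor c d f = ldual_mor (dL d) (dL c) (ldual_mor c d f)"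

text \<open>If \<open>(r, e, k)\<close> and \<open>(r', e', k')\<close> are two right duals of the same object, then
  \<open>rdual_comparison r e r' k'\<close> is the canonical isomorphism \<open>r \<rightarrow> r'\<close>; similarly
  \<open>ldual_comparison l e l' k' : l \<rightarrow> l'\<close> for left duals. The inverse is the comparison
  with the roles of the two duals exchanged.\<close>

definition rdual_comparison :: "'o \<Rightarrow> 'm \<Rightarrow> 'o \<Rightarrow> 'm \<Rightarrow> 'm"
  where "rdual_comparison r e r' k' = (e \<otimes> idm r') \<cdot> (idm r \<otimes> k')"

definition ldual_comparison :: "'o \<Rightarrow> 'm \<Rightarrow> 'o \<Rightarrow> 'm \<Rightarrow> 'm"
  where "ldual_comparison l e l' k' = (idm l' \<otimes> e) \<cdot> (k' \<otimes> idm l)"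

text \<open>\<open>d* \<otimes> c*\<close> is a right dual of \<open>c \<otimes> d\<close> by nesting the dualities, and \<open>*d \<otimes> *c\<close> is a
  left dual.\<close>

definition ev_r_nested :: "'o \<Rightarrow> 'o \<Rightarrow> 'm"
  where "ev_r_nested c d = evR d \<cdot> (idm (dR d) \<otimes> evR c \<otimes> idm d)"

definition coev_r_nested :: "'o \<Rightarrow> 'o \<Rightarrow> 'm"
  where "coev_r_nested c d = (idm c \<otimes> coevR d \<otimes> idm (dR c)) \<cdot> coevR c"

definition ev_l_nested :: "'o \<Rightarrow> 'o \<Rightarrow> 'm"
  where "ev_l_nested c d = evL c \<cdot> (idm c \<otimes> evL d \<otimes> idm (dL c))"

definition coev_l_nested :: "'o \<Rightarrow> 'o \<Rightarrow> 'm"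
  where "coev_l_nested c d = (idm (dL d) \<otimes> coevL c \<otimes> idm d) \<cdot> coevL d"

text \<open>The canonical isomorphism \<open>d* \<otimes> c* \<rightarrow> (c \<otimes> d)*\<close> and its inverse, and the same for left
  duals.\<close>

definition rdual_tensor :: "'o \<Rightarrow> 'o \<Rightarrow> 'm"
  where "rdual_tensor c d =
    rdual_comparison (dR d \<otimes>\<^sub>o dR c) (ev_r_nested c d) (dR (c \<otimes>\<^sub>o d)) (coevR (c \<otimes>\<^sub>o d))"

definition rdual_tensor_inv :: "'o \<Rightarrow> 'o \<Rightarrow> 'm"
  where "rdual_tensor_inv c d =
    rdual_comparison (dR (c \<otimes>\<^sub>o d)) (evR (c \<otimes>\<^sub>o d)) (dR d \<otimes>\<^sub>o dR c) (coev_r_nested c d)"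

definition ldual_tensor :: "'o \<Rightarrow> 'o \<Rightarrow> 'm"
  where "ldual_tensor c d =
    ldual_comparison (dL d \<otimes>\<^sub>o dL c) (ev_l_nested c d) (dL (c \<otimes>\<^sub>o d)) (coevL (c \<otimes>\<^sub>o d))"

definition ldual_tensor_inv :: "'o \<Rightarrow> 'o \<Rightarrow> 'm"
  where "ldual_tensor_inv c d =
    ldual_comparison (dL (c \<otimes>\<^sub>o d)) (evL (c \<otimes>\<^sub>o d)) (dL d \<otimes>\<^sub>o dL c) (coev_l_nested c d)"

text \<open>The monoidal structures \<open>c** \<otimes> d** \<rightarrow> (d* \<otimes> c*)* \<rightarrow> (c \<otimes> d)**\<close> and
  \<open>1 \<rightarrow> 1* \<rightarrow> 1**\<close> of the double right dual, and those of the double left dual. For the unit,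
  \<open>coevR \<one> : 1 \<rightarrow> 1*\<close> and \<open>evR \<one> : 1* \<rightarrow> 1\<close> are the comparisons of \<open>1*\<close> with the trivial dual
  of \<open>1\<close>.\<close>

definition rdual2_tensor :: "'o \<Rightarrow> 'o \<Rightarrow> 'm"
  where "rdual2_tensor c d =
    rdual_mor (dR (c \<otimes>\<^sub>o d)) (dR d \<otimes>\<^sub>o dR c) (rdual_tensor_inv c d) \<cdot> rdual_tensor (dR d) (dR c)"

definition rdual2_unit :: 'm
  where "rdual2_unit = rdual_mor (dR \<one>) \<one> (evR \<one>) \<cdot> coevR \<one>"

definition ldual2_tensor :: "'o \<Rightarrow> 'o \<Rightarrow> 'm"
  where "ldual2_tensor c d =
    ldual_mor (dL (c \<otimes>\<^sub>o d)) (dL d \<otimes>\<^sub>o dL c) (ldual_tensor_inv c d) \<cdot> ldual_tensor (dL d) (dL c)"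

definition ldual2_unit :: 'm
  where "ldual2_unit = ldual_mor (dL \<one>) \<one> (evL \<one>) \<cdot> coevL \<one>"

text \<open>\<open>\<eta>\<close> is a monoidal natural isomorphism from the monoidal functor \<open>(F, Fm, J, J\<^sub>1)\<close> to
  \<open>(G, Gm, K, K\<^sub>1)\<close>, where \<open>Fm c d\<close> is the action of \<open>F\<close> on \<open>Hom c d\<close>, and
  \<open>J c d : F c \<otimes> F d \<rightarrow> F (c \<otimes> d)\<close> and \<open>J\<^sub>1 : 1 \<rightarrow> F 1\<close> are the monoidal structure.\<close>

definition monoidal_natural_iso ::
  "('o \<Rightarrow> 'o) \<Rightarrow> ('o \<Rightarrow> 'o \<Rightarrow> 'm \<Rightarrow> 'm) \<Rightarrow> ('o \<Rightarrow> 'o \<Rightarrow> 'm) \<Rightarrow> 'm \<Rightarrow>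
   ('o \<Rightarrow> 'o) \<Rightarrow> ('o \<Rightarrow> 'o \<Rightarrow> 'm \<Rightarrow> 'm) \<Rightarrow> ('o \<Rightarrow> 'o \<Rightarrow> 'm) \<Rightarrow> 'm \<Rightarrow> ('o \<Rightarrow> 'm) \<Rightarrow> bool"
  where "monoidal_natural_iso F Fm J J\<^sub>1 G Gm K K\<^sub>1 \<eta> \<longleftrightarrow>
    (\<forall>c. is_iso C (F c) (G c) (\<eta> c)) \<and>
    (\<forall>c d. \<forall>f\<in>Hom c d. \<eta> d \<cdot> Fm c d f = Gm c d f \<cdot> \<eta> c) \<and>
    (\<forall>c d. \<eta> (c \<otimes>\<^sub>o d) \<cdot> J c d = K c d \<cdot> (\<eta> c \<otimes> \<eta> d)) \<and>
    \<eta> \<one> \<cdot> J\<^sub>1 = K\<^sub>1"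

end


section \<open>The pairing and the chain of isomorphisms\<close>

text \<open>A functor \<open>(c, x) \<mapsto> F c x\<close> to vector spaces, covariant in \<open>c\<close> and contravariant in \<open>x\<close>,
  is given by its spaces and its action \<open>F c x \<rightarrow> F c' x'\<close> of pairs \<open>a : c \<rightarrow> c'\<close>, \<open>b : x' \<rightarrow> x\<close>;
  the action takes the arguments \<open>c c' x x' a b\<close>.\<close>

type_synonym ('o, 'm, 'v) bifunctor =
  "('o \<Rightarrow> 'o \<Rightarrow> 'v set) \<times> ('o \<Rightarrow> 'o \<Rightarrow> 'o \<Rightarrow> 'o \<Rightarrow> 'm \<Rightarrow> 'm \<Rightarrow> 'v \<Rightarrow> 'v)"

context
  fixes C :: "('o, 'm::ab_group_add) fusion_data" (structure)
begin

definition natural_linear_iso ::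
  "(complex \<Rightarrow> 'a \<Rightarrow> 'a) \<Rightarrow> (complex \<Rightarrow> 'b \<Rightarrow> 'b) \<Rightarrow> ('o, 'm, 'a::ab_group_add) bifunctor \<Rightarrow>
   ('o, 'm, 'b::ab_group_add) bifunctor \<Rightarrow> ('o \<Rightarrow> 'o \<Rightarrow> 'a \<Rightarrow> 'b) \<Rightarrow> bool"
  where "natural_linear_iso s1 s2 F G t \<longleftrightarrow>
    (\<forall>c x. linear_iso_on s1 s2 (fst F c x) (fst G c x) (t c x)) \<and>
    (\<forall>c c' x x'. \<forall>a\<in>Hom c c'. \<forall>b\<in>Hom x' x. \<forall>v\<in>fst F c x.
      t c' x' (snd F c c' x x' a b v) = snd G c c' x x' a b (t c x v))"

text \<open>The identification of \<open>End(1)\<close> with the complex numbers, \<open>z\<close> corresponding to \<open>z\<close> times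
  the identity.\<close>

definition scalar_of :: "'m \<Rightarrow> complex"
  where "scalar_of k = (THE z. scale C z (idm \<one>) = k)"

definition pairing :: "'o \<Rightarrow> 'm \<Rightarrow> 'm \<Rightarrow> complex"
  where "pairing c f = restrict0 (Hom \<one> c) (\<lambda>h. scalar_of (f \<cdot> h))"

text \<open>The seven functors in the chain: \<open>Hom(x, **c)\<close>, \<open>Hom(*c \<otimes> x, 1)\<close>,
  the dual spaces of \<open>Hom(1, *c \<otimes> x)\<close>, of \<open>Hom(c, x)\<close> and of \<open>Hom(1, x \<otimes> c*)\<close>,
  \<open>Hom(x \<otimes> c*, 1)\<close>, and \<open>Hom(x, c**)\<close>.\<close>

definition chain_functor1 :: "('o, 'm, 'm) bifunctor"
  where "chain_functor1 =
    (\<lambda>c x. Hom x (ldual2 C c),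
     \<lambda>c c' x x' a b f. ldual2_mor C c c' a \<cdot> f \<cdot> b)"

definition chain_functor2 :: "('o, 'm, 'm) bifunctor"
  where "chain_functor2 =
    (\<lambda>c x. Hom (dL c \<otimes>\<^sub>o x) \<one>,
     \<lambda>c c' x x' a b f. f \<cdot> (ldual_mor C c c' a \<otimes> b))"

definition chain_functor3 :: "('o, 'm, 'm \<Rightarrow> complex) bifunctor"
  where "chain_functor3 =
    (\<lambda>c x. dual_space (scale C) (Hom \<one> (dL c \<otimes>\<^sub>o x)),
     \<lambda>c c' x x' a b \<psi>.
       restrict0 (Hom \<one> (dL c' \<otimes>\<^sub>o x')) (\<lambda>k. \<psi> ((ldual_mor C c c' a \<otimes> b) \<cdot> k)))"

definition chain_functor4 :: "('o, 'm, 'm \<Rightarrow> complex) bifunctor"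
  where "chain_functor4 =
    (\<lambda>c x. dual_space (scale C) (Hom c x),
     \<lambda>c c' x x' a b \<psi>. restrict0 (Hom c' x') (\<lambda>h. \<psi> (b \<cdot> h \<cdot> a)))"

definition chain_functor5 :: "('o, 'm, 'm \<Rightarrow> complex) bifunctor"
  where "chain_functor5 =
    (\<lambda>c x. dual_space (scale C) (Hom \<one> (x \<otimes>\<^sub>o dR c)),
     \<lambda>c c' x x' a b \<psi>.
       restrict0 (Hom \<one> (x' \<otimes>\<^sub>o dR c')) (\<lambda>k. \<psi> ((b \<otimes> rdual_mor C c c' a) \<cdot> k)))"

definition chain_functor6 :: "('o, 'm, 'm) bifunctor"
  where "chain_functor6 =
    (\<lambda>c x. Hom (x \<otimes>\<^sub>o dR c) \<one>,
     \<lambda>c c' x x' a b f. f \<cdot> (b \<otimes> rdual_mor C c c' a))"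

definition chain_functor7 :: "('o, 'm, 'm) bifunctor"
  where "chain_functor7 =
    (\<lambda>c x. Hom x (rdual2 C c),
     \<lambda>c c' x x' a b f. rdual2_mor C c c' a \<cdot> f \<cdot> b)"

definition chain_step1 :: "'o \<Rightarrow> 'o \<Rightarrow> 'm \<Rightarrow> 'm"
  where "chain_step1 c x f = evL (dL c) \<cdot> (idm (dL c) \<otimes> f)"

definition chain_step2 :: "'o \<Rightarrow> 'o \<Rightarrow> 'm \<Rightarrow> 'm \<Rightarrow> complex"
  where "chain_step2 c x = pairing (dL c \<otimes>\<^sub>o x)"

text \<open>Steps 3 and 4 are precomposition with the duality isomorphisms
  \<open>Hom(c, x) \<rightarrow> Hom(1, *c \<otimes> x)\<close> and \<open>Hom(1, x \<otimes> c*) \<rightarrow> Hom(c, x)\<close>.\<close>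

definition chain_step3 :: "'o \<Rightarrow> 'o \<Rightarrow> ('m \<Rightarrow> complex) \<Rightarrow> 'm \<Rightarrow> complex"
  where "chain_step3 c x \<psi> =
    restrict0 (Hom c x) (\<lambda>h. \<psi> ((idm (dL c) \<otimes> h) \<cdot> coevL c))"

definition chain_step4 :: "'o \<Rightarrow> 'o \<Rightarrow> ('m \<Rightarrow> complex) \<Rightarrow> 'm \<Rightarrow> complex"
  where "chain_step4 c x \<psi> =
    restrict0 (Hom \<one> (x \<otimes>\<^sub>o dR c)) (\<lambda>k. \<psi> ((idm x \<otimes> evR c) \<cdot> (k \<otimes> idm c)))"

definition chain_step5 :: "'o \<Rightarrow> 'o \<Rightarrow> ('m \<Rightarrow> complex) \<Rightarrow> 'm"
  where "chain_step5 c x = inv_into (Hom (x \<otimes>\<^sub>o dR c) \<one>) (pairing (x \<otimes>\<^sub>o dR c))"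

definition chain_step6 :: "'o \<Rightarrow> 'o \<Rightarrow> 'm \<Rightarrow> 'm"
  where "chain_step6 c x k = (k \<otimes> idm (rdual2 C c)) \<cdot> (idm x \<otimes> coevR (dR c))"

definition chain :: "'o \<Rightarrow> 'o \<Rightarrow> 'm \<Rightarrow> 'm"
  where "chain c x = chain_step6 c x \<circ> chain_step5 c x \<circ> chain_step4 c x \<circ>
    chain_step3 c x \<circ> chain_step2 c x \<circ> chain_step1 c x"

text \<open>The morphism representing \<open>chain c\<close>, obtained as in the Yoneda lemma as the image of the
  identity of \<open>**c\<close>.\<close>

definition double_dual_iso :: "'o \<Rightarrow> 'm"
  where "double_dual_iso c = chain c (ldual2 C c) (idm (ldual2 C c))"

end

end

(*
  Everything rests on the pairing Hom(c, 1) x Hom(1, c) -> End(1) being perfect. Schur's lemma and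
  the fundamental theorem of algebra give End(1) = C, and decomposing c into simple objects gives
  finite families u k : 1 -> c and v k : c -> 1 with h = sum u k (v k h) and f = sum (f u k) v k,
  from which both injectivity and surjectivity can be read off.

  Write tr_R(m) for the right trace of m : c -> c** and tr_L(h) for the left trace of h : c -> **c.
  Unwinding the chain shows tr_R(chain(f) h) = tr_L(f h), and since a morphism m : x -> c** is
  determined by the traces tr_R(m h), this characterises both chain(f) and g_c. Monoidality follows
  from the same principle: tr_L of a map c (x) d -> **c (x) **d can be taken first over c and then
  over d, tr_R first over d and then over c, and the two partial traces, being on opposite sides,
  slide past each other; so g_c and g_d can be inserted one at a time.
*)

theory Submission
  imports Defs "HOL-Computational_Algebra.Fundamental_Theorem_Algebra"
begin

section \<open>Morphisms with source and target\<close>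

text \<open>Without a pivotal structure only maps from \<open>c\<close> to one of its double duals
  have a trace, and the left and the right trace ask for different double duals; \<open>g\<close> is
  what compares them. Transposing \<open>m : x -> c**\<close> to \<open>x \<otimes> c* -> 1\<close>
  and bending \<open>h : c -> x\<close> to \<open>1 -> x \<otimes> c*\<close> turns the right trace
  of \<open>m h\<close> into a plain composite \<open>1 -> x \<otimes> c* -> 1\<close>, that is,
  into an instance of the pairing, and likewise on the left with \<open>*c \<otimes> x\<close>. The
  space in the middle of the chain therefore receives the functional \<open>h |-> tr_L(f h)\<close>,
  and the second half of the chain looks for the map whose right trace gives this functional.
  Semisimplicity, finite dimension and simplicity of the unit enter through the pairing alone; what
  remains is calculus with dual pairs. Associativity, whiskering and interchange occur there in
  every line, so the calculus is done on typed arrows, where simplification settles most steps other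
  than the interchange of maps on disjoint strands.\<close>

text \<open>An element of \<open>'m\<close> does not know its source and target. Recording them lets the simplifier
  discharge the typing side conditions of the category axioms.\<close>

datatype ('o, 'm) arrow = Arrow (src: 'o) (mor: 'm) (tgt: 'o)

context strict_monoidal_linear_category
begin

definition typed :: "('a, 'b) arrow \<Rightarrow> bool"
  where "typed A \<longleftrightarrow> mor A \<in> Hom (src A) (tgt A)"

definition Id :: "'a \<Rightarrow> ('a, 'b) arrow"
  where "Id x = Arrow x (idm x) x"

definition cmp :: "('a, 'b) arrow \<Rightarrow> ('a, 'b) arrow \<Rightarrow> ('a, 'b) arrow"  (infixl "\<odot>" 70)
  where "A \<odot> B = Arrow (src B) (mor A \<cdot> mor B) (tgt A)"

definition tns :: "('a, 'b) arrow \<Rightarrow> ('a, 'b) arrow \<Rightarrow> ('a, 'b) arrow"  (infixr "\<boxtimes>" 75)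
  where "A \<boxtimes> B = Arrow (src A \<otimes>\<^sub>o src B) (mor A \<otimes> mor B) (tgt A \<otimes>\<^sub>o tgt B)"

section \<open>Normal forms in a strict monoidal category\<close>

declare tensor_ob_assoc [simp] unit_tensor_ob [simp] tensor_ob_unit [simp]

lemma arrow_simps [simp]:
  "src (Id x) = x" "tgt (Id x) = x" "mor (Id x) = idm x"
  "src (A \<odot> B) = src B" "tgt (A \<odot> B) = tgt A" "mor (A \<odot> B) = mor A \<cdot> mor B"
  "src (A \<boxtimes> B) = src A \<otimes>\<^sub>o src B" "tgt (A \<boxtimes> B) = tgt A \<otimes>\<^sub>o tgt B"
  "mor (A \<boxtimes> B) = mor A \<otimes> mor B"
  by (simp_all add: Id_def cmp_def tns_def)

lemma typed_Id [simp]: "typed (Id x)"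
  and typed_cmp [simp]: "\<lbrakk>typed A; typed B; src A = tgt B\<rbrakk> \<Longrightarrow> typed (A \<odot> B)"
  and typed_tns [simp]: "\<lbrakk>typed A; typed B\<rbrakk> \<Longrightarrow> typed (A \<boxtimes> B)"
  by (auto simp: typed_def ident_hom intro: comp_hom tensor_hom)

lemma arrow_of_hom:
  assumes "f \<in> Hom x y"
  obtains F where "typed F" "src F = x" "tgt F = y" "mor F = f"
  using assms by (metis arrow.sel typed_def)

lemma cmp_assoc [simp]:
  "\<lbrakk>typed A; typed B; typed D; src A = tgt B; src B = tgt D\<rbrakk> \<Longrightarrow> (A \<odot> B) \<odot> D = A \<odot> (B \<odot> D)"
  by (simp add: cmp_def typed_def comp_assoc)

lemma cmp_Id [simp]: "\<lbrakk>typed A; src A = x\<rbrakk> \<Longrightarrow> A \<odot> Id x = A"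
  and Id_cmp [simp]: "\<lbrakk>typed A; tgt A = x\<rbrakk> \<Longrightarrow> Id x \<odot> A = A"
  by (auto simp: cmp_def typed_def comp_ident ident_comp intro: arrow.expand)

lemma tns_assoc [simp]: "\<lbrakk>typed A; typed B; typed D\<rbrakk> \<Longrightarrow> (A \<boxtimes> B) \<boxtimes> D = A \<boxtimes> (B \<boxtimes> D)"
  by (simp add: tns_def typed_def tensor_assoc)

lemma Id_tns_Id [simp]: "Id x \<boxtimes> Id y = Id (x \<otimes>\<^sub>o y)"
  by (simp add: tns_def Id_def tensor_ident)

lemma Id_tns_Id_tns [simp]: "typed A \<Longrightarrow> Id x \<boxtimes> (Id y \<boxtimes> A) = Id (x \<otimes>\<^sub>o y) \<boxtimes> A"
  by (metis Id_tns_Id tns_assoc typed_Id)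

lemma unit_tns [simp]: "typed A \<Longrightarrow> Id \<one> \<boxtimes> A = A"
  and tns_unit [simp]: "typed A \<Longrightarrow> A \<boxtimes> Id \<one> = A"
  by (auto simp: tns_def typed_def unit_tensor tensor_unit intro: arrow.expand)

lemma tns_cmp:
  "\<lbrakk>typed A; typed B; typed A'; typed B'; src A = tgt B; src A' = tgt B'\<rbrakk> \<Longrightarrow>
    (A \<odot> B) \<boxtimes> (A' \<odot> B') = (A \<boxtimes> A') \<odot> (B \<boxtimes> B')"
  by (auto simp: tns_def cmp_def typed_def intro!: interchange)

text \<open>Together with right-nested composites and tensor products, distributing whiskering over
  composition brings both sides of an equation that holds without interchange to a common
  form.\<close>

lemma Id_tns_cmp [simp]:
  "\<lbrakk>typed A; typed B; src A = tgt B\<rbrakk> \<Longrightarrow> Id x \<boxtimes> (A \<odot> B) = (Id x \<boxtimes> A) \<odot> (Id x \<boxtimes> B)"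
  using tns_cmp[of "Id x" "Id x" A B] by simp

lemma cmp_tns_Id [simp]:
  "\<lbrakk>typed A; typed B; src A = tgt B\<rbrakk> \<Longrightarrow> (A \<odot> B) \<boxtimes> Id x = (A \<boxtimes> Id x) \<odot> (B \<boxtimes> Id x)"
  using tns_cmp[of A B "Id x" "Id x"] by simp

lemma tns_left_first:
  "\<lbrakk>typed A; typed B\<rbrakk> \<Longrightarrow> (A \<boxtimes> Id (tgt B)) \<odot> (Id (src A) \<boxtimes> B) = A \<boxtimes> B"
  using tns_cmp[of A "Id (src A)" "Id (tgt B)" B] by simp

lemma tns_right_first:
  "\<lbrakk>typed A; typed B\<rbrakk> \<Longrightarrow> (Id (tgt A) \<boxtimes> B) \<odot> (A \<boxtimes> Id (src B)) = A \<boxtimes> B"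
  using tns_cmp[of "Id (tgt A)" A B "Id (src B)"] by simp

text \<open>Both orders of whiskering equal \<open>A \<boxtimes> B\<close>. Neither side is the
  simpler one, so this is not a rewrite rule: each use names the two arrows that pass each
  other.\<close>

lemma slide:
  "\<lbrakk>typed A; typed B\<rbrakk> \<Longrightarrow>
    (A \<boxtimes> Id (tgt B)) \<odot> (Id (src A) \<boxtimes> B) = (Id (tgt A) \<boxtimes> B) \<odot> (A \<boxtimes> Id (src B))"
  by (simp add: tns_left_first tns_right_first)

end

text \<open>Reversing the tensor product exchanges left and right duals, so it suffices to prove each
  fact about duals on one side.\<close>

definition mirror :: "('o, 'm) fusion_data \<Rightarrow> ('o, 'm) fusion_data"
  where "mirror C = C\<lparr>tensor_ob := \<lambda>x y. tensor_ob C y x, tensor := \<lambda>f g. tensor C g f\<rparr>"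

lemma mirror_simps [simp]:
  "scale (mirror C) = scale C" "hom (mirror C) = hom C" "ident (mirror C) = ident C"
  "comp (mirror C) = comp C" "unit_ob (mirror C) = unit_ob C"
  "tensor_ob (mirror C) x y = tensor_ob C y x" "tensor (mirror C) f g = tensor C g f"
  by (simp_all add: mirror_def)

lemma (in strict_monoidal_linear_category) mirror_strict_monoidal:
  "strict_monoidal_linear_category (mirror C)"
  by (intro strict_monoidal_linear_category.intro linear_category.intro
      strict_monoidal_linear_category_axioms.intro)
    (auto simp: vector_space hom_subspace ident_hom comp_assoc ident_comp comp_ident
      comp_linear_left comp_linear_right tensor_ob_assoc unit_tensor_ob tensor_ob_unit
      tensor_ident tensor_assoc unit_tensor tensor_unit tensor_linear_left tensor_linear_right
      intro: comp_hom tensor_hom interchange)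

section \<open>Dual pairs\<close>

text \<open>Both \<open>(c*, c)\<close>, with \<open>ev\<close> and \<open>coev\<close>, and \<open>(c, *c)\<close>, with \<open>ev'\<close> and \<open>coev'\<close>, are dual pairs.\<close>

definition dual_pair :: "('o, 'm) fusion_data \<Rightarrow> 'o \<Rightarrow> 'o \<Rightarrow> 'm \<Rightarrow> 'm \<Rightarrow> bool"
  where "dual_pair C a b e k \<longleftrightarrow>
    e \<in> hom C (tensor_ob C a b) (unit_ob C) \<and> k \<in> hom C (unit_ob C) (tensor_ob C b a) \<and>
    comp C (tensor C (ident C b) e) (tensor C k (ident C b)) = ident C b \<and>
    comp C (tensor C e (ident C a)) (tensor C (ident C a) k) = ident C a"

text \<open>Reversal exchanges the two objects and the two zigzag equations while \<open>e\<close>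
  and \<open>k\<close> stay the same morphisms. An instance in the mirror category therefore turns a
  statement about left duals into one about right duals.\<close>

lemma dual_pair_mirror [simp]: "dual_pair (mirror C) a b e k \<longleftrightarrow> dual_pair C b a e k"
  by (auto simp: dual_pair_def)

context strict_monoidal_linear_category
begin

lemma dual_pairD:
  assumes "dual_pair C a b e k"
  shows "e \<in> Hom (a \<otimes>\<^sub>o b) \<one>" "k \<in> Hom \<one> (b \<otimes>\<^sub>o a)"
  using assms by (auto simp: dual_pair_def)

lemma dual_pair_arrows:
  assumes "dual_pair C a b e k"
  obtains E K where "typed E" "src E = a \<otimes>\<^sub>o b" "tgt E = \<one>" "mor E = e"
    "typed K" "src K = \<one>" "tgt K = b \<otimes>\<^sub>o a" "mor K = k"
    "(Id b \<boxtimes> E) \<odot> (K \<boxtimes> Id b) = Id b" "(E \<boxtimes> Id a) \<odot> (Id a \<boxtimes> K) = Id a"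
proof -
  obtain E where E: "typed E" "src E = a \<otimes>\<^sub>o b" "tgt E = \<one>" "mor E = e"
    by (rule arrow_of_hom[OF dual_pairD(1)[OF assms]])
  obtain K where K: "typed K" "src K = \<one>" "tgt K = b \<otimes>\<^sub>o a" "mor K = k"
    by (rule arrow_of_hom[OF dual_pairD(2)[OF assms]])
  have "(Id b \<boxtimes> E) \<odot> (K \<boxtimes> Id b) = Id b" "(E \<boxtimes> Id a) \<odot> (Id a \<boxtimes> K) = Id a"
    using assms E K by (auto simp: dual_pair_def intro: arrow.expand)
  with E K show thesis by (rule that)
qed

section \<open>Zigzags, transposition and bending\<close>

lemma snake_whiskered:
  assumes "typed E" "src E = a \<otimes>\<^sub>o b" "tgt E = \<one>" "typed K" "src K = \<one>" "tgt K = b \<otimes>\<^sub>o a"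
    "(E \<boxtimes> Id a) \<odot> (Id a \<boxtimes> K) = Id a"
  shows "(E \<boxtimes> Id (a \<otimes>\<^sub>o x)) \<odot> (Id a \<boxtimes> (K \<boxtimes> Id x)) = Id (a \<otimes>\<^sub>o x)"
  using arg_cong[OF assms(7), of "\<lambda>A. A \<boxtimes> Id x"] assms(1-6) by simp

lemma snake_whiskered':
  assumes "typed E" "src E = a \<otimes>\<^sub>o b" "tgt E = \<one>" "typed K" "src K = \<one>" "tgt K = b \<otimes>\<^sub>o a"
    "(Id b \<boxtimes> E) \<odot> (K \<boxtimes> Id b) = Id b"
  shows "(Id b \<boxtimes> (E \<boxtimes> Id x)) \<odot> (K \<boxtimes> Id (b \<otimes>\<^sub>o x)) = Id (b \<otimes>\<^sub>o x)"
  using arg_cong[OF assms(7), of "\<lambda>A. A \<boxtimes> Id x"] assms(1-6) by simp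

text \<open>\<open>e\<close> and \<open>l\<close> act on disjoint strands; once \<open>l\<close> is
  slid past \<open>e\<close>, the latter meets \<open>k\<close> in the zigzag of
  \<open>a\<close>.\<close>

lemma ev_transpose:
  assumes "dual_pair C a b e k" "l \<in> Hom (a \<otimes>\<^sub>o x) \<one>"
  shows "e \<cdot> (idm a \<otimes> ((idm b \<otimes> l) \<cdot> (k \<otimes> idm x))) = l"
proof -
  obtain E K where E [simp]: "typed E" "src E = a \<otimes>\<^sub>o b" "tgt E = \<one>" "mor E = e"
    and K [simp]: "typed K" "src K = \<one>" "tgt K = b \<otimes>\<^sub>o a" "mor K = k"
    and s: "(Id b \<boxtimes> E) \<odot> (K \<boxtimes> Id b) = Id b" "(E \<boxtimes> Id a) \<odot> (Id a \<boxtimes> K) = Id a"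
    by (rule dual_pair_arrows[OF assms(1)])
  obtain L where L [simp]: "typed L" "src L = a \<otimes>\<^sub>o x" "tgt L = \<one>" "mor L = l"
    by (rule arrow_of_hom[OF assms(2)])
  have "E \<odot> (Id a \<boxtimes> ((Id b \<boxtimes> L) \<odot> (K \<boxtimes> Id x)))
      = (E \<odot> (Id (a \<otimes>\<^sub>o b) \<boxtimes> L)) \<odot> (Id a \<boxtimes> (K \<boxtimes> Id x))"
    by simp
  also have "\<dots> = L \<odot> ((E \<boxtimes> Id (a \<otimes>\<^sub>o x)) \<odot> (Id a \<boxtimes> (K \<boxtimes> Id x)))"
    using slide[of E L] by simp
  also have "\<dots> = L"
    using snake_whiskered[OF E(1-3) K(1-3) s(2)] by simp
  finally have "mor (E \<odot> (Id a \<boxtimes> ((Id b \<boxtimes> L) \<odot> (K \<boxtimes> Id x)))) = mor L" by (rule arg_cong)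
  \<comment> \<open>\<open>mor\<close> has to produce the very term of the claim, so whiskering must
    not be distributed over composition first. The later proofs on typed arrows end in the same
    way.\<close>
  then show ?thesis by (simp del: Id_tns_cmp)
qed

end

text \<open>The duals of morphisms and the comparisons between two duals of one object are both mates, the
  latter with \<open>f\<close> an identity.\<close>

definition mate :: "('o, 'm) fusion_data \<Rightarrow> 'o \<Rightarrow> 'm \<Rightarrow> 'o \<Rightarrow> 'm \<Rightarrow> 'm \<Rightarrow> 'm"
  where "mate C b e' b' k f =
    comp C (comp C (tensor C (ident C b) e') (tensor C (ident C b) (tensor C f (ident C b'))))
      (tensor C k (ident C b'))"

context strict_monoidal_linear_category
begin

lemma transpose_ev:
  assumes "dual_pair C a b e k" "f \<in> Hom x b"
  shows "(idm b \<otimes> (e \<cdot> (idm a \<otimes> f))) \<cdot> (k \<otimes> idm x) = f"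
proof -
  obtain E K where E [simp]: "typed E" "src E = a \<otimes>\<^sub>o b" "tgt E = \<one>" "mor E = e"
    and K [simp]: "typed K" "src K = \<one>" "tgt K = b \<otimes>\<^sub>o a" "mor K = k"
    and s: "(Id b \<boxtimes> E) \<odot> (K \<boxtimes> Id b) = Id b" "(E \<boxtimes> Id a) \<odot> (Id a \<boxtimes> K) = Id a"
    by (rule dual_pair_arrows[OF assms(1)])
  obtain F where F [simp]: "typed F" "src F = x" "tgt F = b" "mor F = f"
    by (rule arrow_of_hom[OF assms(2)])
  have "(Id b \<boxtimes> (E \<odot> (Id a \<boxtimes> F))) \<odot> (K \<boxtimes> Id x)
      = (Id b \<boxtimes> E) \<odot> ((Id (b \<otimes>\<^sub>o a) \<boxtimes> F) \<odot> (K \<boxtimes> Id x))"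
    by simp
  also have "\<dots> = ((Id b \<boxtimes> E) \<odot> (K \<boxtimes> Id b)) \<odot> F"
    using slide[of K F] by simp
  also have "\<dots> = F"
    by (simp add: s del: cmp_assoc)
  finally have "mor ((Id b \<boxtimes> (E \<odot> (Id a \<boxtimes> F))) \<odot> (K \<boxtimes> Id x)) = mor F" by (rule arg_cong)
  then show ?thesis by (simp del: Id_tns_cmp cmp_assoc)
qed

text \<open>Bending trades the source \<open>a\<close> for a tensor factor \<open>b\<close> of the
  target. Sliding \<open>h\<close> past \<open>e\<close> leaves the zigzag of \<open>a\<close>; in
  the opposite composite, \<open>bend_unbend\<close>, it is the zigzag of \<open>b\<close>, tensored
  with \<open>x\<close>.\<close>

lemma unbend_bend:
  assumes "dual_pair C a b e k" "h \<in> Hom a x"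
  shows "(e \<otimes> idm x) \<cdot> (idm a \<otimes> ((idm b \<otimes> h) \<cdot> k)) = h"
proof -
  obtain E K where E [simp]: "typed E" "src E = a \<otimes>\<^sub>o b" "tgt E = \<one>" "mor E = e"
    and K [simp]: "typed K" "src K = \<one>" "tgt K = b \<otimes>\<^sub>o a" "mor K = k"
    and s: "(Id b \<boxtimes> E) \<odot> (K \<boxtimes> Id b) = Id b" "(E \<boxtimes> Id a) \<odot> (Id a \<boxtimes> K) = Id a"
    by (rule dual_pair_arrows[OF assms(1)])
  obtain H where H [simp]: "typed H" "src H = a" "tgt H = x" "mor H = h"
    by (rule arrow_of_hom[OF assms(2)])
  have "(E \<boxtimes> Id x) \<odot> (Id a \<boxtimes> ((Id b \<boxtimes> H) \<odot> K))
      = ((E \<boxtimes> Id x) \<odot> (Id (a \<otimes>\<^sub>o b) \<boxtimes> H)) \<odot> (Id a \<boxtimes> K)"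
    by simp
  also have "\<dots> = H \<odot> ((E \<boxtimes> Id a) \<odot> (Id a \<boxtimes> K))"
    using slide[of E H] by simp
  also have "\<dots> = H"
    by (simp add: s)
  finally have "mor ((E \<boxtimes> Id x) \<odot> (Id a \<boxtimes> ((Id b \<boxtimes> H) \<odot> K))) = mor H" by (rule arg_cong)
  then show ?thesis by (simp del: Id_tns_cmp cmp_assoc)
qed

lemma bend_unbend:
  assumes "dual_pair C a b e k" "l \<in> Hom \<one> (b \<otimes>\<^sub>o x)"
  shows "(idm b \<otimes> ((e \<otimes> idm x) \<cdot> (idm a \<otimes> l))) \<cdot> k = l"
proof -
  obtain E K where E [simp]: "typed E" "src E = a \<otimes>\<^sub>o b" "tgt E = \<one>" "mor E = e"
    and K [simp]: "typed K" "src K = \<one>" "tgt K = b \<otimes>\<^sub>o a" "mor K = k"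
    and s: "(Id b \<boxtimes> E) \<odot> (K \<boxtimes> Id b) = Id b" "(E \<boxtimes> Id a) \<odot> (Id a \<boxtimes> K) = Id a"
    by (rule dual_pair_arrows[OF assms(1)])
  obtain L where L [simp]: "typed L" "src L = \<one>" "tgt L = b \<otimes>\<^sub>o x" "mor L = l"
    by (rule arrow_of_hom[OF assms(2)])
  have "(Id b \<boxtimes> ((E \<boxtimes> Id x) \<odot> (Id a \<boxtimes> L))) \<odot> K
      = (Id b \<boxtimes> (E \<boxtimes> Id x)) \<odot> ((Id (b \<otimes>\<^sub>o a) \<boxtimes> L) \<odot> K)"
    by simp
  also have "\<dots> = ((Id b \<boxtimes> (E \<boxtimes> Id x)) \<odot> (K \<boxtimes> Id (b \<otimes>\<^sub>o x))) \<odot> L"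
    using slide[of K L] by simp
  also have "\<dots> = L"
    using snake_whiskered'[OF E(1-3) K(1-3) s(1)] by (simp del: cmp_assoc)
  finally have "mor ((Id b \<boxtimes> ((E \<boxtimes> Id x) \<odot> (Id a \<boxtimes> L))) \<odot> K) = mor L" by (rule arg_cong)
  then show ?thesis by (simp del: Id_tns_cmp cmp_assoc)
qed

lemma mate_hom:
  assumes "dual_pair C a b e k" "dual_pair C a' b' e' k'" "f \<in> Hom a a'"
  shows "mate C b e' b' k f \<in> Hom b' b"
proof -
  obtain K where K [simp]: "typed K" "src K = \<one>" "tgt K = b \<otimes>\<^sub>o a" "mor K = k"
    by (rule arrow_of_hom[OF dual_pairD(2)[OF assms(1)]])
  obtain E' where E' [simp]: "typed E'" "src E' = a' \<otimes>\<^sub>o b'" "tgt E' = \<one>" "mor E' = e'"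
    by (rule arrow_of_hom[OF dual_pairD(1)[OF assms(2)]])
  obtain F where F [simp]: "typed F" "src F = a" "tgt F = a'" "mor F = f"
    by (rule arrow_of_hom[OF assms(3)])
  have "typed ((Id b \<boxtimes> E') \<odot> (Id b \<boxtimes> (F \<boxtimes> Id b')) \<odot> (K \<boxtimes> Id b'))"
    by (simp del: cmp_assoc)
  then show ?thesis by (simp add: typed_def mate_def del: cmp_assoc)
qed

text \<open>The mate is the inverse transpose of \<open>e' \<cdot> (f \<otimes> idm b')\<close>, so
  \<open>ev_transpose\<close> applies. This equation and its twin \<open>coev_mate\<close> stand in
  for the explicit formula of a dual morphism in all later arguments.\<close>

lemma ev_mate:
  assumes "dual_pair C a b e k" "dual_pair C a' b' e' k'" "f \<in> Hom a a'"
  shows "e \<cdot> (idm a \<otimes> mate C b e' b' k f) = e' \<cdot> (f \<otimes> idm b')"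
proof -
  obtain E' where E' [simp]: "typed E'" "src E' = a' \<otimes>\<^sub>o b'" "tgt E' = \<one>" "mor E' = e'"
    by (rule arrow_of_hom[OF dual_pairD(1)[OF assms(2)]])
  obtain F where F [simp]: "typed F" "src F = a" "tgt F = a'" "mor F = f"
    by (rule arrow_of_hom[OF assms(3)])
  have "mor ((Id b \<boxtimes> E') \<odot> (Id b \<boxtimes> (F \<boxtimes> Id b'))) = mor (Id b \<boxtimes> (E' \<odot> (F \<boxtimes> Id b')))"
    by simp
  then have "mate C b e' b' k f = (idm b \<otimes> (e' \<cdot> (f \<otimes> idm b'))) \<cdot> (k \<otimes> idm b')"
    by (simp add: mate_def del: Id_tns_cmp)
  moreover have "typed (E' \<odot> (F \<boxtimes> Id b'))" by simp
  then have "e' \<cdot> (f \<otimes> idm b') \<in> Hom (a \<otimes>\<^sub>o b') \<one>" by (simp add: typed_def)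
  ultimately show ?thesis using ev_transpose[OF assms(1)] by metis
qed

text \<open>\<open>k'\<close> slides past \<open>k\<close> and then past \<open>f\<close> until it
  meets \<open>e'\<close>; the zigzag of \<open>a'\<close> removes both.\<close>

lemma coev_mate:
  assumes "dual_pair C a b e k" "dual_pair C a' b' e' k'" "f \<in> Hom a a'"
  shows "(mate C b e' b' k f \<otimes> idm a') \<cdot> k' = (idm b \<otimes> f) \<cdot> k"
proof -
  obtain E K where E [simp]: "typed E" "src E = a \<otimes>\<^sub>o b" "tgt E = \<one>" "mor E = e"
    and K [simp]: "typed K" "src K = \<one>" "tgt K = b \<otimes>\<^sub>o a" "mor K = k"
    and s: "(Id b \<boxtimes> E) \<odot> (K \<boxtimes> Id b) = Id b" "(E \<boxtimes> Id a) \<odot> (Id a \<boxtimes> K) = Id a"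
    by (rule dual_pair_arrows[OF assms(1)])
  obtain E' K' where E' [simp]: "typed E'" "src E' = a' \<otimes>\<^sub>o b'" "tgt E' = \<one>" "mor E' = e'"
    and K' [simp]: "typed K'" "src K' = \<one>" "tgt K' = b' \<otimes>\<^sub>o a'" "mor K' = k'"
    and s: "(Id b' \<boxtimes> E') \<odot> (K' \<boxtimes> Id b') = Id b'" "(E' \<boxtimes> Id a') \<odot> (Id a' \<boxtimes> K') = Id a'"
    by (rule dual_pair_arrows[OF assms(2)])
  obtain F where F [simp]: "typed F" "src F = a" "tgt F = a'" "mor F = f"
    by (rule arrow_of_hom[OF assms(3)])
  let ?M = "(Id b \<boxtimes> E') \<odot> (Id b \<boxtimes> (F \<boxtimes> Id b')) \<odot> (K \<boxtimes> Id b')"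
  have "(?M \<boxtimes> Id a') \<odot> K' = (Id b \<boxtimes> ((E' \<boxtimes> Id a') \<odot> (F \<boxtimes> Id (b' \<otimes>\<^sub>o a')))) \<odot>
      ((K \<boxtimes> Id (b' \<otimes>\<^sub>o a')) \<odot> K')"
    by simp
  also have "(K \<boxtimes> Id (b' \<otimes>\<^sub>o a')) \<odot> K' = (Id b \<boxtimes> (Id a \<boxtimes> K')) \<odot> K"
    using slide[of K K'] by simp
  also have "(Id b \<boxtimes> ((E' \<boxtimes> Id a') \<odot> (F \<boxtimes> Id (b' \<otimes>\<^sub>o a')))) \<odot> \<dots>
      = (Id b \<boxtimes> ((E' \<boxtimes> Id a') \<odot> ((F \<boxtimes> Id (b' \<otimes>\<^sub>o a')) \<odot> (Id a \<boxtimes> K')))) \<odot> K"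
    by simp
  also have "\<dots> = (Id b \<boxtimes> (((E' \<boxtimes> Id a') \<odot> (Id a' \<boxtimes> K')) \<odot> F)) \<odot> K"
    using slide[of F K'] by simp
  also have "\<dots> = (Id b \<boxtimes> F) \<odot> K"
    by (simp add: s del: cmp_assoc)
  finally have "mor ((?M \<boxtimes> Id a') \<odot> K') = mor ((Id b \<boxtimes> F) \<odot> K)" by (rule arg_cong)
  then show ?thesis by (simp add: mate_def del: Id_tns_cmp cmp_tns_Id cmp_assoc)
qed

section \<open>Nested dual pairs\<close>

lemma nested_snake:
  assumes "dual_pair C a1 b1 e1 k1" "dual_pair C a2 b2 e2 k2"
  shows "(idm (b1 \<otimes>\<^sub>o b2) \<otimes> (e2 \<cdot> (idm a2 \<otimes> e1 \<otimes> idm b2))) \<cdot>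
    (((idm b1 \<otimes> k2 \<otimes> idm a1) \<cdot> k1) \<otimes> idm (b1 \<otimes>\<^sub>o b2)) = idm (b1 \<otimes>\<^sub>o b2)"
proof -
  obtain E1 K1 where E1 [simp]: "typed E1" "src E1 = a1 \<otimes>\<^sub>o b1" "tgt E1 = \<one>" "mor E1 = e1"
    and K1 [simp]: "typed K1" "src K1 = \<one>" "tgt K1 = b1 \<otimes>\<^sub>o a1" "mor K1 = k1"
    and s1: "(Id b1 \<boxtimes> E1) \<odot> (K1 \<boxtimes> Id b1) = Id b1" "(E1 \<boxtimes> Id a1) \<odot> (Id a1 \<boxtimes> K1) = Id a1"
    by (rule dual_pair_arrows[OF assms(1)])
  obtain E2 K2 where E2 [simp]: "typed E2" "src E2 = a2 \<otimes>\<^sub>o b2" "tgt E2 = \<one>" "mor E2 = e2"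
    and K2 [simp]: "typed K2" "src K2 = \<one>" "tgt K2 = b2 \<otimes>\<^sub>o a2" "mor K2 = k2"
    and s2: "(Id b2 \<boxtimes> E2) \<odot> (K2 \<boxtimes> Id b2) = Id b2" "(E2 \<boxtimes> Id a2) \<odot> (Id a2 \<boxtimes> K2) = Id a2"
    by (rule dual_pair_arrows[OF assms(2)])
  have "(Id (b1 \<otimes>\<^sub>o b2) \<boxtimes> (E2 \<odot> (Id a2 \<boxtimes> E1 \<boxtimes> Id b2))) \<odot>
      (((Id b1 \<boxtimes> K2 \<boxtimes> Id a1) \<odot> K1) \<boxtimes> Id (b1 \<otimes>\<^sub>o b2))
    = (Id b1 \<boxtimes> ((Id b2 \<boxtimes> E2) \<odot> ((Id (b2 \<otimes>\<^sub>o a2) \<boxtimes> (E1 \<boxtimes> Id b2)) \<odot>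
      (K2 \<boxtimes> Id (a1 \<otimes>\<^sub>o b1 \<otimes>\<^sub>o b2))))) \<odot> (K1 \<boxtimes> Id (b1 \<otimes>\<^sub>o b2))"
    by simp
  \<comment> \<open>The inner coevaluation \<open>K2\<close> slides past the inner evaluation
    \<open>E1\<close> and meets \<open>E2\<close>. Straightening this zigzag of the second pair
    leaves the zigzag of the first.\<close>
  also have "\<dots> = (Id b1 \<boxtimes> (((Id b2 \<boxtimes> E2) \<odot> (K2 \<boxtimes> Id b2)) \<odot> (E1 \<boxtimes> Id b2))) \<odot>
      (K1 \<boxtimes> Id (b1 \<otimes>\<^sub>o b2))"
    using slide[of K2 "E1 \<boxtimes> Id b2"] by simp
  also have "\<dots> = ((Id b1 \<boxtimes> E1) \<odot> (K1 \<boxtimes> Id b1)) \<boxtimes> Id b2"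
    unfolding s2 by simp
  also have "\<dots> = Id (b1 \<otimes>\<^sub>o b2)"
    unfolding s1 by simp
  finally have "mor ((Id (b1 \<otimes>\<^sub>o b2) \<boxtimes> (E2 \<odot> (Id a2 \<boxtimes> E1 \<boxtimes> Id b2))) \<odot>
      (((Id b1 \<boxtimes> K2 \<boxtimes> Id a1) \<odot> K1) \<boxtimes> Id (b1 \<otimes>\<^sub>o b2))) = mor (Id (b1 \<otimes>\<^sub>o b2))"
    by (rule arg_cong)
  then show ?thesis by (simp del: Id_tns_cmp cmp_tns_Id cmp_assoc)
qed

lemma nested_ev_coev_hom:
  assumes "dual_pair C a1 b1 e1 k1" "dual_pair C a2 b2 e2 k2"
  shows "e2 \<cdot> (idm a2 \<otimes> e1 \<otimes> idm b2) \<in> Hom ((a2 \<otimes>\<^sub>o a1) \<otimes>\<^sub>o (b1 \<otimes>\<^sub>o b2)) \<one>"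
    and "(idm b1 \<otimes> k2 \<otimes> idm a1) \<cdot> k1 \<in> Hom \<one> ((b1 \<otimes>\<^sub>o b2) \<otimes>\<^sub>o (a2 \<otimes>\<^sub>o a1))"
proof -
  obtain E1 K1 where E1 [simp]: "typed E1" "src E1 = a1 \<otimes>\<^sub>o b1" "tgt E1 = \<one>" "mor E1 = e1"
    and K1 [simp]: "typed K1" "src K1 = \<one>" "tgt K1 = b1 \<otimes>\<^sub>o a1" "mor K1 = k1"
    and s1: "(Id b1 \<boxtimes> E1) \<odot> (K1 \<boxtimes> Id b1) = Id b1" "(E1 \<boxtimes> Id a1) \<odot> (Id a1 \<boxtimes> K1) = Id a1"
    by (rule dual_pair_arrows[OF assms(1)])
  obtain E2 K2 where E2 [simp]: "typed E2" "src E2 = a2 \<otimes>\<^sub>o b2" "tgt E2 = \<one>" "mor E2 = e2"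
    and K2 [simp]: "typed K2" "src K2 = \<one>" "tgt K2 = b2 \<otimes>\<^sub>o a2" "mor K2 = k2"
    and s2: "(Id b2 \<boxtimes> E2) \<odot> (K2 \<boxtimes> Id b2) = Id b2" "(E2 \<boxtimes> Id a2) \<odot> (Id a2 \<boxtimes> K2) = Id a2"
    by (rule dual_pair_arrows[OF assms(2)])
  have "typed (E2 \<odot> (Id a2 \<boxtimes> E1 \<boxtimes> Id b2))" "typed ((Id b1 \<boxtimes> K2 \<boxtimes> Id a1) \<odot> K1)"
    by simp_all
  then show "e2 \<cdot> (idm a2 \<otimes> e1 \<otimes> idm b2) \<in> Hom ((a2 \<otimes>\<^sub>o a1) \<otimes>\<^sub>o (b1 \<otimes>\<^sub>o b2)) \<one>"
    "(idm b1 \<otimes> k2 \<otimes> idm a1) \<cdot> k1 \<in> Hom \<one> ((b1 \<otimes>\<^sub>o b2) \<otimes>\<^sub>o (a2 \<otimes>\<^sub>o a1))"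
    by (simp_all add: typed_def)
qed

text \<open>\<open>nested_snake\<close> is one of the two zigzags. The same statement in the mirror
  category is the other one, up to the bracketing of the triple tensor products.\<close>

lemma dual_pair_nested:
  assumes "dual_pair C a1 b1 e1 k1" "dual_pair C a2 b2 e2 k2"
  shows "dual_pair C (a2 \<otimes>\<^sub>o a1) (b1 \<otimes>\<^sub>o b2)
    (e2 \<cdot> (idm a2 \<otimes> e1 \<otimes> idm b2)) ((idm b1 \<otimes> k2 \<otimes> idm a1) \<cdot> k1)"
proof -
  have "(idm a2 \<otimes> e1) \<otimes> idm b2 = idm a2 \<otimes> e1 \<otimes> idm b2"
    "(idm b1 \<otimes> k2) \<otimes> idm a1 = idm b1 \<otimes> k2 \<otimes> idm a1"
    using assms by (auto simp: dual_pair_def intro!: tensor_assoc ident_hom)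
  then show ?thesis
    using strict_monoidal_linear_category.nested_snake[OF mirror_strict_monoidal, of b1 a1 e1 k1 b2 a2 e2 k2]
      nested_snake[OF assms] nested_ev_coev_hom[OF assms] assms
    by (simp add: dual_pair_def)
qed

text \<open>Cyclicity for traces with values in a dual: \<open>n\<close> leaves the traced strand,
  reappears as \<open>p\<close> on the dual strand, and there is absorbed into the coevaluation.
  This is how traces formed with different duals of one object are compared.\<close>

lemma trace_slide:
  assumes "e \<in> Hom (v \<otimes>\<^sub>o y) \<one>" "e' \<in> Hom (v' \<otimes>\<^sub>o y') \<one>" "k \<in> Hom \<one> (v \<otimes>\<^sub>o u)"
    "n \<in> Hom y' y" "p \<in> Hom v v'" "m \<in> Hom u y'"
    and en: "e \<cdot> (idm v \<otimes> n) = e' \<cdot> (p \<otimes> idm y')" and pk: "(p \<otimes> idm u) \<cdot> k = k'"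
  shows "e \<cdot> (idm v \<otimes> (n \<cdot> m)) \<cdot> k = e' \<cdot> (idm v' \<otimes> m) \<cdot> k'"
proof -
  obtain E where [simp]: "typed E" "src E = v \<otimes>\<^sub>o y" "tgt E = \<one>" "mor E = e"
    by (rule arrow_of_hom[OF assms(1)])
  obtain E' where [simp]: "typed E'" "src E' = v' \<otimes>\<^sub>o y'" "tgt E' = \<one>" "mor E' = e'"
    by (rule arrow_of_hom[OF assms(2)])
  obtain K where [simp]: "typed K" "src K = \<one>" "tgt K = v \<otimes>\<^sub>o u" "mor K = k"
    by (rule arrow_of_hom[OF assms(3)])
  obtain N where [simp]: "typed N" "src N = y'" "tgt N = y" "mor N = n"
    by (rule arrow_of_hom[OF assms(4)])
  obtain P where [simp]: "typed P" "src P = v" "tgt P = v'" "mor P = p"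
    by (rule arrow_of_hom[OF assms(5)])
  obtain M where [simp]: "typed M" "src M = u" "tgt M = y'" "mor M = m"
    by (rule arrow_of_hom[OF assms(6)])
  have en': "E \<odot> (Id v \<boxtimes> N) = E' \<odot> (P \<boxtimes> Id y')"
    using en by (intro arrow.expand) simp
  have "E \<odot> (Id v \<boxtimes> (N \<odot> M)) \<odot> K = (E \<odot> (Id v \<boxtimes> N)) \<odot> ((Id v \<boxtimes> M) \<odot> K)"
    by simp
  also have "\<dots> = E' \<odot> (((P \<boxtimes> Id y') \<odot> (Id v \<boxtimes> M)) \<odot> K)"
    unfolding en' by simp
  also have "\<dots> = E' \<odot> (Id v' \<boxtimes> M) \<odot> ((P \<boxtimes> Id u) \<odot> K)"
    using slide[of P M] by simp
  finally have "mor (E \<odot> (Id v \<boxtimes> (N \<odot> M)) \<odot> K) = mor (E' \<odot> (Id v' \<boxtimes> M) \<odot> ((P \<boxtimes> Id u) \<odot> K))"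
    by (rule arg_cong)
  then show ?thesis by (simp add: pk del: Id_tns_cmp cmp_assoc)
qed

text \<open>\<open>e1\<close> and \<open>k1\<close> live to the left of \<open>h\<close>,
  \<open>e2\<close> and \<open>k2\<close> to its right. One interchange of the two evaluations and
  one of the two coevaluations suffice, and \<open>h\<close> stays in place.\<close>

lemma partial_traces:
  assumes "e1 \<in> Hom (b \<otimes>\<^sub>o y1) \<one>" "k1 \<in> Hom \<one> (b \<otimes>\<^sub>o c1)"
    "e2 \<in> Hom (y2 \<otimes>\<^sub>o a) \<one>" "k2 \<in> Hom \<one> (c2 \<otimes>\<^sub>o a)" "h \<in> Hom (c1 \<otimes>\<^sub>o c2) (y1 \<otimes>\<^sub>o y2)"
  shows "e1 \<cdot> (idm b \<otimes> ((idm y1 \<otimes> e2) \<cdot> (h \<otimes> idm a) \<cdot> (idm c1 \<otimes> k2))) \<cdot> k1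
    = e2 \<cdot> (((e1 \<otimes> idm y2) \<cdot> (idm b \<otimes> h) \<cdot> (k1 \<otimes> idm c2)) \<otimes> idm a) \<cdot> k2"
proof -
  obtain E1 where [simp]: "typed E1" "src E1 = b \<otimes>\<^sub>o y1" "tgt E1 = \<one>" "mor E1 = e1"
    by (rule arrow_of_hom[OF assms(1)])
  obtain K1 where [simp]: "typed K1" "src K1 = \<one>" "tgt K1 = b \<otimes>\<^sub>o c1" "mor K1 = k1"
    by (rule arrow_of_hom[OF assms(2)])
  obtain E2 where [simp]: "typed E2" "src E2 = y2 \<otimes>\<^sub>o a" "tgt E2 = \<one>" "mor E2 = e2"
    by (rule arrow_of_hom[OF assms(3)])
  obtain K2 where [simp]: "typed K2" "src K2 = \<one>" "tgt K2 = c2 \<otimes>\<^sub>o a" "mor K2 = k2"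
    by (rule arrow_of_hom[OF assms(4)])
  obtain H where [simp]: "typed H" "src H = c1 \<otimes>\<^sub>o c2" "tgt H = y1 \<otimes>\<^sub>o y2" "mor H = h"
    by (rule arrow_of_hom[OF assms(5)])
  have "E1 \<odot> (Id b \<boxtimes> ((Id y1 \<boxtimes> E2) \<odot> (H \<boxtimes> Id a) \<odot> (Id c1 \<boxtimes> K2))) \<odot> K1
    = (E1 \<odot> (Id (b \<otimes>\<^sub>o y1) \<boxtimes> E2)) \<odot> ((Id b \<boxtimes> (H \<boxtimes> Id a)) \<odot> ((Id (b \<otimes>\<^sub>o c1) \<boxtimes> K2) \<odot> K1))"
    by simp
  also have "E1 \<odot> (Id (b \<otimes>\<^sub>o y1) \<boxtimes> E2) = E2 \<odot> (E1 \<boxtimes> Id (y2 \<otimes>\<^sub>o a))"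
    using slide[of E1 E2] by simp
  also have "(Id (b \<otimes>\<^sub>o c1) \<boxtimes> K2) \<odot> K1 = (K1 \<boxtimes> Id (c2 \<otimes>\<^sub>o a)) \<odot> K2"
    using slide[of K1 K2] by simp
  also have "(E2 \<odot> (E1 \<boxtimes> Id (y2 \<otimes>\<^sub>o a))) \<odot>
      ((Id b \<boxtimes> (H \<boxtimes> Id a)) \<odot> ((K1 \<boxtimes> Id (c2 \<otimes>\<^sub>o a)) \<odot> K2))
    = E2 \<odot> (((E1 \<boxtimes> Id y2) \<odot> (Id b \<boxtimes> H) \<odot> (K1 \<boxtimes> Id c2)) \<boxtimes> Id a) \<odot> K2"
    by simp
  finally have "mor (E1 \<odot> (Id b \<boxtimes> ((Id y1 \<boxtimes> E2) \<odot> (H \<boxtimes> Id a) \<odot> (Id c1 \<boxtimes> K2))) \<odot> K1)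
    = mor (E2 \<odot> (((E1 \<boxtimes> Id y2) \<odot> (Id b \<boxtimes> H) \<odot> (K1 \<boxtimes> Id c2)) \<boxtimes> Id a) \<odot> K2)"
    by (rule arg_cong)
  then show ?thesis by (simp del: Id_tns_cmp cmp_tns_Id cmp_assoc)
qed

text \<open>A nested evaluation and coevaluation close the inner strand before the outer one.
  Distributing the whiskerings on both sides makes them coincide.\<close>

lemma nested_trace:
  assumes "e1 \<in> Hom (b1 \<otimes>\<^sub>o y1) \<one>" "k1 \<in> Hom \<one> (b1 \<otimes>\<^sub>o c1)"
    "e2 \<in> Hom (b2 \<otimes>\<^sub>o y2) \<one>" "k2 \<in> Hom \<one> (b2 \<otimes>\<^sub>o c2)" "h \<in> Hom (c1 \<otimes>\<^sub>o c2) (y1 \<otimes>\<^sub>o y2)"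
  shows "(e2 \<cdot> (idm b2 \<otimes> e1 \<otimes> idm y2)) \<cdot> (idm (b2 \<otimes>\<^sub>o b1) \<otimes> h) \<cdot> ((idm b2 \<otimes> k1 \<otimes> idm c2) \<cdot> k2)
    = e2 \<cdot> (idm b2 \<otimes> ((e1 \<otimes> idm y2) \<cdot> (idm b1 \<otimes> h) \<cdot> (k1 \<otimes> idm c2))) \<cdot> k2"
proof -
  obtain E1 where [simp]: "typed E1" "src E1 = b1 \<otimes>\<^sub>o y1" "tgt E1 = \<one>" "mor E1 = e1"
    by (rule arrow_of_hom[OF assms(1)])
  obtain K1 where [simp]: "typed K1" "src K1 = \<one>" "tgt K1 = b1 \<otimes>\<^sub>o c1" "mor K1 = k1"
    by (rule arrow_of_hom[OF assms(2)])
  obtain E2 where [simp]: "typed E2" "src E2 = b2 \<otimes>\<^sub>o y2" "tgt E2 = \<one>" "mor E2 = e2"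
    by (rule arrow_of_hom[OF assms(3)])
  obtain K2 where [simp]: "typed K2" "src K2 = \<one>" "tgt K2 = b2 \<otimes>\<^sub>o c2" "mor K2 = k2"
    by (rule arrow_of_hom[OF assms(4)])
  obtain H where [simp]: "typed H" "src H = c1 \<otimes>\<^sub>o c2" "tgt H = y1 \<otimes>\<^sub>o y2" "mor H = h"
    by (rule arrow_of_hom[OF assms(5)])
  have "(E2 \<odot> (Id b2 \<boxtimes> E1 \<boxtimes> Id y2)) \<odot> (Id (b2 \<otimes>\<^sub>o b1) \<boxtimes> H) \<odot> ((Id b2 \<boxtimes> K1 \<boxtimes> Id c2) \<odot> K2)
    = E2 \<odot> (Id b2 \<boxtimes> ((E1 \<boxtimes> Id y2) \<odot> (Id b1 \<boxtimes> H) \<odot> (K1 \<boxtimes> Id c2))) \<odot> K2"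
    by simp
  then have "mor ((E2 \<odot> (Id b2 \<boxtimes> E1 \<boxtimes> Id y2)) \<odot> (Id (b2 \<otimes>\<^sub>o b1) \<boxtimes> H) \<odot> ((Id b2 \<boxtimes> K1 \<boxtimes> Id c2) \<odot> K2))
    = mor (E2 \<odot> (Id b2 \<boxtimes> ((E1 \<boxtimes> Id y2) \<odot> (Id b1 \<boxtimes> H) \<odot> (K1 \<boxtimes> Id c2))) \<odot> K2)"
    by (rule arg_cong)
  then show ?thesis by (simp del: Id_tns_cmp cmp_tns_Id cmp_assoc)
qed

end

section \<open>Schur's lemma and the pairing\<close>

context linear_category
begin

interpretation vs: vector_space "scale C"
  by (rule vector_space)

lemma hom_zero [simp]: "0 \<in> Hom x y"
  and hom_add: "\<lbrakk>f \<in> Hom x y; g \<in> Hom x y\<rbrakk> \<Longrightarrow> f + g \<in> Hom x y"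
  and hom_diff: "\<lbrakk>f \<in> Hom x y; g \<in> Hom x y\<rbrakk> \<Longrightarrow> f - g \<in> Hom x y"
  and hom_scale: "f \<in> Hom x y \<Longrightarrow> scale C z f \<in> Hom x y"
  and hom_sum: "(\<And>k. k \<in> K \<Longrightarrow> t k \<in> Hom x y) \<Longrightarrow> sum t K \<in> Hom x y"
  using hom_subspace[of x y]
  by (auto intro: vs.subspace_0 vs.subspace_add vs.subspace_diff vs.subspace_scale vs.subspace_sum)

lemma comp_add_left: "\<lbrakk>f \<in> Hom x y; g \<in> Hom y z; g' \<in> Hom y z\<rbrakk> \<Longrightarrow> (g + g') \<cdot> f = g \<cdot> f + g' \<cdot> f"
  and comp_scale_left: "\<lbrakk>f \<in> Hom x y; g \<in> Hom y z\<rbrakk> \<Longrightarrow> scale C r g \<cdot> f = scale C r (g \<cdot> f)"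
  using comp_linear_left[of f x y z] by (auto simp: linear_map_on_def)

lemma comp_add_right: "\<lbrakk>g \<in> Hom y z; f \<in> Hom x y; f' \<in> Hom x y\<rbrakk> \<Longrightarrow> g \<cdot> (f + f') = g \<cdot> f + g \<cdot> f'"
  and comp_scale_right: "\<lbrakk>g \<in> Hom y z; f \<in> Hom x y\<rbrakk> \<Longrightarrow> g \<cdot> scale C r f = scale C r (g \<cdot> f)"
  using comp_linear_right[of g y z x] by (auto simp: linear_map_on_def)

lemma comp_zero_left [simp]: "f \<in> Hom x y \<Longrightarrow> 0 \<cdot> f = 0"
  and comp_zero_right [simp]: "g \<in> Hom y z \<Longrightarrow> g \<cdot> 0 = 0"
  using comp_scale_left[of f x y 0 _ 0] comp_scale_right[of g y z 0 _ 0] hom_zero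
  by (metis vs.scale_zero_left)+

lemma comp_diff_right:
  "\<lbrakk>g \<in> Hom y z; f \<in> Hom x y; f' \<in> Hom x y\<rbrakk> \<Longrightarrow> g \<cdot> (f - f') = g \<cdot> f - g \<cdot> f'"
  using comp_add_right[of g y z "f - f'" x f'] by (simp add: hom_diff algebra_simps)

lemma comp_sum_left:
  assumes "f \<in> Hom x y" "\<And>k. k \<in> K \<Longrightarrow> t k \<in> Hom y z"
  shows "sum t K \<cdot> f = (\<Sum>k\<in>K. t k \<cdot> f)"
  using assms(2)
  by (induction K rule: infinite_finite_induct)
    (simp_all add: comp_add_left[where z = z, OF assms(1)] hom_sum comp_zero_left[OF assms(1)])

lemma comp_sum_right:
  assumes "g \<in> Hom y z" "\<And>k. k \<in> K \<Longrightarrow> t k \<in> Hom x y"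
  shows "g \<cdot> sum t K = (\<Sum>k\<in>K. g \<cdot> t k)"
  using assms(2)
  by (induction K rule: infinite_finite_induct)
    (simp_all add: comp_add_right[where x = x, OF assms(1)] hom_sum comp_zero_right[OF assms(1)])

text \<open>Horner's scheme for p(f). The algebra \<open>Hom x x\<close> is a subset of
  \<open>'m\<close> whose unit and product depend on \<open>x\<close> and on the category, so the
  evaluation is written out by a fold instead of with ring operations.\<close>

definition poly_at :: "'m \<Rightarrow> 'o \<Rightarrow> complex poly \<Rightarrow> 'm"
  where "poly_at f x p = fold_coeffs (\<lambda>a r. scale C a (idm x) + f \<cdot> r) p 0"

context
  fixes f x
  assumes f: "f \<in> Hom x x"
begin

lemma poly_at_0 [simp]: "poly_at f x 0 = 0"
  by (simp add: poly_at_def)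

lemma poly_at_pCons [simp]: "poly_at f x (pCons a p) = scale C a (idm x) + f \<cdot> poly_at f x p"
  using f by (cases "p = 0 \<and> a = 0") (auto simp: poly_at_def)

lemma poly_at_hom: "poly_at f x p \<in> Hom x x"
  by (induction p) (auto intro: hom_add hom_scale ident_hom comp_hom f)

lemma poly_at_add: "poly_at f x (p + q) = poly_at f x p + poly_at f x q"
proof (induction p q rule: poly_induct2)
  case (pCons a p b q)
  then show ?case
    by (simp add: comp_add_right[OF f poly_at_hom poly_at_hom] vs.scale_left_distrib)
qed simp

lemma poly_at_smult: "poly_at f x (smult a p) = scale C a (poly_at f x p)"
  by (induction p) (simp_all add: comp_scale_right[OF f poly_at_hom] vs.scale_right_distrib)

lemma poly_at_sum: "poly_at f x (sum p K) = (\<Sum>k\<in>K. poly_at f x (p k))"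
  by (induction K rule: infinite_finite_induct) (simp_all add: poly_at_add)

lemma poly_at_monom: "poly_at f x (monom a k) = scale C a (((\<cdot>) f ^^ k) (idm x))"
proof -
  have "poly_at f x (monom 1 k) = ((\<cdot>) f ^^ k) (idm x)"
    by (induction k) (simp_all add: monom_0 monom_Suc comp_zero_right[OF f])
  then show ?thesis using poly_at_smult[of a "monom 1 k"] by (simp add: smult_monom)
qed

text \<open>The case of multiplicativity that splitting off a root calls for. The linear factor acts
  from the left because Horner's scheme composes with \<open>f\<close> from the left.\<close>

lemma poly_at_linear_factor:
  "poly_at f x ([:- z, 1:] * q) = (f - scale C z (idm x)) \<cdot> poly_at f x q"
proof -
  have "(f + scale C (- z) (idm x)) \<cdot> poly_at f x q
      = f \<cdot> poly_at f x q + scale C (- z) (poly_at f x q)"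
    using poly_at_hom[of q] f
    by (simp only: comp_add_left[OF _ f hom_scale[OF ident_hom]] comp_scale_left[OF _ ident_hom]
        ident_comp)
  moreover have "[:- z, 1:] * q = pCons 0 q + smult (- z) q" by simp
  ultimately show ?thesis
    by (simp add: poly_at_add poly_at_smult del: mult_pCons_left smult_minus_left)
qed

lemma annihilating_poly:
  assumes "finite B" "vs.span B = Hom x x"
  shows "\<exists>p. p \<noteq> 0 \<and> poly_at f x p = 0"
proof -
  define P where "P k = ((\<cdot>) f ^^ k) (idm x)" for k
  have P: "P k \<in> Hom x x" for k
    by (induction k) (auto simp: P_def intro: ident_hom comp_hom f)
  \<comment> \<open>These are \<open>card B + 1\<close> exponents, one more than a spanning set has
    elements.\<close>
  let ?N = "{..card B}"
  \<comment> \<open>Linear dependence concerns the set of powers, which has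
    \<open>card B + 1\<close> elements only if the powers are distinct. Two equal powers give the
    annihilating difference of two monomials directly.\<close>
  show ?thesis
  proof (cases "inj_on P ?N")
    case True
    have "vs.dependent (P ` ?N)"
      using vs.independent_span_bound[OF assms(1), of "P ` ?N"] assms(2) P True
      by (auto simp: card_image)
    then obtain u k where u: "(\<Sum>v\<in>P ` ?N. scale C (u v) v) = 0" and k: "k \<in> ?N" "u (P k) \<noteq> 0"
      using vs.dependent_finite[of "P ` ?N"] by auto
    define p where "p = (\<Sum>k\<in>?N. monom (u (P k)) k)"
    have "coeff p k = u (P k)"
      using k by (simp add: p_def coeff_sum)
    then have "p \<noteq> 0" using k by auto
    moreover have "poly_at f x p = 0"
      using u True by (simp add: p_def poly_at_sum poly_at_monom sum.reindex flip: P_def)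
    ultimately show ?thesis by blast
  next
    case False
    then obtain k l where "P k = P l" "k \<noteq> l" by (auto simp: inj_on_def)
    then have "poly_at f x (monom 1 k + monom (-1) l) = 0"
      by (simp add: poly_at_add poly_at_monom flip: P_def)
    moreover have "coeff (monom 1 k + monom (-1::complex) l) k = 1"
      using \<open>k \<noteq> l\<close> by simp
    then have "monom 1 k + monom (-1::complex) l \<noteq> 0" by (metis coeff_0 zero_neq_one)
    ultimately show ?thesis by blast
  qed
qed

end

lemma zero_object_hom: "\<lbrakk>zero_object C w; u \<in> Hom w x\<rbrakk> \<Longrightarrow> u = 0"
  and zero_object_hom': "\<lbrakk>zero_object C w; u \<in> Hom x w\<rbrakk> \<Longrightarrow> u = 0"
  by (auto simp: zero_object_def)

lemma ident_eq_0_zero_object: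
  assumes "idm x = 0"
  shows "zero_object C x"
proof -
  have "f = 0" if "f \<in> Hom x y \<or> f \<in> Hom y x" for f y
    using that assms comp_ident ident_comp comp_zero_right comp_zero_left by metis
  then show ?thesis by (auto simp: zero_object_def)
qed

lemma simple_ident_neq_0: "simple_object C x \<Longrightarrow> idm x \<noteq> 0"
  using ident_eq_0_zero_object by (auto simp: simple_object_def)

lemma kernel_mono:
  assumes "is_kernel C x y f w k"
  shows "is_mono C w x k"
proof -
  have k: "k \<in> Hom w x" "f \<in> Hom x y" "f \<cdot> k = 0"
    using assms by (auto simp: is_kernel_def)
  have "u = v" if "u \<in> Hom t w" "v \<in> Hom t w" "k \<cdot> u = k \<cdot> v" for t u v
  proof -
    have "f \<cdot> (k \<cdot> u) = 0"
      using k that comp_assoc[of f x y k w u t] by simp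
    then show ?thesis
      using assms that comp_hom[OF k(1) that(1)] by (auto simp: is_kernel_def)
  qed
  then show ?thesis using k by (auto simp: is_mono_def)
qed

end

text \<open>The kernel of \<open>f\<close> is a mono into the simple \<open>x\<close>. It is no
  isomorphism since \<open>f \<noteq> 0\<close>, so its object is zero and \<open>f\<close> is mono.
  A mono from the nonzero \<open>x\<close> into the simple \<open>y\<close> is an isomorphism by the
  definition of simplicity.\<close>

lemma (in abelian_linear_category) schur_iso:
  assumes "simple_object C x" "simple_object C y" "f \<in> Hom x y" "f \<noteq> 0"
  shows "is_iso C x y f"
proof -
  obtain w k where k: "is_kernel C x y f w k"
    using kernels assms(3) by blast
  then have kh: "k \<in> Hom w x" "f \<cdot> k = 0" by (auto simp: is_kernel_def)
  have "\<not> is_iso C w x k"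
  proof
    assume "is_iso C w x k"
    then obtain g where g: "g \<in> Hom x w" "k \<cdot> g = idm x" by (auto simp: is_iso_def)
    then have "f = (f \<cdot> k) \<cdot> g"
      using comp_assoc[OF assms(3) kh(1) g(1)] comp_ident[OF assms(3)] by simp
    then show False using g kh assms(4) by simp
  qed
  then have w: "zero_object C w"
    using assms(1) kernel_mono[OF k] by (auto simp: simple_object_def)
  have "is_mono C x y f"
    unfolding is_mono_def
  proof (intro conjI allI ballI impI)
    fix t u v assume uv: "u \<in> Hom t x" "v \<in> Hom t x" "f \<cdot> u = f \<cdot> v"
    then have "f \<cdot> (u - v) = 0" using comp_diff_right[OF assms(3)] by simp
    then obtain u' where "u' \<in> Hom t w" "k \<cdot> u' = u - v"
      using k hom_diff[OF uv(1,2)] unfolding is_kernel_def by blast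
    then have "u - v = 0" using zero_object_hom'[OF w] comp_zero_right[OF kh(1)] by metis
    then show "u = v" by simp
  qed (rule assms(3))
  then show ?thesis using assms(1,2) by (auto simp: simple_object_def)
qed

section \<open>Endomorphisms of simple objects are scalars\<close>

context fusion_category
begin

interpretation vs: vector_space "scale C"
  by (rule vector_space)

text \<open>Take a root \<open>z\<close> of an annihilating polynomial and split off its linear
  factor. By Schur, \<open>f - z\<close> is zero, as wanted, or invertible; in the latter case it
  cancels and the cofactor is an annihilating polynomial of smaller degree. The descent stops
  because a nonzero constant cannot annihilate: \<open>idm x \<noteq> 0\<close>.\<close>

lemma simple_endomorphism:
  assumes x: "simple_object C x" and f: "f \<in> Hom x x"
  shows "\<exists>z. f = scale C z (idm x)"
proof -
  obtain B where "finite B" "vs.span B = Hom x x"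
    using hom_finite_dim by blast
  then obtain p where p: "p \<noteq> 0" "poly_at f x p = 0"
    using annihilating_poly[OF f] by blast
  then show ?thesis
  proof (induction "degree p" arbitrary: p rule: less_induct)
    case less
    have "degree p \<noteq> 0"
    proof
      assume "degree p = 0"
      then obtain a where "p = [:a:]" by (rule degree_eq_zeroE)
      then show False using less.prems f simple_ident_neq_0[OF x] by simp
    qed
    then obtain z where "poly p z = 0"
      using fundamental_theorem_of_algebra constant_degree by metis
    then obtain q where q: "p = [:- z, 1:] * q" by (metis dvdE poly_eq_0_iff_dvd)
    with less.prems have "q \<noteq> 0" by auto
    have eq: "(f - scale C z (idm x)) \<cdot> poly_at f x q = 0"
      using less.prems poly_at_linear_factor[OF f] q by metis
    have d: "f - scale C z (idm x) \<in> Hom x x"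
      by (intro hom_diff hom_scale ident_hom f)
    show ?case
    proof (cases "f - scale C z (idm x) = 0")
      case False
      then obtain g where g: "g \<in> Hom x x" "g \<cdot> (f - scale C z (idm x)) = idm x"
        using schur_iso[OF x x d] by (auto simp: is_iso_def)
      have "poly_at f x q = g \<cdot> ((f - scale C z (idm x)) \<cdot> poly_at f x q)"
        using comp_assoc[OF g(1) d poly_at_hom[OF f]] g(2) ident_comp[OF poly_at_hom[OF f]] by metis
      then have "poly_at f x q = 0" using eq g comp_zero_right by metis
      moreover have "degree q < degree p"
        unfolding q using \<open>q \<noteq> 0\<close> by (subst degree_mult_eq) auto
      ultimately show ?thesis using less.hyps \<open>q \<noteq> 0\<close> by blast
    qed auto
  qed
qed

section \<open>Scalars of the unit and dual families\<close>

lemma scalar_of_scale [simp]: "scalar_of C (scale C z (idm \<one>)) = z"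
  unfolding scalar_of_def
  using simple_ident_neq_0[OF simple_unit] by (intro the_equality) auto

lemma scale_scalar_of:
  assumes "k \<in> Hom \<one> \<one>"
  shows "scale C (scalar_of C k) (idm \<one>) = k"
  using simple_endomorphism[OF simple_unit assms] by auto

lemma scalar_of_add:
  "\<lbrakk>k \<in> Hom \<one> \<one>; l \<in> Hom \<one> \<one>\<rbrakk> \<Longrightarrow> scalar_of C (k + l) = scalar_of C k + scalar_of C l"
  by (metis scalar_of_scale scale_scalar_of vs.scale_left_distrib)

lemma scalar_of_scale_left: "k \<in> Hom \<one> \<one> \<Longrightarrow> scalar_of C (scale C z k) = z * scalar_of C k"
  by (metis scalar_of_scale scale_scalar_of vs.scale_scale)

text \<open>If \<open>s\<close> is isomorphic to the unit, \<open>j\<close> and \<open>q\<close> are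
  an isomorphism and its inverse. Otherwise Schur leaves no nonzero map between \<open>s\<close> and
  the unit in either direction, and zero maps satisfy the same equations. This uniform form spares a
  selection of the summands isomorphic to the unit.\<close>

lemma unit_split:
  assumes "simple_object C s"
  obtains j q where "j \<in> Hom \<one> s" "q \<in> Hom s \<one>"
    "\<And>g. g \<in> Hom \<one> s \<Longrightarrow> j \<cdot> (q \<cdot> g) = g" "\<And>g. g \<in> Hom s \<one> \<Longrightarrow> (g \<cdot> j) \<cdot> q = g"
proof (cases "\<exists>j. is_iso C \<one> s j")
  case True
  then obtain j q where j: "j \<in> Hom \<one> s" "q \<in> Hom s \<one>" "j \<cdot> q = idm s"
    by (auto simp: is_iso_def)
  show thesis
  proof (rule that[OF j(1,2)])
    show "j \<cdot> (q \<cdot> g) = g" if "g \<in> Hom \<one> s" for g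
      using comp_assoc[OF j(1,2) that] ident_comp[OF that] j(3) by simp
    show "(g \<cdot> j) \<cdot> q = g" if "g \<in> Hom s \<one>" for g
      using comp_assoc[OF that j(1,2)] comp_ident[OF that] j(3) by simp
  qed
next
  case False
  have "g = 0" if "g \<in> Hom \<one> s" for g
    using schur_iso[OF simple_unit assms that] False by blast
  moreover have "g = 0" if g: "g \<in> Hom s \<one>" for g
  proof (rule ccontr)
    assume "g \<noteq> 0"
    then obtain g' where "is_iso C \<one> s g'"
      using schur_iso[OF assms simple_unit g] by (auto simp: is_iso_def)
    then show False using False by blast
  qed
  ultimately show thesis
    by (intro that[of 0 0]) (auto simp: comp_zero_left[OF hom_zero])
qed

text \<open>The identity of \<open>c\<close> is expanded over its simple summands, and
  \<open>j k\<close>, \<open>q k\<close> are inserted at each summand, which changes no map from or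
  to the unit. The families have the reproducing property of dual bases, although some members may
  vanish.\<close>

lemma unit_dual_bases:
  obtains n :: nat and u v where "\<And>k. k < n \<Longrightarrow> u k \<in> Hom \<one> c" "\<And>k. k < n \<Longrightarrow> v k \<in> Hom c \<one>"
    "\<And>h. h \<in> Hom \<one> c \<Longrightarrow> h = (\<Sum>k<n. u k \<cdot> (v k \<cdot> h))"
    "\<And>f. f \<in> Hom c \<one> \<Longrightarrow> f = (\<Sum>k<n. (f \<cdot> u k) \<cdot> v k)"
proof -
  obtain n :: nat and s i p where s: "\<forall>k<n. simple_object C (s k)" and d: "is_direct_sum C c n s i p"
    using semisimple by metis
  have ip: "i k \<in> Hom (s k) c" "p k \<in> Hom c (s k)" if "k < n" for k
    using d that by (auto simp: is_direct_sum_def)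
  have id: "idm c = (\<Sum>k<n. i k \<cdot> p k)"
    using d by (simp add: is_direct_sum_def)
  have "\<exists>j q. j \<in> Hom \<one> (s k) \<and> q \<in> Hom (s k) \<one> \<and> (\<forall>g\<in>Hom \<one> (s k). j \<cdot> (q \<cdot> g) = g) \<and>
      (\<forall>g\<in>Hom (s k) \<one>. (g \<cdot> j) \<cdot> q = g)" if "k < n" for k
    using unit_split[of "s k"] s that by metis
  then obtain j q where jq: "\<And>k. k < n \<Longrightarrow> j k \<in> Hom \<one> (s k)" "\<And>k. k < n \<Longrightarrow> q k \<in> Hom (s k) \<one>"
    and jqg: "\<And>k g. \<lbrakk>k < n; g \<in> Hom \<one> (s k)\<rbrakk> \<Longrightarrow> j k \<cdot> (q k \<cdot> g) = g"
    and gjq: "\<And>k g. \<lbrakk>k < n; g \<in> Hom (s k) \<one>\<rbrakk> \<Longrightarrow> (g \<cdot> j k) \<cdot> q k = g"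
    by metis
  show thesis
  proof (rule that[of n "\<lambda>k. i k \<cdot> j k" "\<lambda>k. q k \<cdot> p k"])
    show "h = (\<Sum>k<n. (i k \<cdot> j k) \<cdot> ((q k \<cdot> p k) \<cdot> h))" if h: "h \<in> Hom \<one> c" for h
    proof -
      have "h = (\<Sum>k<n. (i k \<cdot> p k) \<cdot> h)"
        using ident_comp[OF h] comp_sum_left[OF h, of "{..<n}" "\<lambda>k. i k \<cdot> p k" c]
        by (simp add: id ip comp_hom[OF ip(1) ip(2)])
      also have "\<dots> = (\<Sum>k<n. (i k \<cdot> j k) \<cdot> ((q k \<cdot> p k) \<cdot> h))"
      proof (intro sum.cong refl)
        fix k assume "k \<in> {..<n}"
        then have k: "k < n" by simp
        note ph = comp_hom[OF ip(2)[OF k] h]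
        have "(i k \<cdot> j k) \<cdot> ((q k \<cdot> p k) \<cdot> h) = i k \<cdot> (j k \<cdot> (q k \<cdot> (p k \<cdot> h)))"
          using comp_assoc[OF ip(1)[OF k] jq(1)[OF k] comp_hom[OF jq(2)[OF k] ph]]
            comp_assoc[OF jq(2)[OF k] ip(2)[OF k] h] by simp
        then show "(i k \<cdot> p k) \<cdot> h = (i k \<cdot> j k) \<cdot> ((q k \<cdot> p k) \<cdot> h)"
          using comp_assoc[OF ip(1)[OF k] ip(2)[OF k] h] jqg[OF k ph] by simp
      qed
      finally show ?thesis .
    qed
    show "f = (\<Sum>k<n. (f \<cdot> (i k \<cdot> j k)) \<cdot> (q k \<cdot> p k))" if f: "f \<in> Hom c \<one>" for f
    proof -
      have "f = (\<Sum>k<n. f \<cdot> (i k \<cdot> p k))"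
        using comp_ident[OF f] comp_sum_right[OF f, of "{..<n}" "\<lambda>k. i k \<cdot> p k" c]
        by (simp add: id ip comp_hom[OF ip(1) ip(2)])
      also have "\<dots> = (\<Sum>k<n. (f \<cdot> (i k \<cdot> j k)) \<cdot> (q k \<cdot> p k))"
      proof (intro sum.cong refl)
        fix k assume "k \<in> {..<n}"
        then have k: "k < n" by simp
        note fi = comp_hom[OF f ip(1)[OF k]]
        have "(f \<cdot> (i k \<cdot> j k)) \<cdot> (q k \<cdot> p k) = (((f \<cdot> i k) \<cdot> j k) \<cdot> q k) \<cdot> p k"
          using comp_assoc[OF comp_hom[OF fi jq(1)[OF k]] jq(2)[OF k] ip(2)[OF k]]
            comp_assoc[OF f ip(1)[OF k] jq(1)[OF k]] by simp
        then show "f \<cdot> (i k \<cdot> p k) = (f \<cdot> (i k \<cdot> j k)) \<cdot> (q k \<cdot> p k)"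
          using comp_assoc[OF f ip(1)[OF k] ip(2)[OF k]] gjq[OF k fi] by simp
      qed
      finally show ?thesis .
    qed
  qed (auto intro: comp_hom ip jq)
qed

section \<open>Perfectness and naturality of the pairing\<close>

lemma pairing_apply: "h \<in> Hom \<one> c \<Longrightarrow> pairing C c f h = scalar_of C (f \<cdot> h)"
  by (simp add: pairing_def restrict0_def)

lemma scale_pairing:
  "\<lbrakk>f \<in> Hom c \<one>; h \<in> Hom \<one> c\<rbrakk> \<Longrightarrow> scale C (pairing C c f h) (idm \<one>) = f \<cdot> h"
  by (simp add: pairing_apply scale_scalar_of comp_hom)

text \<open>In the expansion over the dual families, \<open>f\<close> occurs only through its
  composites with the \<open>u k\<close>.\<close>

lemma pairing_eqI:
  assumes fg: "f \<in> Hom c \<one>" "g \<in> Hom c \<one>" and eq: "\<And>h. h \<in> Hom \<one> c \<Longrightarrow> f \<cdot> h = g \<cdot> h"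
  shows "f = g"
proof -
  obtain n :: nat and u v where u: "\<And>k. k < n \<Longrightarrow> u k \<in> Hom \<one> c"
    and v: "\<And>k. k < n \<Longrightarrow> v k \<in> Hom c \<one>"
    and exp: "\<And>h. h \<in> Hom \<one> c \<Longrightarrow> h = (\<Sum>k<n. u k \<cdot> (v k \<cdot> h))"
      "\<And>f. f \<in> Hom c \<one> \<Longrightarrow> f = (\<Sum>k<n. (f \<cdot> u k) \<cdot> v k)"
    by (rule unit_dual_bases[of c]) (rule that; assumption)
  have "(\<Sum>k<n. (f \<cdot> u k) \<cdot> v k) = (\<Sum>k<n. (g \<cdot> u k) \<cdot> v k)"
    by (intro sum.cong refl) (simp add: eq u)
  then show ?thesis using exp(2)[OF fg(1)] exp(2)[OF fg(2)] by simp
qed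

lemma pairing_surj:
  assumes \<psi>: "\<psi> \<in> dual_space (scale C) (Hom \<one> c)"
  shows "\<exists>f\<in>Hom c \<one>. pairing C c f = \<psi>"
proof -
  obtain n :: nat and u v where u: "\<And>k. k < n \<Longrightarrow> u k \<in> Hom \<one> c"
    and v: "\<And>k. k < n \<Longrightarrow> v k \<in> Hom c \<one>"
    and exp: "\<And>h. h \<in> Hom \<one> c \<Longrightarrow> h = (\<Sum>k<n. u k \<cdot> (v k \<cdot> h))"
      "\<And>f. f \<in> Hom c \<one> \<Longrightarrow> f = (\<Sum>k<n. (f \<cdot> u k) \<cdot> v k)"
    by (rule unit_dual_bases[of c]) (rule that; assumption)
  have add: "\<psi> (g + h) = \<psi> g + \<psi> h" if "g \<in> Hom \<one> c" "h \<in> Hom \<one> c" for g h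
    using that \<psi> by (auto simp: dual_space_def linear_map_on_def)
  have scale: "\<psi> (scale C z g) = z * \<psi> g" if "g \<in> Hom \<one> c" for g z
    using that \<psi> by (auto simp: dual_space_def linear_map_on_def)
  have \<psi>0: "\<psi> 0 = 0"
    using scale[OF hom_zero, of 0] by simp
  have sum: "\<psi> (sum t K) = (\<Sum>k\<in>K. \<psi> (t k))" if "\<And>k. k \<in> K \<Longrightarrow> t k \<in> Hom \<one> c" for t and K :: "nat set"
    using that by (induction K rule: infinite_finite_induct) (auto simp: \<psi>0 add hom_sum)
  \<comment> \<open>The only possible preimage: by the expansion of maps to the unit, its
    coefficient at \<open>v k\<close> has to be its value on \<open>u k\<close>. Applied to
    \<open>h\<close> it gives the sum of \<open>\<psi> (u k)\<close> times the scalar of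
    \<open>v k \<cdot> h\<close>, which is \<open>\<psi>\<close> of the expansion of
    \<open>h\<close>.\<close>
  define f where "f = (\<Sum>k<n. scale C (\<psi> (u k)) (v k))"
  have f: "f \<in> Hom c \<one>"
    unfolding f_def by (intro hom_sum hom_scale v) simp
  have "scalar_of C (f \<cdot> h) = \<psi> h" if h: "h \<in> Hom \<one> c" for h
  proof -
    define z where "z k = scalar_of C (v k \<cdot> h)" for k
    have z: "v k \<cdot> h = scale C (z k) (idm \<one>)" if "k < n" for k
      using scale_scalar_of[OF comp_hom[OF v[OF that] h]] by (simp add: z_def)
    have "f \<cdot> h = (\<Sum>k<n. scale C (\<psi> (u k)) (v k) \<cdot> h)"
      unfolding f_def by (rule comp_sum_left[OF h, where z = "\<one>"]) (auto intro: hom_scale v)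
    also have "\<dots> = (\<Sum>k<n. scale C (\<psi> (u k) * z k) (idm \<one>))"
      by (intro sum.cong refl) (simp add: comp_scale_left[OF h v] z)
    also have "\<dots> = scale C (\<Sum>k<n. \<psi> (u k) * z k) (idm \<one>)"
      by (simp add: vs.scale_sum_left)
    finally have "scalar_of C (f \<cdot> h) = (\<Sum>k<n. \<psi> (u k) * z k)" by simp
    also have "\<dots> = (\<Sum>k<n. \<psi> (scale C (z k) (u k)))"
      by (simp add: scale[OF u] mult.commute)
    also have "\<dots> = \<psi> (\<Sum>k<n. scale C (z k) (u k))"
      by (rule sum[symmetric]) (simp add: hom_scale u)
    also have "(\<Sum>k<n. scale C (z k) (u k)) = h"
      using exp(1)[OF h] by (simp add: z comp_scale_right[OF u ident_hom] comp_ident[OF u])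
    finally show ?thesis .
  qed
  then have "pairing C c f = \<psi>"
    using \<psi> by (auto simp: fun_eq_iff pairing_def restrict0_def dual_space_def)
  then show ?thesis using f by blast
qed

lemma pairing_in_dual_space:
  assumes f: "f \<in> Hom c \<one>"
  shows "pairing C c f \<in> dual_space (scale C) (Hom \<one> c)"
proof -
  have "linear_map_on (scale C) (*) (Hom \<one> c) (pairing C c f)"
    unfolding linear_map_on_def
    by (auto simp: pairing_apply hom_add hom_scale comp_add_right[OF f] comp_scale_right[OF f]
        scalar_of_add scalar_of_scale_left comp_hom[OF f])
  then show ?thesis by (simp add: dual_space_def pairing_def restrict0_def)
qed

lemma pairing_linear_iso:
  "linear_iso_on (scale C) dual_scale (Hom c \<one>) (dual_space (scale C) (Hom \<one> c)) (pairing C c)"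
  unfolding linear_iso_on_def
proof
  show "linear_map_on (scale C) dual_scale (Hom c \<one>) (pairing C c)"
    by (auto simp: linear_map_on_def fun_eq_iff pairing_def restrict0_def dual_scale_def
        comp_add_left comp_scale_left scalar_of_add scalar_of_scale_left comp_hom)
  have "inj_on (pairing C c) (Hom c \<one>)"
  proof (rule inj_onI)
    fix f g assume fg: "f \<in> Hom c \<one>" "g \<in> Hom c \<one>" "pairing C c f = pairing C c g"
    show "f = g"
      using fg scale_pairing by (intro pairing_eqI[OF fg(1,2)]) metis
  qed
  moreover have "pairing C c ` Hom c \<one> = dual_space (scale C) (Hom \<one> c)"
    using pairing_in_dual_space pairing_surj by blast
  ultimately show "bij_betw (pairing C c) (Hom c \<one>) (dual_space (scale C) (Hom \<one> c))"
    by (simp add: bij_betw_def)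
qed

lemma pairing_natural:
  assumes "a \<in> Hom c d" "f \<in> Hom d \<one>"
  shows "pairing C c (f \<cdot> a) = restrict0 (Hom \<one> c) (\<lambda>h. pairing C d f (a \<cdot> h))"
  using assms by (auto simp: fun_eq_iff pairing_def restrict0_def comp_assoc comp_hom)

end

section \<open>Natural isomorphisms between dual spaces\<close>

lemma dual_space_restrict0:
  assumes "\<And>u v. \<lbrakk>u \<in> V; v \<in> V\<rbrakk> \<Longrightarrow> u + v \<in> V" "\<And>z u. u \<in> V \<Longrightarrow> s z u \<in> V"
    and "linear_map_on s (*) V \<psi>"
  shows "restrict0 V \<psi> \<in> dual_space s V"
  using assms by (auto simp: dual_space_def restrict0_def linear_map_on_def)

text \<open>The transpose of the inverse, which inherits linearity from \<open>t\<close>, is the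
  inverse of the transpose. Functionals vanish outside their space by convention, so cutting off
  with \<open>restrict0\<close> after precomposition loses nothing.\<close>

lemma linear_iso_on_dual:
  assumes t: "linear_iso_on s s' W V t"
    and W: "\<And>u v. \<lbrakk>u \<in> W; v \<in> W\<rbrakk> \<Longrightarrow> u + v \<in> W" "\<And>z u. u \<in> W \<Longrightarrow> s z u \<in> W"
    and V: "\<And>u v. \<lbrakk>u \<in> V; v \<in> V\<rbrakk> \<Longrightarrow> u + v \<in> V" "\<And>z u. u \<in> V \<Longrightarrow> s' z u \<in> V"
  shows "linear_iso_on dual_scale dual_scale (dual_space s' V) (dual_space s W)
    (\<lambda>\<psi>. restrict0 W (\<lambda>w. \<psi> (t w)))"
  unfolding linear_iso_on_def
proof
  have bij: "bij_betw t W V" and lin: "linear_map_on s s' W t"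
    using t by (auto simp: linear_iso_on_def)
  have tW: "t w \<in> V" if "w \<in> W" for w
    using bij that by (auto simp: bij_betw_def)
  define r where "r = inv_into W t"
  have r: "r v \<in> W" "t (r v) = v" if "v \<in> V" for v
    using bij that by (auto simp: r_def bij_betw_def inv_into_into f_inv_into_f)
  have rt: "r (t w) = w" if "w \<in> W" for w
    using bij that by (auto simp: r_def bij_betw_def)
  have r_add: "r (u + v) = r u + r v" if "u \<in> V" "v \<in> V" for u v
    using lin rt[of "r u + r v"] r that W by (auto simp: linear_map_on_def)
  have r_scale: "r (s' z u) = s z (r u)" if "u \<in> V" for z u
    using lin rt[of "s z (r u)"] r that W by (auto simp: linear_map_on_def)
  show "linear_map_on dual_scale dual_scale (dual_space s' V) (\<lambda>\<psi>. restrict0 W (\<lambda>w. \<psi> (t w)))"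
    by (auto simp: linear_map_on_def restrict0_def dual_scale_def fun_eq_iff)
  show "bij_betw (\<lambda>\<psi>. restrict0 W (\<lambda>w. \<psi> (t w))) (dual_space s' V) (dual_space s W)"
  proof (rule bij_betw_byWitness[where f' = "\<lambda>\<phi>. restrict0 V (\<lambda>v. \<phi> (r v))"])
    show "\<forall>\<psi>\<in>dual_space s' V. restrict0 V (\<lambda>v. restrict0 W (\<lambda>w. \<psi> (t w)) (r v)) = \<psi>"
      using r by (auto simp: dual_space_def restrict0_def fun_eq_iff)
    show "\<forall>\<phi>\<in>dual_space s W. restrict0 W (\<lambda>w. restrict0 V (\<lambda>v. \<phi> (r v)) (t w)) = \<phi>"
      using rt tW by (auto simp: dual_space_def restrict0_def fun_eq_iff)
    show "(\<lambda>\<psi>. restrict0 W (\<lambda>w. \<psi> (t w))) ` dual_space s' V \<subseteq> dual_space s W"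
      using lin tW
      by (intro image_subsetI dual_space_restrict0 W) (auto simp: linear_map_on_def dual_space_def)
    show "(\<lambda>\<phi>. restrict0 V (\<lambda>v. \<phi> (r v))) ` dual_space s W \<subseteq> dual_space s' V"
      using r_add r_scale r
      by (intro image_subsetI dual_space_restrict0 V) (auto simp: linear_map_on_def dual_space_def)
  qed
qed

lemma natural_linear_iso_comp:
  assumes "natural_linear_iso C s1 s2 F G t" "natural_linear_iso C s2 s3 G H r"
  shows "natural_linear_iso C s1 s3 F H (\<lambda>c x. r c x \<circ> t c x)"
proof -
  have tG: "t c x v \<in> fst G c x" if "v \<in> fst F c x" for c x v
    using assms(1) that by (auto simp: natural_linear_iso_def linear_iso_on_def bij_betw_def)
  have "linear_iso_on s1 s3 (fst F c x) (fst H c x) (r c x \<circ> t c x)" for c x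
    using assms tG bij_betw_trans[of "t c x" "fst F c x" "fst G c x" "r c x" "fst H c x"]
    by (auto simp: natural_linear_iso_def linear_iso_on_def linear_map_on_def)
  then show ?thesis
    using assms tG by (auto simp: natural_linear_iso_def)
qed

text \<open>A pointwise right inverse of a bijection is two-sided, and linearity and naturality are
  carried back along \<open>t\<close>. This suits steps 5 and 6 of the chain, whose inverses are the
  maps with directly accessible naturality.\<close>

lemma natural_linear_iso_inverse:
  assumes t: "natural_linear_iso C s1 s2 F G t"
    and add: "\<And>c x u v. \<lbrakk>u \<in> fst F c x; v \<in> fst F c x\<rbrakk> \<Longrightarrow> u + v \<in> fst F c x"
    and scale: "\<And>c x z u. u \<in> fst F c x \<Longrightarrow> s1 z u \<in> fst F c x"
    and act: "\<And>c c' x x' a b v. \<lbrakk>a \<in> hom C c c'; b \<in> hom C x' x; v \<in> fst F c x\<rbrakk> \<Longrightarrow>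
      snd F c c' x x' a b v \<in> fst F c' x'"
    and r: "\<And>c x w. w \<in> fst G c x \<Longrightarrow> r c x w \<in> fst F c x"
    and tr: "\<And>c x w. w \<in> fst G c x \<Longrightarrow> t c x (r c x w) = w"
  shows "natural_linear_iso C s2 s1 G F r"
proof -
  have lin: "linear_map_on s1 s2 (fst F c x) (t c x)"
    and bij: "bij_betw (t c x) (fst F c x) (fst G c x)" for c x
    using t by (auto simp: natural_linear_iso_def linear_iso_on_def)
  have tG: "t c x v \<in> fst G c x" and rt: "r c x (t c x v) = v" if "v \<in> fst F c x" for c x v
  proof -
    show tv: "t c x v \<in> fst G c x" using bij that by (auto simp: bij_betw_def)
    show "r c x (t c x v) = v"
      using bij[of c x] that r[OF tv] tr[OF tv] by (auto simp: bij_betw_def dest: inj_onD)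
  qed
  have "linear_map_on s2 s1 (fst G c x) (r c x)" for c x
    unfolding linear_map_on_def
  proof (intro conjI ballI allI)
    show "r c x (u + v) = r c x u + r c x v" if "u \<in> fst G c x" "v \<in> fst G c x" for u v
      using lin[of c x] rt[OF add[OF r[OF that(1)] r[OF that(2)]]] that
      by (simp add: linear_map_on_def r tr)
    show "r c x (s2 z v) = s1 z (r c x v)" if "v \<in> fst G c x" for z v
      using lin[of c x] rt[OF scale[OF r[OF that]], of z] that
      by (simp add: linear_map_on_def r tr)
  qed
  moreover have "bij_betw (r c x) (fst G c x) (fst F c x)" for c x
    by (rule bij_betw_byWitness[where f' = "t c x"]) (auto simp: tr rt intro: r tG)
  moreover have "r c' x' (snd G c c' x x' a b w) = snd F c c' x x' a b (r c x w)"
    if "a \<in> hom C c c'" "b \<in> hom C x' x" "w \<in> fst G c x" for c c' x x' a b w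
  proof -
    have "t c' x' (snd F c c' x x' a b (r c x w)) = snd G c c' x x' a b (t c x (r c x w))"
      using t that r[OF that(3)] by (simp add: natural_linear_iso_def)
    then show ?thesis
      using rt[OF act[OF that(1,2) r[OF that(3)]]] tr[OF that(3)] by simp
  qed
  ultimately show ?thesis by (auto simp: natural_linear_iso_def linear_iso_on_def)
qed

section \<open>Mirror images, and naturality of transposition and bending\<close>

context strict_monoidal_linear_category
begin

lemma ev_transpose_r:
  assumes "dual_pair C a b e k" "l \<in> Hom (x \<otimes>\<^sub>o b) \<one>"
  shows "e \<cdot> (((l \<otimes> idm a) \<cdot> (idm x \<otimes> k)) \<otimes> idm b) = l"
  using strict_monoidal_linear_category.ev_transpose[OF mirror_strict_monoidal, of b a e k l x] assms by simp

lemma unbend_bend_r: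
  assumes "dual_pair C a b e k" "h \<in> Hom b x"
  shows "(idm x \<otimes> e) \<cdot> (((h \<otimes> idm a) \<cdot> k) \<otimes> idm b) = h"
  using strict_monoidal_linear_category.unbend_bend[OF mirror_strict_monoidal, of b a e k h x] assms by simp

lemma bend_unbend_r:
  assumes "dual_pair C a b e k" "l \<in> Hom \<one> (x \<otimes>\<^sub>o a)"
  shows "(((idm x \<otimes> e) \<cdot> (l \<otimes> idm b)) \<otimes> idm a) \<cdot> k = l"
  using strict_monoidal_linear_category.bend_unbend[OF mirror_strict_monoidal, of b a e k l x] assms by simp

lemma trace_slide_r:
  assumes "e \<in> Hom (y \<otimes>\<^sub>o v) \<one>" "e' \<in> Hom (y' \<otimes>\<^sub>o v') \<one>" "k \<in> Hom \<one> (u \<otimes>\<^sub>o v)"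
    "n \<in> Hom y' y" "p \<in> Hom v v'" "m \<in> Hom u y'"
    and "e \<cdot> (n \<otimes> idm v) = e' \<cdot> (idm y' \<otimes> p)" "(idm u \<otimes> p) \<cdot> k = k'"
  shows "e \<cdot> ((n \<cdot> m) \<otimes> idm v) \<cdot> k = e' \<cdot> (m \<otimes> idm v') \<cdot> k'"
  using strict_monoidal_linear_category.trace_slide[OF mirror_strict_monoidal, of e v y e' v' y' k u n p m k'] assms
  by simp

lemma nested_trace_r:
  assumes "e1 \<in> Hom (y1 \<otimes>\<^sub>o b1) \<one>" "k1 \<in> Hom \<one> (c1 \<otimes>\<^sub>o b1)"
    "e2 \<in> Hom (y2 \<otimes>\<^sub>o b2) \<one>" "k2 \<in> Hom \<one> (c2 \<otimes>\<^sub>o b2)" "h \<in> Hom (c2 \<otimes>\<^sub>o c1) (y2 \<otimes>\<^sub>o y1)"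
  shows "(e2 \<cdot> (idm y2 \<otimes> e1 \<otimes> idm b2)) \<cdot> (h \<otimes> idm (b1 \<otimes>\<^sub>o b2)) \<cdot> ((idm c2 \<otimes> k1 \<otimes> idm b2) \<cdot> k2)
    = e2 \<cdot> (((idm y2 \<otimes> e1) \<cdot> (h \<otimes> idm b1) \<cdot> (idm c2 \<otimes> k1)) \<otimes> idm b2) \<cdot> k2"
proof -
  have "(idm y2 \<otimes> e1) \<otimes> idm b2 = idm y2 \<otimes> e1 \<otimes> idm b2"
    "(idm c2 \<otimes> k1) \<otimes> idm b2 = idm c2 \<otimes> k1 \<otimes> idm b2"
    using assms by (auto intro: tensor_assoc ident_hom)
  then show ?thesis
    using strict_monoidal_linear_category.nested_trace[OF mirror_strict_monoidal, of e1 b1 y1 k1 c1 e2 b2 y2 k2 c2 h]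
      assms by simp
qed

text \<open>Hypothesis \<open>en\<close> says that \<open>n\<close> and \<open>p\<close> are adjoint
  under the two evaluations. In the chain \<open>p\<close> is the dual of a morphism and
  \<open>n\<close> its double dual, so this is the naturality square of step 1; its mirror image
  serves step 6.\<close>

lemma transpose_natural:
  assumes "e \<in> Hom (v \<otimes>\<^sub>o w) \<one>" "e' \<in> Hom (v' \<otimes>\<^sub>o w') \<one>" "n \<in> Hom w w'" "p \<in> Hom v' v"
    "f \<in> Hom x w" "b \<in> Hom x' x"
    and en: "e' \<cdot> (idm v' \<otimes> n) = e \<cdot> (p \<otimes> idm w)"
  shows "e' \<cdot> (idm v' \<otimes> (n \<cdot> f \<cdot> b)) = (e \<cdot> (idm v \<otimes> f)) \<cdot> (p \<otimes> b)"
proof -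
  obtain E where [simp]: "typed E" "src E = v \<otimes>\<^sub>o w" "tgt E = \<one>" "mor E = e"
    by (rule arrow_of_hom[OF assms(1)])
  obtain E' where [simp]: "typed E'" "src E' = v' \<otimes>\<^sub>o w'" "tgt E' = \<one>" "mor E' = e'"
    by (rule arrow_of_hom[OF assms(2)])
  obtain N where [simp]: "typed N" "src N = w" "tgt N = w'" "mor N = n"
    by (rule arrow_of_hom[OF assms(3)])
  obtain P where [simp]: "typed P" "src P = v'" "tgt P = v" "mor P = p"
    by (rule arrow_of_hom[OF assms(4)])
  obtain F where [simp]: "typed F" "src F = x" "tgt F = w" "mor F = f"
    by (rule arrow_of_hom[OF assms(5)])
  obtain B where [simp]: "typed B" "src B = x'" "tgt B = x" "mor B = b"
    by (rule arrow_of_hom[OF assms(6)])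
  have en': "E' \<odot> (Id v' \<boxtimes> N) = E \<odot> (P \<boxtimes> Id w)"
    using en by (intro arrow.expand) simp
  have "E' \<odot> (Id v' \<boxtimes> (N \<odot> F \<odot> B)) = (E' \<odot> (Id v' \<boxtimes> N)) \<odot> (Id v' \<boxtimes> (F \<odot> B))"
    by simp
  also have "\<dots> = E \<odot> ((P \<boxtimes> Id w) \<odot> (Id v' \<boxtimes> (F \<odot> B)))"
    unfolding en' by simp
  also have "(P \<boxtimes> Id w) \<odot> (Id v' \<boxtimes> (F \<odot> B)) = (Id v \<boxtimes> F) \<odot> (P \<boxtimes> B)"
    using tns_cmp[of P "Id v'" "Id w" "F \<odot> B"] tns_cmp[of "Id v" P F B] by (simp del: Id_tns_cmp)
  finally have "mor (E' \<odot> (Id v' \<boxtimes> (N \<odot> F \<odot> B))) = mor ((E \<odot> (Id v \<boxtimes> F)) \<odot> (P \<boxtimes> B))"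
    by simp
  then show ?thesis by (simp del: Id_tns_cmp cmp_assoc)
qed

lemma transpose_natural_r:
  assumes "e \<in> Hom (w \<otimes>\<^sub>o v) \<one>" "e' \<in> Hom (w' \<otimes>\<^sub>o v') \<one>" "n \<in> Hom w w'" "p \<in> Hom v' v"
    "f \<in> Hom x w" "b \<in> Hom x' x"
    and "e' \<cdot> (n \<otimes> idm v') = e \<cdot> (idm w \<otimes> p)"
  shows "e' \<cdot> ((n \<cdot> f \<cdot> b) \<otimes> idm v') = (e \<cdot> (f \<otimes> idm v)) \<cdot> (b \<otimes> p)"
  using strict_monoidal_linear_category.transpose_natural[OF mirror_strict_monoidal, of e v w e' v' w' n p f x b x']
    assms by simp

text \<open>The counterpart of \<open>transpose_natural\<close> for coevaluations, with
  \<open>pk\<close> as the adjointness of \<open>p\<close> and \<open>a\<close>: \<open>p\<close> is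
  moved off the dual strand and becomes \<open>a\<close> in front of \<open>h\<close>.\<close>

lemma bend_natural:
  assumes "k \<in> Hom \<one> (v \<otimes>\<^sub>o c)" "k' \<in> Hom \<one> (v' \<otimes>\<^sub>o c')" "p \<in> Hom v' v" "a \<in> Hom c c'"
    "h \<in> Hom c' x'" "b \<in> Hom x' x"
    and pk: "(p \<otimes> idm c') \<cdot> k' = (idm v \<otimes> a) \<cdot> k"
  shows "(p \<otimes> b) \<cdot> ((idm v' \<otimes> h) \<cdot> k') = (idm v \<otimes> (b \<cdot> h \<cdot> a)) \<cdot> k"
proof -
  obtain K where [simp]: "typed K" "src K = \<one>" "tgt K = v \<otimes>\<^sub>o c" "mor K = k"
    by (rule arrow_of_hom[OF assms(1)])
  obtain K' where [simp]: "typed K'" "src K' = \<one>" "tgt K' = v' \<otimes>\<^sub>o c'" "mor K' = k'"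
    by (rule arrow_of_hom[OF assms(2)])
  obtain P where [simp]: "typed P" "src P = v'" "tgt P = v" "mor P = p"
    by (rule arrow_of_hom[OF assms(3)])
  obtain A where [simp]: "typed A" "src A = c" "tgt A = c'" "mor A = a"
    by (rule arrow_of_hom[OF assms(4)])
  obtain H where [simp]: "typed H" "src H = c'" "tgt H = x'" "mor H = h"
    by (rule arrow_of_hom[OF assms(5)])
  obtain B where [simp]: "typed B" "src B = x'" "tgt B = x" "mor B = b"
    by (rule arrow_of_hom[OF assms(6)])
  have pk': "(P \<boxtimes> Id c') \<odot> K' = (Id v \<boxtimes> A) \<odot> K"
    using pk by (intro arrow.expand) simp
  have "(P \<boxtimes> B) \<odot> ((Id v' \<boxtimes> H) \<odot> K') = ((P \<boxtimes> B) \<odot> (Id v' \<boxtimes> H)) \<odot> K'"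
    by simp
  also have "(P \<boxtimes> B) \<odot> (Id v' \<boxtimes> H) = (Id v \<boxtimes> (B \<odot> H)) \<odot> (P \<boxtimes> Id c')"
    using tns_cmp[of P "Id v'" B H] tns_cmp[of "Id v" P "B \<odot> H" "Id c'"] by (simp del: Id_tns_cmp)
  also have "\<dots> \<odot> K' = (Id v \<boxtimes> (B \<odot> H)) \<odot> ((P \<boxtimes> Id c') \<odot> K')"
    by simp
  also have "\<dots> = (Id v \<boxtimes> (B \<odot> H \<odot> A)) \<odot> K"
    unfolding pk' by simp
  finally have "mor ((P \<boxtimes> B) \<odot> ((Id v' \<boxtimes> H) \<odot> K')) = mor ((Id v \<boxtimes> (B \<odot> H \<odot> A)) \<odot> K)"
    by (rule arg_cong)
  then show ?thesis by (simp del: Id_tns_cmp cmp_assoc)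
qed

lemma bend_natural_r:
  assumes "k \<in> Hom \<one> (c \<otimes>\<^sub>o v)" "k' \<in> Hom \<one> (c' \<otimes>\<^sub>o v')" "p \<in> Hom v' v" "a \<in> Hom c c'"
    "h \<in> Hom c' x'" "b \<in> Hom x' x"
    and "(idm c' \<otimes> p) \<cdot> k' = (a \<otimes> idm v) \<cdot> k"
  shows "(b \<otimes> p) \<cdot> ((h \<otimes> idm v') \<cdot> k') = ((b \<cdot> h \<cdot> a) \<otimes> idm v) \<cdot> k"
  using strict_monoidal_linear_category.bend_natural[OF mirror_strict_monoidal, of k v c k' v' c' p a h x' b x] assms
  by simp

text \<open>The bridge between traces and the pairing: the trace of \<open>f \<cdot> h\<close> is
  the transpose of \<open>f\<close> applied to the bent \<open>h\<close>.\<close>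

lemma trace_comp:
  assumes "e \<in> Hom (v \<otimes>\<^sub>o y) \<one>" "k \<in> Hom \<one> (v \<otimes>\<^sub>o u)" "f \<in> Hom x y" "h \<in> Hom u x"
  shows "e \<cdot> (idm v \<otimes> (f \<cdot> h)) \<cdot> k = (e \<cdot> (idm v \<otimes> f)) \<cdot> ((idm v \<otimes> h) \<cdot> k)"
proof -
  obtain E where [simp]: "typed E" "src E = v \<otimes>\<^sub>o y" "tgt E = \<one>" "mor E = e"
    by (rule arrow_of_hom[OF assms(1)])
  obtain K where [simp]: "typed K" "src K = \<one>" "tgt K = v \<otimes>\<^sub>o u" "mor K = k"
    by (rule arrow_of_hom[OF assms(2)])
  obtain F where [simp]: "typed F" "src F = x" "tgt F = y" "mor F = f"
    by (rule arrow_of_hom[OF assms(3)])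
  obtain H where [simp]: "typed H" "src H = u" "tgt H = x" "mor H = h"
    by (rule arrow_of_hom[OF assms(4)])
  have "mor (E \<odot> (Id v \<boxtimes> (F \<odot> H)) \<odot> K) = mor ((E \<odot> (Id v \<boxtimes> F)) \<odot> ((Id v \<boxtimes> H) \<odot> K))"
    by (rule arg_cong) simp
  then show ?thesis by (simp del: Id_tns_cmp cmp_assoc)
qed

lemma trace_comp_r:
  assumes "e \<in> Hom (y \<otimes>\<^sub>o v) \<one>" "k \<in> Hom \<one> (u \<otimes>\<^sub>o v)" "f \<in> Hom x y" "h \<in> Hom u x"
  shows "e \<cdot> ((f \<cdot> h) \<otimes> idm v) \<cdot> k = (e \<cdot> (f \<otimes> idm v)) \<cdot> ((h \<otimes> idm v) \<cdot> k)"
  using strict_monoidal_linear_category.trace_comp[OF mirror_strict_monoidal, of e v y k u f x h] assms by simp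

text \<open>Read from left to right, \<open>g1\<close> enters a partial trace that already contains
  \<open>g2\<close>. Only the other strand is closed up, so \<open>g1\<close> passes under the
  evaluation and joins \<open>g2\<close> in a tensor product.\<close>

lemma partial_trace_comp:
  assumes "g1 \<in> Hom y1 z1" "g2 \<in> Hom y2 z2" "e \<in> Hom (z2 \<otimes>\<^sub>o a) \<one>" "k \<in> Hom \<one> (d \<otimes>\<^sub>o a)"
    "h \<in> Hom (c \<otimes>\<^sub>o d) (y1 \<otimes>\<^sub>o y2)"
  shows "g1 \<cdot> ((idm y1 \<otimes> (e \<cdot> (g2 \<otimes> idm a))) \<cdot> (h \<otimes> idm a) \<cdot> (idm c \<otimes> k))
    = (idm z1 \<otimes> e) \<cdot> (((g1 \<otimes> g2) \<cdot> h) \<otimes> idm a) \<cdot> (idm c \<otimes> k)"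
proof -
  obtain G1 where [simp]: "typed G1" "src G1 = y1" "tgt G1 = z1" "mor G1 = g1"
    by (rule arrow_of_hom[OF assms(1)])
  obtain G2 where [simp]: "typed G2" "src G2 = y2" "tgt G2 = z2" "mor G2 = g2"
    by (rule arrow_of_hom[OF assms(2)])
  obtain E where [simp]: "typed E" "src E = z2 \<otimes>\<^sub>o a" "tgt E = \<one>" "mor E = e"
    by (rule arrow_of_hom[OF assms(3)])
  obtain K where [simp]: "typed K" "src K = \<one>" "tgt K = d \<otimes>\<^sub>o a" "mor K = k"
    by (rule arrow_of_hom[OF assms(4)])
  obtain H where [simp]: "typed H" "src H = c \<otimes>\<^sub>o d" "tgt H = y1 \<otimes>\<^sub>o y2" "mor H = h"
    by (rule arrow_of_hom[OF assms(5)])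
  have *: "G1 \<odot> (Id y1 \<boxtimes> (E \<odot> (G2 \<boxtimes> Id a))) = (Id z1 \<boxtimes> E) \<odot> ((G1 \<boxtimes> G2) \<boxtimes> Id a)"
    using tns_cmp[of G1 "Id y1" "Id \<one>" "E \<odot> (G2 \<boxtimes> Id a)"] tns_cmp[of "Id z1" G1 E "G2 \<boxtimes> Id a"]
    by (simp del: Id_tns_cmp)
  have "G1 \<odot> ((Id y1 \<boxtimes> (E \<odot> (G2 \<boxtimes> Id a))) \<odot> (H \<boxtimes> Id a) \<odot> (Id c \<boxtimes> K))
    = (G1 \<odot> (Id y1 \<boxtimes> (E \<odot> (G2 \<boxtimes> Id a)))) \<odot> ((H \<boxtimes> Id a) \<odot> (Id c \<boxtimes> K))"
    by simp
  also have "\<dots> = (Id z1 \<boxtimes> E) \<odot> (((G1 \<boxtimes> G2) \<odot> H) \<boxtimes> Id a) \<odot> (Id c \<boxtimes> K)"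
    unfolding * by simp
  finally have "mor (G1 \<odot> ((Id y1 \<boxtimes> (E \<odot> (G2 \<boxtimes> Id a))) \<odot> (H \<boxtimes> Id a) \<odot> (Id c \<boxtimes> K)))
    = mor ((Id z1 \<boxtimes> E) \<odot> (((G1 \<boxtimes> G2) \<odot> H) \<boxtimes> Id a) \<odot> (Id c \<boxtimes> K))"
    by (rule arg_cong)
  then show ?thesis by (simp del: Id_tns_cmp cmp_tns_Id cmp_assoc)
qed

lemma ldual_comparison:
  assumes "dual_pair C c l e k" "dual_pair C c l' e' k'"
  defines "n \<equiv> ldual_comparison C l e l' k'"
  shows "n \<in> Hom l l'" "e' \<cdot> (idm c \<otimes> n) = e" "(n \<otimes> idm c) \<cdot> k = k'"
proof -
  have e: "e \<in> Hom (c \<otimes>\<^sub>o l) \<one>" and k': "k' \<in> Hom \<one> (l' \<otimes>\<^sub>o c)" and k: "k \<in> Hom \<one> (l \<otimes>\<^sub>o c)"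
    using assms(1,2) by (auto simp: dual_pair_def)
  have "idm l' \<otimes> e \<in> Hom (l' \<otimes>\<^sub>o (c \<otimes>\<^sub>o l)) (l' \<otimes>\<^sub>o \<one>)"
    using e by (intro tensor_hom ident_hom)
  \<comment> \<open>The definition of \<open>mate\<close> has an additional middle factor, which for
    \<open>f = idm c\<close> is an identity.\<close>
  then have "n = mate C l' e l k' (idm c)"
    by (simp only: n_def ldual_comparison_def mate_def tensor_ident comp_ident)
  then show "n \<in> Hom l l'" "e' \<cdot> (idm c \<otimes> n) = e" "(n \<otimes> idm c) \<cdot> k = k'"
    using mate_hom[OF assms(2,1) ident_hom] ev_mate[OF assms(2,1) ident_hom]
      coev_mate[OF assms(2,1) ident_hom] comp_ident[OF e] ident_comp[OF k']
    by (simp_all add: tensor_ident)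
qed

lemma rdual_comparison:
  assumes "dual_pair C r c e k" "dual_pair C r' c e' k'"
  defines "n \<equiv> rdual_comparison C r e r' k'"
  shows "n \<in> Hom r r'" "e' \<cdot> (n \<otimes> idm c) = e" "(idm c \<otimes> n) \<cdot> k = k'"
  using strict_monoidal_linear_category.ldual_comparison[OF mirror_strict_monoidal, of c r e k r' e' k'] assms(1,2)
  by (simp_all add: n_def rdual_comparison_def ldual_comparison_def)

end

section \<open>Duals of morphisms\<close>

context rigid_linear_category
begin

lemma dual_pair_r: "dual_pair C (dR c) c (evR c) (coevR c)"
  and dual_pair_l: "dual_pair C c (dL c) (evL c) (coevL c)"
  by (simp_all add: dual_pair_def ev_r_hom coev_r_hom ev_l_hom coev_l_hom
      snake_r snake_r_dual snake_l snake_l_dual)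

lemma ldual_mor_mate: "ldual_mor C c d f = mate C (dL c) (evL d) (dL d) (coevL c) f"
  by (simp add: ldual_mor_def mate_def)

text \<open>In the mirror category the triple tensor product comes out bracketed to the left.
  Rebracketing it requires \<open>f\<close> to be typed, unlike in
  \<open>ldual_mor_mate\<close>.\<close>

lemma rdual_mor_mate:
  "f \<in> Hom c d \<Longrightarrow> rdual_mor C c d f = mate (mirror C) (dR c) (evR d) (dR d) (coevR c) f"
  using tensor_assoc[OF ident_hom _ ident_hom, of f c d "dR d" "dR c"]
  by (simp add: rdual_mor_def mate_def)

lemma ldual_mor_hom: "f \<in> Hom c d \<Longrightarrow> ldual_mor C c d f \<in> Hom (dL d) (dL c)"
  unfolding ldual_mor_mate by (rule mate_hom[OF dual_pair_l dual_pair_l])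

lemma ev_ldual_mor:
  "f \<in> Hom c d \<Longrightarrow> evL c \<cdot> (idm c \<otimes> ldual_mor C c d f) = evL d \<cdot> (f \<otimes> idm (dL d))"
  unfolding ldual_mor_mate by (rule ev_mate[OF dual_pair_l dual_pair_l])

lemma coev_ldual_mor:
  "f \<in> Hom c d \<Longrightarrow> (ldual_mor C c d f \<otimes> idm d) \<cdot> coevL d = (idm (dL c) \<otimes> f) \<cdot> coevL c"
  unfolding ldual_mor_mate by (rule coev_mate[OF dual_pair_l dual_pair_l])

lemma rdual_mor_hom: "f \<in> Hom c d \<Longrightarrow> rdual_mor C c d f \<in> Hom (dR d) (dR c)"
  using strict_monoidal_linear_category.mate_hom[OF mirror_strict_monoidal, of c "dR c" "evR c" "coevR c"
      d "dR d" "evR d" "coevR d" f] dual_pair_r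
  by (simp add: rdual_mor_mate)

lemma ev_rdual_mor:
  "f \<in> Hom c d \<Longrightarrow> evR c \<cdot> (rdual_mor C c d f \<otimes> idm c) = evR d \<cdot> (idm (dR d) \<otimes> f)"
  using strict_monoidal_linear_category.ev_mate[OF mirror_strict_monoidal, of c "dR c" "evR c" "coevR c"
      d "dR d" "evR d" "coevR d" f] dual_pair_r
  by (simp add: rdual_mor_mate)

lemma coev_rdual_mor:
  "f \<in> Hom c d \<Longrightarrow> (idm d \<otimes> rdual_mor C c d f) \<cdot> coevR d = (f \<otimes> idm (dR c)) \<cdot> coevR c"
  using strict_monoidal_linear_category.coev_mate[OF mirror_strict_monoidal, of c "dR c" "evR c" "coevR c"
      d "dR d" "evR d" "coevR d" f] dual_pair_r
  by (simp add: rdual_mor_mate)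

lemma ldual2_mor_hom: "f \<in> Hom c d \<Longrightarrow> ldual2_mor C c d f \<in> Hom (ldual2 C c) (ldual2 C d)"
  and rdual2_mor_hom: "f \<in> Hom c d \<Longrightarrow> rdual2_mor C c d f \<in> Hom (rdual2 C c) (rdual2 C d)"
  by (simp_all add: ldual2_mor_def rdual2_mor_def ldual2_def rdual2_def ldual_mor_hom rdual_mor_hom)

end

lemma natural_linear_iso_mem:
  "\<lbrakk>natural_linear_iso C s1 s2 F G t; v \<in> fst F c x\<rbrakk> \<Longrightarrow> t c x v \<in> fst G c x"
  by (auto simp: natural_linear_iso_def linear_iso_on_def bij_betw_def)

lemma natural_linear_isoD:
  "\<lbrakk>natural_linear_iso C s1 s2 F G t; a \<in> hom C c c'; b \<in> hom C x' x; v \<in> fst F c x\<rbrakk> \<Longrightarrow>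
    t c' x' (snd F c c' x x' a b v) = snd G c c' x x' a b (t c x v)"
  by (simp add: natural_linear_iso_def)

section \<open>The duality maps as linear isomorphisms\<close>

context strict_monoidal_linear_category
begin

lemma transpose_linear_iso:
  assumes d: "dual_pair C a b e k"
  shows "linear_iso_on (scale C) (scale C) (Hom x b) (Hom (a \<otimes>\<^sub>o x) \<one>)
    (\<lambda>f. e \<cdot> (idm a \<otimes> f))"
  unfolding linear_iso_on_def
proof
  have e: "e \<in> Hom (a \<otimes>\<^sub>o b) \<one>" and k: "k \<in> Hom \<one> (b \<otimes>\<^sub>o a)"
    using dual_pairD[OF d] by auto
  have af: "idm a \<otimes> f \<in> Hom (a \<otimes>\<^sub>o x) (a \<otimes>\<^sub>o b)" if "f \<in> Hom x b" for f
    using that by (intro tensor_hom ident_hom)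
  show "linear_map_on (scale C) (scale C) (Hom x b) (\<lambda>f. e \<cdot> (idm a \<otimes> f))"
    using tensor_linear_right[OF ident_hom, of x b a]
    by (auto simp: linear_map_on_def comp_add_right[OF e af af] comp_scale_right[OF e af])
  show "bij_betw (\<lambda>f. e \<cdot> (idm a \<otimes> f)) (Hom x b) (Hom (a \<otimes>\<^sub>o x) \<one>)"
  proof (rule bij_betw_byWitness[where f' = "\<lambda>l. (idm b \<otimes> l) \<cdot> (k \<otimes> idm x)"])
    have "(idm b \<otimes> l) \<cdot> (k \<otimes> idm x) \<in> Hom x b" if "l \<in> Hom (a \<otimes>\<^sub>o x) \<one>" for l
      using comp_hom[OF tensor_hom[OF ident_hom that, of b] tensor_hom[OF k ident_hom, of x, simplified]]
      by simp
    then show "(\<lambda>l. (idm b \<otimes> l) \<cdot> (k \<otimes> idm x)) ` Hom (a \<otimes>\<^sub>o x) \<one> \<subseteq> Hom x b" by auto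
  qed (auto simp: transpose_ev[OF d] ev_transpose[OF d] intro: comp_hom e af)
qed

lemma transpose_linear_iso_r:
  assumes "dual_pair C a b e k"
  shows "linear_iso_on (scale C) (scale C) (Hom x a) (Hom (x \<otimes>\<^sub>o b) \<one>)
    (\<lambda>f. e \<cdot> (f \<otimes> idm b))"
  using strict_monoidal_linear_category.transpose_linear_iso[OF mirror_strict_monoidal, of b a e k x] assms by simp

lemma bend_linear_iso:
  assumes d: "dual_pair C a b e k"
  shows "linear_iso_on (scale C) (scale C) (Hom a x) (Hom \<one> (b \<otimes>\<^sub>o x))
    (\<lambda>h. (idm b \<otimes> h) \<cdot> k)"
  unfolding linear_iso_on_def
proof
  have e: "e \<in> Hom (a \<otimes>\<^sub>o b) \<one>" and k: "k \<in> Hom \<one> (b \<otimes>\<^sub>o a)"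
    using dual_pairD[OF d] by auto
  have bh: "idm b \<otimes> h \<in> Hom (b \<otimes>\<^sub>o a) (b \<otimes>\<^sub>o x)" if "h \<in> Hom a x" for h
    using that by (intro tensor_hom ident_hom)
  show "linear_map_on (scale C) (scale C) (Hom a x) (\<lambda>h. (idm b \<otimes> h) \<cdot> k)"
    using tensor_linear_right[OF ident_hom, of a x b]
    by (auto simp: linear_map_on_def comp_add_left[OF k bh bh] comp_scale_left[OF k bh])
  show "bij_betw (\<lambda>h. (idm b \<otimes> h) \<cdot> k) (Hom a x) (Hom \<one> (b \<otimes>\<^sub>o x))"
  proof (rule bij_betw_byWitness[where f' = "\<lambda>l. (e \<otimes> idm x) \<cdot> (idm a \<otimes> l)"])
    have "(e \<otimes> idm x) \<cdot> (idm a \<otimes> l) \<in> Hom a x" if "l \<in> Hom \<one> (b \<otimes>\<^sub>o x)" for l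
      using comp_hom[OF tensor_hom[OF e ident_hom, of x, simplified] tensor_hom[OF ident_hom that, of a]]
      by simp
    then show "(\<lambda>l. (e \<otimes> idm x) \<cdot> (idm a \<otimes> l)) ` Hom \<one> (b \<otimes>\<^sub>o x) \<subseteq> Hom a x" by auto
  qed (auto simp: unbend_bend[OF d] bend_unbend[OF d] intro: comp_hom k bh)
qed

text \<open>Step 4 of the chain precomposes with unbending, the direction opposite to the mirror
  image of \<open>bend_linear_iso\<close>; hence the separate statement.\<close>

lemma unbend_linear_iso_r:
  assumes d: "dual_pair C a b e k"
  shows "linear_iso_on (scale C) (scale C) (Hom \<one> (x \<otimes>\<^sub>o a)) (Hom b x)
    (\<lambda>l. (idm x \<otimes> e) \<cdot> (l \<otimes> idm b))"
  unfolding linear_iso_on_def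
proof
  have e: "e \<in> Hom (a \<otimes>\<^sub>o b) \<one>" and k: "k \<in> Hom \<one> (b \<otimes>\<^sub>o a)"
    using dual_pairD[OF d] by auto
  have xe: "idm x \<otimes> e \<in> Hom (x \<otimes>\<^sub>o a \<otimes>\<^sub>o b) x"
    using tensor_hom[OF ident_hom e, of x] by simp
  have lb: "l \<otimes> idm b \<in> Hom b (x \<otimes>\<^sub>o a \<otimes>\<^sub>o b)" if "l \<in> Hom \<one> (x \<otimes>\<^sub>o a)" for l
    using tensor_hom[OF that ident_hom, of b] by simp
  show "linear_map_on (scale C) (scale C) (Hom \<one> (x \<otimes>\<^sub>o a)) (\<lambda>l. (idm x \<otimes> e) \<cdot> (l \<otimes> idm b))"
    using tensor_linear_left[OF ident_hom, of \<one> "x \<otimes>\<^sub>o a" b]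
    by (auto simp: linear_map_on_def comp_add_right[OF xe lb lb] comp_scale_right[OF xe lb])
  show "bij_betw (\<lambda>l. (idm x \<otimes> e) \<cdot> (l \<otimes> idm b)) (Hom \<one> (x \<otimes>\<^sub>o a)) (Hom b x)"
  proof (rule bij_betw_byWitness[where f' = "\<lambda>h. (h \<otimes> idm a) \<cdot> k"])
    show "(\<lambda>h. (h \<otimes> idm a) \<cdot> k) ` Hom b x \<subseteq> Hom \<one> (x \<otimes>\<^sub>o a)"
      by (auto intro!: comp_hom[OF tensor_hom[OF _ ident_hom] k])
  qed (auto simp: unbend_bend_r[OF d] bend_unbend_r[OF d] intro: comp_hom xe lb)
qed

end

section \<open>The chain of isomorphisms\<close>

context fusion_category
begin

lemma chain_step1_natural:
  "natural_linear_iso C (scale C) (scale C) (chain_functor1 C) (chain_functor2 C) (chain_step1 C)"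
  unfolding natural_linear_iso_def
proof (intro conjI allI ballI)
  show "linear_iso_on (scale C) (scale C) (fst (chain_functor1 C) c x) (fst (chain_functor2 C) c x)
      (chain_step1 C c x)" for c x
    using transpose_linear_iso[OF dual_pair_l[of "dL c"], of x]
    by (simp add: chain_functor1_def chain_functor2_def chain_step1_def[abs_def] ldual2_def)
  fix c c' x x' a b v
  assume a: "a \<in> Hom c c'" and b: "b \<in> Hom x' x" and v: "v \<in> fst (chain_functor1 C) c x"
  show "chain_step1 C c' x' (snd (chain_functor1 C) c c' x x' a b v)
      = snd (chain_functor2 C) c c' x x' a b (chain_step1 C c x v)"
    using transpose_natural[OF ev_l_hom ev_l_hom ldual_mor_hom[OF ldual_mor_hom[OF a]]
        ldual_mor_hom[OF a] _ b ev_ldual_mor[OF ldual_mor_hom[OF a]]] v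
    by (simp add: chain_functor1_def chain_functor2_def chain_step1_def ldual2_def ldual2_mor_def)
qed

lemma chain_functor_hom_closed:
  "\<lbrakk>u \<in> fst (chain_functor6 C) c x; v \<in> fst (chain_functor6 C) c x\<rbrakk> \<Longrightarrow> u + v \<in> fst (chain_functor6 C) c x"
  "u \<in> fst (chain_functor6 C) c x \<Longrightarrow> scale C z u \<in> fst (chain_functor6 C) c x"
  "\<lbrakk>u \<in> fst (chain_functor7 C) c x; v \<in> fst (chain_functor7 C) c x\<rbrakk> \<Longrightarrow> u + v \<in> fst (chain_functor7 C) c x"
  "u \<in> fst (chain_functor7 C) c x \<Longrightarrow> scale C z u \<in> fst (chain_functor7 C) c x"
  by (simp_all add: chain_functor6_def chain_functor7_def hom_add hom_scale)

lemma chain_step2_natural: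
  "natural_linear_iso C (scale C) dual_scale (chain_functor2 C) (chain_functor3 C) (chain_step2 C)"
  unfolding natural_linear_iso_def
proof (intro conjI allI ballI)
  show "linear_iso_on (scale C) dual_scale (fst (chain_functor2 C) c x) (fst (chain_functor3 C) c x)
      (chain_step2 C c x)" for c x
    using pairing_linear_iso by (simp add: chain_functor2_def chain_functor3_def chain_step2_def)
  fix c c' x x' a b v
  assume a: "a \<in> Hom c c'" and b: "b \<in> Hom x' x" and v: "v \<in> fst (chain_functor2 C) c x"
  show "chain_step2 C c' x' (snd (chain_functor2 C) c c' x x' a b v)
      = snd (chain_functor3 C) c c' x x' a b (chain_step2 C c x v)"
    using pairing_natural[OF tensor_hom[OF ldual_mor_hom[OF a] b]] v
    by (simp add: chain_functor2_def chain_functor3_def chain_step2_def)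
qed

lemma chain_step3_natural:
  "natural_linear_iso C dual_scale dual_scale (chain_functor3 C) (chain_functor4 C) (chain_step3 C)"
  unfolding natural_linear_iso_def
proof (intro conjI allI ballI)
  show "linear_iso_on dual_scale dual_scale (fst (chain_functor3 C) c x) (fst (chain_functor4 C) c x)
      (chain_step3 C c x)" for c x
    using linear_iso_on_dual[OF bend_linear_iso[OF dual_pair_l[of c], of x] hom_add hom_scale hom_add hom_scale]
    by (simp add: chain_functor3_def chain_functor4_def chain_step3_def[abs_def])
  fix c c' x x' a b v
  assume a: "a \<in> Hom c c'" and b: "b \<in> Hom x' x" and v: "v \<in> fst (chain_functor3 C) c x"
  have k: "(idm (dL c') \<otimes> h) \<cdot> coevL c' \<in> Hom \<one> (dL c' \<otimes>\<^sub>o x')" if "h \<in> Hom c' x'" for h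
    using that by (intro comp_hom[OF tensor_hom[OF ident_hom] coev_l_hom])
  have bha: "b \<cdot> h \<cdot> a \<in> Hom c x" if "h \<in> Hom c' x'" for h
    using that a b by (intro comp_hom)
  show "chain_step3 C c' x' (snd (chain_functor3 C) c c' x x' a b v)
      = snd (chain_functor4 C) c c' x x' a b (chain_step3 C c x v)"
    using bend_natural[OF coev_l_hom coev_l_hom ldual_mor_hom[OF a] a _ b coev_ldual_mor[OF a]] k bha
    by (simp add: chain_functor3_def chain_functor4_def chain_step3_def restrict0_def fun_eq_iff)
qed

lemma chain_step4_natural:
  "natural_linear_iso C dual_scale dual_scale (chain_functor4 C) (chain_functor5 C) (chain_step4 C)"
  unfolding natural_linear_iso_def
proof (intro conjI allI ballI)
  show "linear_iso_on dual_scale dual_scale (fst (chain_functor4 C) c x) (fst (chain_functor5 C) c x)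
      (chain_step4 C c x)" for c x
    using linear_iso_on_dual[OF unbend_linear_iso_r[OF dual_pair_r[of c], of x] hom_add hom_scale hom_add hom_scale]
    by (simp add: chain_functor4_def chain_functor5_def chain_step4_def[abs_def])
  fix c c' x x' a b v
  assume a: "a \<in> Hom c c'" and b: "b \<in> Hom x' x" and v: "v \<in> fst (chain_functor4 C) c x"
  have unbend_hom: "(idm y \<otimes> evR d) \<cdot> (l \<otimes> idm d) \<in> Hom d y" if "l \<in> Hom \<one> (y \<otimes>\<^sub>o dR d)" for l y d
    using unbend_linear_iso_r[OF dual_pair_r[of d], of y] that
    by (auto simp: linear_iso_on_def bij_betw_def)
  have bl: "(b \<otimes> rdual_mor C c c' a) \<cdot> l \<in> Hom \<one> (x \<otimes>\<^sub>o dR c)" if "l \<in> Hom \<one> (x' \<otimes>\<^sub>o dR c')" for l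
    using that by (intro comp_hom[OF tensor_hom[OF b rdual_mor_hom[OF a]]])
  have "(idm x \<otimes> evR c) \<cdot> (((b \<otimes> rdual_mor C c c' a) \<cdot> l) \<otimes> idm c)
      = b \<cdot> ((idm x' \<otimes> evR c') \<cdot> (l \<otimes> idm c')) \<cdot> a" if l: "l \<in> Hom \<one> (x' \<otimes>\<^sub>o dR c')" for l
  proof -
    \<comment> \<open>Every \<open>l\<close> is the bend of some \<open>h\<close>, so naturality of
      unbending reduces to \<open>bend_natural_r\<close>.\<close>
    define h where "h = (idm x' \<otimes> evR c') \<cdot> (l \<otimes> idm c')"
    have h: "h \<in> Hom c' x'" "(h \<otimes> idm (dR c')) \<cdot> coevR c' = l"
      unfolding h_def by (rule unbend_hom[OF l], rule bend_unbend_r[OF dual_pair_r l])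
    have "(b \<otimes> rdual_mor C c c' a) \<cdot> l = ((b \<cdot> h \<cdot> a) \<otimes> idm (dR c)) \<cdot> coevR c"
      using bend_natural_r[OF coev_r_hom coev_r_hom rdual_mor_hom[OF a] a h(1) b coev_rdual_mor[OF a]] h(2)
      by simp
    then show ?thesis
      using unbend_bend_r[OF dual_pair_r comp_hom[OF comp_hom[OF b h(1)] a]] by (simp add: h_def)
  qed
  then show "chain_step4 C c' x' (snd (chain_functor4 C) c c' x x' a b v)
      = snd (chain_functor5 C) c c' x x' a b (chain_step4 C c x v)"
    using unbend_hom bl
    by (simp add: chain_functor4_def chain_functor5_def chain_step4_def restrict0_def fun_eq_iff)
qed

lemma chain_step5_natural:
  "natural_linear_iso C dual_scale (scale C) (chain_functor5 C) (chain_functor6 C) (chain_step5 C)"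
proof (rule natural_linear_iso_inverse[where t = "\<lambda>c x. pairing C (x \<otimes>\<^sub>o dR c)"])
  show "natural_linear_iso C (scale C) dual_scale (chain_functor6 C) (chain_functor5 C)
      (\<lambda>c x. pairing C (x \<otimes>\<^sub>o dR c))"
    unfolding natural_linear_iso_def
  proof (intro conjI allI ballI)
    show "linear_iso_on (scale C) dual_scale (fst (chain_functor6 C) c x) (fst (chain_functor5 C) c x)
        (pairing C (x \<otimes>\<^sub>o dR c))" for c x
      using pairing_linear_iso by (simp add: chain_functor6_def chain_functor5_def)
    fix c c' x x' a b v
    assume a: "a \<in> Hom c c'" and b: "b \<in> Hom x' x" and v: "v \<in> fst (chain_functor6 C) c x"
    show "pairing C (x' \<otimes>\<^sub>o dR c') (snd (chain_functor6 C) c c' x x' a b v)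
        = snd (chain_functor5 C) c c' x x' a b (pairing C (x \<otimes>\<^sub>o dR c) v)"
      using pairing_natural[OF tensor_hom[OF b rdual_mor_hom[OF a]]] v
      by (simp add: chain_functor6_def chain_functor5_def)
  qed
  show "snd (chain_functor6 C) c c' x x' a b v \<in> fst (chain_functor6 C) c' x'"
    if "a \<in> Hom c c'" "b \<in> Hom x' x" "v \<in> fst (chain_functor6 C) c x" for c c' x x' a b v
    using that comp_hom[OF _ tensor_hom[OF that(2) rdual_mor_hom[OF that(1)]]]
    by (simp add: chain_functor6_def)
  \<comment> \<open>\<open>inv_into\<close> returns a genuine preimage only for elements of the
    image; surjectivity of the pairing ensures this for every functional.\<close>
  have surj: "fst (chain_functor5 C) c x = pairing C (x \<otimes>\<^sub>o dR c) ` Hom (x \<otimes>\<^sub>o dR c) \<one>" for c x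
    using pairing_linear_iso[of "x \<otimes>\<^sub>o dR c"]
    by (simp add: linear_iso_on_def bij_betw_def chain_functor5_def)
  show "chain_step5 C c x w \<in> fst (chain_functor6 C) c x"
    "pairing C (x \<otimes>\<^sub>o dR c) (chain_step5 C c x w) = w"
    if "w \<in> fst (chain_functor5 C) c x" for c x w
    using that unfolding surj
    by (simp_all add: chain_step5_def chain_functor6_def inv_into_into f_inv_into_f)
qed (fact chain_functor_hom_closed)+

text \<open>The opposite map, transposition by the evaluation of \<open>dR c\<close>, is natural by
  \<open>ev_rdual_mor\<close>; step 6 is its inverse.\<close>

lemma chain_step6_natural:
  "natural_linear_iso C (scale C) (scale C) (chain_functor6 C) (chain_functor7 C) (chain_step6 C)"
proof (rule natural_linear_iso_inverse[where t = "\<lambda>c x f. evR (dR c) \<cdot> (f \<otimes> idm (dR c))"])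
  show "natural_linear_iso C (scale C) (scale C) (chain_functor7 C) (chain_functor6 C)
      (\<lambda>c x f. evR (dR c) \<cdot> (f \<otimes> idm (dR c)))"
    unfolding natural_linear_iso_def
  proof (intro conjI allI ballI)
    show "linear_iso_on (scale C) (scale C) (fst (chain_functor7 C) c x) (fst (chain_functor6 C) c x)
        (\<lambda>f. evR (dR c) \<cdot> (f \<otimes> idm (dR c)))" for c x
      using transpose_linear_iso_r[OF dual_pair_r[of "dR c"], of x]
      by (simp add: chain_functor6_def chain_functor7_def rdual2_def)
    fix c c' x x' a b v
    assume a: "a \<in> Hom c c'" and b: "b \<in> Hom x' x" and v: "v \<in> fst (chain_functor7 C) c x"
    show "evR (dR c') \<cdot> (snd (chain_functor7 C) c c' x x' a b v \<otimes> idm (dR c'))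
        = snd (chain_functor6 C) c c' x x' a b (evR (dR c) \<cdot> (v \<otimes> idm (dR c)))"
      using transpose_natural_r[OF ev_r_hom ev_r_hom rdual_mor_hom[OF rdual_mor_hom[OF a]]
          rdual_mor_hom[OF a] _ b ev_rdual_mor[OF rdual_mor_hom[OF a]]] v
      by (simp add: chain_functor6_def chain_functor7_def rdual2_def rdual2_mor_def)
  qed
  show "snd (chain_functor7 C) c c' x x' a b v \<in> fst (chain_functor7 C) c' x'"
    if "a \<in> Hom c c'" "b \<in> Hom x' x" "v \<in> fst (chain_functor7 C) c x" for c c' x x' a b v
    using that comp_hom[OF comp_hom[OF rdual2_mor_hom[OF that(1)]] that(2)]
    by (simp add: chain_functor7_def)
  show "chain_step6 C c x w \<in> fst (chain_functor7 C) c x"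
    if "w \<in> fst (chain_functor6 C) c x" for c x w
  proof -
    have "w \<otimes> idm (rdual2 C c) \<in> Hom (x \<otimes>\<^sub>o dR c \<otimes>\<^sub>o rdual2 C c) (rdual2 C c)"
      using tensor_hom[OF _ ident_hom, of w "x \<otimes>\<^sub>o dR c" \<one> "rdual2 C c"] that
      by (simp add: chain_functor6_def)
    moreover have "idm x \<otimes> coevR (dR c) \<in> Hom x (x \<otimes>\<^sub>o dR c \<otimes>\<^sub>o rdual2 C c)"
      using tensor_hom[OF ident_hom coev_r_hom, of x "dR c"] by (simp add: rdual2_def)
    ultimately show ?thesis
      unfolding chain_step6_def chain_functor7_def by (simp add: comp_hom)
  qed
  show "evR (dR c) \<cdot> (chain_step6 C c x w \<otimes> idm (dR c)) = w"
    if "w \<in> fst (chain_functor6 C) c x" for c x w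
    using ev_transpose_r[OF dual_pair_r, of w x "dR c"] that
    by (simp add: chain_step6_def chain_functor6_def rdual2_def)
qed (fact chain_functor_hom_closed)+

lemma chain_natural:
  "natural_linear_iso C (scale C) (scale C) (chain_functor1 C) (chain_functor7 C) (chain C)"
proof -
  have "chain C = (\<lambda>c x. chain_step6 C c x \<circ> (chain_step5 C c x \<circ> (chain_step4 C c x \<circ>
      (chain_step3 C c x \<circ> (chain_step2 C c x \<circ> chain_step1 C c x)))))"
    by (simp add: chain_def fun_eq_iff)
  then show ?thesis
    by (simp only:) (intro natural_linear_iso_comp[OF _ chain_step6_natural]
        natural_linear_iso_comp[OF _ chain_step5_natural]
        natural_linear_iso_comp[OF _ chain_step4_natural]
        natural_linear_iso_comp[OF _ chain_step3_natural]
        natural_linear_iso_comp[OF chain_step1_natural chain_step2_natural])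
qed

lemma chain_bij:
  "bij_betw (chain C c x) (Hom x (ldual2 C c)) (Hom x (rdual2 C c))"
  using chain_natural
  by (simp add: natural_linear_iso_def linear_iso_on_def chain_functor1_def chain_functor7_def)

lemma chain_hom: "f \<in> Hom x (ldual2 C c) \<Longrightarrow> chain C c x f \<in> Hom x (rdual2 C c)"
  using chain_bij[of c x] by (auto simp: bij_betw_def)

section \<open>Traces and the morphism representing the chain\<close>

definition trace_r :: "'a \<Rightarrow> 'b \<Rightarrow> 'b"
  where "trace_r c m = evR (dR c) \<cdot> (m \<otimes> idm (dR c)) \<cdot> coevR c"

definition trace_l :: "'a \<Rightarrow> 'b \<Rightarrow> 'b"
  where "trace_l c m = evL (dL c) \<cdot> (idm (dL c) \<otimes> m) \<cdot> coevL c"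

lemma trace_r_comp:
  "\<lbrakk>m \<in> Hom x (rdual2 C c); h \<in> Hom c x\<rbrakk> \<Longrightarrow>
    trace_r c (m \<cdot> h) = (evR (dR c) \<cdot> (m \<otimes> idm (dR c))) \<cdot> ((h \<otimes> idm (dR c)) \<cdot> coevR c)"
  unfolding trace_r_def rdual2_def by (rule trace_comp_r[OF ev_r_hom coev_r_hom])

lemma trace_l_comp:
  "\<lbrakk>m \<in> Hom x (ldual2 C c); h \<in> Hom c x\<rbrakk> \<Longrightarrow>
    trace_l c (m \<cdot> h) = (evL (dL c) \<cdot> (idm (dL c) \<otimes> m)) \<cdot> ((idm (dL c) \<otimes> h) \<cdot> coevL c)"
  unfolding trace_l_def ldual2_def by (rule trace_comp[OF ev_l_hom coev_l_hom])

text \<open>Nondegeneracy of the right trace. Each \<open>l : 1 -> x \<otimes> c*\<close> is the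
  bend of some \<open>h\<close>, so the hypothesis says that the transposes of \<open>m\<close> and
  \<open>m'\<close> agree against every \<open>l\<close>. The perfect pairing makes the transposes
  equal, and transposition is injective.\<close>

lemma trace_r_eqI:
  assumes m: "m \<in> Hom x (rdual2 C c)" "m' \<in> Hom x (rdual2 C c)"
    and eq: "\<And>h. h \<in> Hom c x \<Longrightarrow> trace_r c (m \<cdot> h) = trace_r c (m' \<cdot> h)"
  shows "m = m'"
proof -
  have "evR (dR c) \<cdot> (m \<otimes> idm (dR c)) = evR (dR c) \<cdot> (m' \<otimes> idm (dR c))"
  proof (rule pairing_eqI)
    fix l assume l: "l \<in> Hom \<one> (x \<otimes>\<^sub>o dR c)"
    define h where "h = (idm x \<otimes> evR c) \<cdot> (l \<otimes> idm c)"
    have "h \<in> Hom c x"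
      using unbend_linear_iso_r[OF dual_pair_r[of c], of x] l
      by (auto simp: h_def linear_iso_on_def bij_betw_def)
    moreover have "(h \<otimes> idm (dR c)) \<cdot> coevR c = l"
      unfolding h_def by (rule bend_unbend_r[OF dual_pair_r l])
    ultimately show "(evR (dR c) \<cdot> (m \<otimes> idm (dR c))) \<cdot> l = (evR (dR c) \<cdot> (m' \<otimes> idm (dR c))) \<cdot> l"
      using eq[of h] m by (simp add: trace_r_comp)
  qed (use m in \<open>auto simp: rdual2_def intro!: comp_hom[OF ev_r_hom tensor_hom[OF _ ident_hom]]\<close>)
  then show ?thesis
    using transpose_linear_iso_r[OF dual_pair_r[of "dR c"], of x] m
    by (auto simp: linear_iso_on_def bij_betw_def rdual2_def dest: inj_onD)
qed

text \<open>With \<open>u\<close> the transpose of \<open>f\<close> and \<open>v\<close> the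
  preimage chosen in step 5, the claim is \<open>v \<cdot> l = u \<cdot> k\<close>, where
  \<open>l\<close> and \<open>k\<close> are the bends of \<open>h\<close> to the right and to the
  left. Step 6 makes \<open>v\<close> the transpose of \<open>chain C c x f\<close>.\<close>

lemma chain_trace:
  assumes f: "f \<in> Hom x (ldual2 C c)" and h: "h \<in> Hom c x"
  shows "trace_r c (chain C c x f \<cdot> h) = trace_l c (f \<cdot> h)"
proof -
  define u where "u = evL (dL c) \<cdot> (idm (dL c) \<otimes> f)"
  define \<psi> where "\<psi> = chain_step4 C c x (chain_step3 C c x (pairing C (dL c \<otimes>\<^sub>o x) u))"
  define v where "v = chain_step5 C c x \<psi>"
  define l where "l = (h \<otimes> idm (dR c)) \<cdot> coevR c"
  define k where "k = (idm (dL c) \<otimes> h) \<cdot> coevL c"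
  have u: "u \<in> Hom (dL c \<otimes>\<^sub>o x) \<one>"
    using f comp_hom[OF ev_l_hom tensor_hom[OF ident_hom]] by (simp add: u_def ldual2_def)
  have l: "l \<in> Hom \<one> (x \<otimes>\<^sub>o dR c)"
    unfolding l_def by (rule comp_hom[OF tensor_hom[OF h ident_hom] coev_r_hom])
  have k: "k \<in> Hom \<one> (dL c \<otimes>\<^sub>o x)"
    unfolding k_def by (rule comp_hom[OF tensor_hom[OF ident_hom h] coev_l_hom])
  have "pairing C (dL c \<otimes>\<^sub>o x) u \<in> fst (chain_functor3 C) c x"
    using pairing_in_dual_space[OF u] by (simp add: chain_functor3_def)
  then have "\<psi> \<in> fst (chain_functor5 C) c x"
    unfolding \<psi>_def
    by (intro natural_linear_iso_mem[OF chain_step4_natural] natural_linear_iso_mem[OF chain_step3_natural])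
  then have \<psi>: "\<psi> \<in> pairing C (x \<otimes>\<^sub>o dR c) ` Hom (x \<otimes>\<^sub>o dR c) \<one>"
    using pairing_linear_iso[of "x \<otimes>\<^sub>o dR c"]
    by (simp add: chain_functor5_def linear_iso_on_def bij_betw_def)
  then have v: "v \<in> Hom (x \<otimes>\<^sub>o dR c) \<one>" "pairing C (x \<otimes>\<^sub>o dR c) v = \<psi>"
    by (simp_all add: v_def chain_step5_def inv_into_into f_inv_into_f)
  \<comment> \<open>Step 4 unbends \<open>l\<close> back to \<open>h\<close>, and step 3 bends
    \<open>h\<close> to the other side, giving \<open>k\<close>.\<close>
  have "\<psi> l = pairing C (dL c \<otimes>\<^sub>o x) u k"
    using l h unbend_bend_r[OF dual_pair_r h, folded l_def]
    by (simp add: \<psi>_def chain_step4_def chain_step3_def restrict0_def k_def)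
  then have "v \<cdot> l = u \<cdot> k"
    using scale_pairing[OF v(1) l] scale_pairing[OF u k] v(2) by simp
  moreover have "chain C c x f = chain_step6 C c x v"
    by (simp add: chain_def v_def \<psi>_def u_def chain_step1_def chain_step2_def)
  then have "v = evR (dR c) \<cdot> (chain C c x f \<otimes> idm (dR c))"
    using ev_transpose_r[OF dual_pair_r v(1)] by (simp add: chain_step6_def rdual2_def)
  ultimately show ?thesis
    using trace_r_comp[OF chain_hom[OF f] h] trace_l_comp[OF f h] by (simp add: u_def l_def k_def)
qed

lemma double_dual_iso_hom: "double_dual_iso C c \<in> Hom (ldual2 C c) (rdual2 C c)"
  unfolding double_dual_iso_def by (rule chain_hom[OF ident_hom])

lemma double_dual_iso_trace:
  "h \<in> Hom c (ldual2 C c) \<Longrightarrow> trace_r c (double_dual_iso C c \<cdot> h) = trace_l c h"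
  unfolding double_dual_iso_def using chain_trace[OF ident_hom] by (simp add: ident_comp)

text \<open>The Yoneda formula, obtained from nondegeneracy: against every \<open>h\<close> both
  sides have the right trace \<open>trace_l c (f \<cdot> h)\<close>.\<close>

lemma chain_eq_double_dual_iso:
  assumes f: "f \<in> Hom x (ldual2 C c)"
  shows "chain C c x f = double_dual_iso C c \<cdot> f"
proof (rule trace_r_eqI[OF chain_hom[OF f] comp_hom[OF double_dual_iso_hom f]])
  fix h assume h: "h \<in> Hom c x"
  show "trace_r c (chain C c x f \<cdot> h) = trace_r c (double_dual_iso C c \<cdot> f \<cdot> h)"
    using chain_trace[OF f h] double_dual_iso_trace[OF comp_hom[OF f h]]
      comp_assoc[OF double_dual_iso_hom f h] by simp
qed

lemma double_dual_iso_unique_chain: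
  assumes k: "k \<in> Hom (ldual2 C c) (rdual2 C c)"
  shows "(\<forall>x. \<forall>f\<in>Hom x (ldual2 C c). chain C c x f = k \<cdot> f) \<longleftrightarrow> k = double_dual_iso C c"
  using chain_eq_double_dual_iso comp_ident[OF k] ident_hom by (metis double_dual_iso_def)

text \<open>The case where \<open>f\<close> is an identity fixes \<open>k\<close>, by nondegeneracy.
  Conversely composing with \<open>double_dual_iso C c\<close> is the chain, whose traces are
  known.\<close>

lemma double_dual_iso_unique_trace:
  assumes k: "k \<in> Hom (ldual2 C c) (rdual2 C c)"
  shows "(\<forall>x. \<forall>f\<in>Hom x (ldual2 C c). \<forall>h\<in>Hom c x. trace_r c (k \<cdot> f \<cdot> h) = trace_l c (f \<cdot> h))
    \<longleftrightarrow> k = double_dual_iso C c"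
proof
  assume eq: "\<forall>x. \<forall>f\<in>Hom x (ldual2 C c). \<forall>h\<in>Hom c x. trace_r c (k \<cdot> f \<cdot> h) = trace_l c (f \<cdot> h)"
  show "k = double_dual_iso C c"
  proof (rule trace_r_eqI[OF k double_dual_iso_hom])
    fix h assume h: "h \<in> Hom c (ldual2 C c)"
    have "trace_r c (k \<cdot> h) = trace_l c h"
      using eq[rule_format, OF ident_hom h] by (simp add: comp_ident[OF k] ident_comp[OF h])
    then show "trace_r c (k \<cdot> h) = trace_r c (double_dual_iso C c \<cdot> h)"
      by (simp add: double_dual_iso_trace[OF h])
  qed
next
  assume "k = double_dual_iso C c"
  then show "\<forall>x. \<forall>f\<in>Hom x (ldual2 C c). \<forall>h\<in>Hom c x. trace_r c (k \<cdot> f \<cdot> h) = trace_l c (f \<cdot> h)"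
    using chain_trace chain_eq_double_dual_iso by metis
qed

text \<open>Composition with \<open>?g\<close> is the bijective chain. Surjectivity at
  \<open>rdual2 C c\<close> yields a right inverse \<open>f\<close>; then
  \<open>f \<cdot> ?g\<close> and the identity have the same image, so injectivity at
  \<open>ldual2 C c\<close> makes \<open>f\<close> a left inverse as well.\<close>

lemma double_dual_iso_is_iso: "is_iso C (ldual2 C c) (rdual2 C c) (double_dual_iso C c)"
proof -
  let ?g = "double_dual_iso C c"
  note g = double_dual_iso_hom[of c]
  have "idm (rdual2 C c) \<in> chain C c (rdual2 C c) ` Hom (rdual2 C c) (ldual2 C c)"
    using bij_betw_imp_surj_on[OF chain_bij[of c "rdual2 C c"]] ident_hom by simp
  then obtain f where f: "idm (rdual2 C c) = chain C c (rdual2 C c) f" "f \<in> Hom (rdual2 C c) (ldual2 C c)"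
    by (rule imageE)
  have gf: "?g \<cdot> f = idm (rdual2 C c)"
    using f(1) unfolding chain_eq_double_dual_iso[OF f(2)] by (rule sym)
  have fg: "f \<cdot> ?g \<in> Hom (ldual2 C c) (ldual2 C c)"
    by (rule comp_hom[OF f(2) g])
  have "?g \<cdot> (f \<cdot> ?g) = ?g \<cdot> idm (ldual2 C c)"
    using comp_assoc[OF g f(2) g] ident_comp[OF g] comp_ident[OF g] by (simp only: gf)
  then have "chain C c (ldual2 C c) (f \<cdot> ?g) = chain C c (ldual2 C c) (idm (ldual2 C c))"
    by (simp only: chain_eq_double_dual_iso[OF fg] chain_eq_double_dual_iso[OF ident_hom])
  then have "f \<cdot> ?g = idm (ldual2 C c)"
    by (rule inj_onD[OF bij_betw_imp_inj_on[OF chain_bij] _ fg ident_hom])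
  then show ?thesis
    using f(2) g gf unfolding is_iso_def by blast
qed

lemma double_dual_iso_natural:
  assumes f: "f \<in> Hom c d"
  shows "double_dual_iso C d \<cdot> ldual2_mor C c d f = rdual2_mor C c d f \<cdot> double_dual_iso C c"
proof -
  let ?i = "idm (ldual2 C c)"
  have i: "?i \<in> fst (chain_functor1 C) c (ldual2 C c)"
    by (simp add: chain_functor1_def ident_hom)
  \<comment> \<open>Naturality of the chain in \<open>c\<close>, applied to the identity of
    \<open>ldual2 C c\<close>. One \<open>?i\<close> is that element, the other is the trivial
    change of the second variable.\<close>
  have "chain C d (ldual2 C c) (ldual2_mor C c d f \<cdot> ?i \<cdot> ?i)
      = rdual2_mor C c d f \<cdot> double_dual_iso C c \<cdot> ?i"
    using natural_linear_isoD[OF chain_natural f ident_hom i]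
    by (simp add: chain_functor1_def chain_functor7_def flip: double_dual_iso_def)
  then show ?thesis
    by (simp only: chain_eq_double_dual_iso[OF ldual2_mor_hom[OF f]] comp_ident[OF ldual2_mor_hom[OF f]]
        comp_ident[OF comp_hom[OF rdual2_mor_hom[OF f] double_dual_iso_hom]])
qed

end

section \<open>Monoidality\<close>

context rigid_linear_category
begin

lemma dual_pair_nested_r:
  "dual_pair C (dR d \<otimes>\<^sub>o dR c) (c \<otimes>\<^sub>o d) (ev_r_nested C c d) (coev_r_nested C c d)"
  unfolding ev_r_nested_def coev_r_nested_def by (rule dual_pair_nested[OF dual_pair_r dual_pair_r])

lemma dual_pair_nested_l:
  "dual_pair C (c \<otimes>\<^sub>o d) (dL d \<otimes>\<^sub>o dL c) (ev_l_nested C c d) (coev_l_nested C c d)"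
  unfolding ev_l_nested_def coev_l_nested_def by (rule dual_pair_nested[OF dual_pair_l dual_pair_l])

text \<open>In each of the four groups, item 1 is the typing, item 2 the compatibility with
  evaluations and item 3 the compatibility with coevaluations.\<close>

lemmas ldual_tensor = ldual_comparison[OF dual_pair_nested_l dual_pair_l, folded ldual_tensor_def]
  and ldual_tensor_inv =
    ldual_comparison[OF dual_pair_l dual_pair_nested_l, folded ldual_tensor_inv_def]
  and rdual_tensor = rdual_comparison[OF dual_pair_nested_r dual_pair_r, folded rdual_tensor_def]
  and rdual_tensor_inv =
    rdual_comparison[OF dual_pair_r dual_pair_nested_r, folded rdual_tensor_inv_def]

lemma ldual2_tensor_hom:
  "ldual2_tensor C c d \<in> Hom (ldual2 C c \<otimes>\<^sub>o ldual2 C d) (ldual2 C (c \<otimes>\<^sub>o d))"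
  unfolding ldual2_tensor_def ldual2_def
  by (rule comp_hom[OF ldual_mor_hom[OF ldual_tensor_inv(1)] ldual_tensor(1)])

lemma rdual2_tensor_hom:
  "rdual2_tensor C c d \<in> Hom (rdual2 C c \<otimes>\<^sub>o rdual2 C d) (rdual2 C (c \<otimes>\<^sub>o d))"
  unfolding rdual2_tensor_def rdual2_def
  by (rule comp_hom[OF rdual_mor_hom[OF rdual_tensor_inv(1)] rdual_tensor(1)])

text \<open>The zigzag equation at the unit, where tensoring with \<open>idm \<one>\<close>
  disappears.\<close>

lemma evL_coevL_unit: "evL \<one> \<cdot> coevL \<one> = idm \<one>"
  using snake_l[of \<one>] tensor_unit[OF ev_l_hom, of \<one>] unit_tensor[OF coev_l_hom, of \<one>] by simp

lemma evR_coevR_unit: "evR \<one> \<cdot> coevR \<one> = idm \<one>"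
  using snake_r[of \<one>] tensor_unit[OF coev_r_hom, of \<one>] unit_tensor[OF ev_r_hom, of \<one>] by simp

lemma ev_l_unit_hom: "evL \<one> \<in> Hom (dL \<one>) \<one>"
  and coev_l_unit_hom: "coevL \<one> \<in> Hom \<one> (dL \<one>)"
  and ev_r_unit_hom: "evR \<one> \<in> Hom (dR \<one>) \<one>"
  and coev_r_unit_hom: "coevR \<one> \<in> Hom \<one> (dR \<one>)"
  using ev_l_hom[of \<one>] coev_l_hom[of \<one>] ev_r_hom[of \<one>] coev_r_hom[of \<one>] by simp_all

lemma ldual2_unit_hom: "ldual2_unit C \<in> Hom \<one> (ldual2 C \<one>)"
  unfolding ldual2_unit_def ldual2_def
  by (rule comp_hom[OF ldual_mor_hom[OF ev_l_unit_hom] coev_l_unit_hom])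

lemma rdual2_unit_hom: "rdual2_unit C \<in> Hom \<one> (rdual2 C \<one>)"
  unfolding rdual2_unit_def rdual2_def
  by (rule comp_hom[OF rdual_mor_hom[OF ev_r_unit_hom] coev_r_unit_hom])

end

section \<open>Traces over tensor products and over the unit\<close>

context fusion_category
begin

text \<open>The two factors of \<open>ldual2_tensor\<close> replace the chosen duals by nested ones,
  one in the coevaluation and one in the evaluation of the trace. A trace formed with nested duals
  is an iterated partial trace, here with \<open>c\<close> closed first.\<close>

lemma trace_l_ldual2_tensor:
  assumes h: "h \<in> Hom (c \<otimes>\<^sub>o d) (ldual2 C c \<otimes>\<^sub>o ldual2 C d)"
  shows "trace_l (c \<otimes>\<^sub>o d) (ldual2_tensor C c d \<cdot> h) =
    trace_l d ((evL (dL c) \<otimes> idm (ldual2 C d)) \<cdot> (idm (dL c) \<otimes> h) \<cdot> (coevL c \<otimes> idm d))"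
proof -
  let ?p = "ldual_tensor_inv C c d" and ?q = "ldual_tensor C (dL d) (dL c)"
  let ?v = "dL d \<otimes>\<^sub>o dL c"
  note h' = h[unfolded ldual2_def]
  note qh = comp_hom[OF ldual_tensor(1) h']
  have "trace_l (c \<otimes>\<^sub>o d) (ldual2_tensor C c d \<cdot> h)
      = trace_l (c \<otimes>\<^sub>o d) (ldual_mor C (dL (c \<otimes>\<^sub>o d)) ?v ?p \<cdot> (?q \<cdot> h))"
    unfolding ldual2_tensor_def
    by (simp only: comp_assoc[OF ldual_mor_hom[OF ldual_tensor_inv(1)] ldual_tensor(1) h'])
  \<comment> \<open>The dual of \<open>?p\<close> goes around the trace as \<open>?p\<close> itself
    and turns the coevaluation of \<open>c \<otimes> d\<close> into the nested one.\<close>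
  also have "\<dots> = evL ?v \<cdot> (idm ?v \<otimes> (?q \<cdot> h)) \<cdot> coev_l_nested C c d"
    unfolding trace_l_def
    by (rule trace_slide[OF ev_l_hom ev_l_hom coev_l_hom ldual_mor_hom[OF ldual_tensor_inv(1)]
          ldual_tensor_inv(1) qh ev_ldual_mor[OF ldual_tensor_inv(1)] ldual_tensor_inv(3)])
  \<comment> \<open>Here \<open>?q\<close> is absorbed into the evaluation, and nothing moves to the
    dual strand: the role of \<open>p\<close> in \<open>trace_slide\<close> is taken by an
    identity.\<close>
  also have "\<dots> = ev_l_nested C (dL d) (dL c) \<cdot> (idm ?v \<otimes> h) \<cdot> coev_l_nested C c d"
  proof (rule trace_slide[OF ev_l_hom _ _ ldual_tensor(1) ident_hom h'])
    show e: "ev_l_nested C (dL d) (dL c) \<in> Hom (?v \<otimes>\<^sub>o dL (dL c) \<otimes>\<^sub>o dL (dL d)) \<one>"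
      using dual_pairD(1)[OF dual_pair_nested_l] .
    show k: "coev_l_nested C c d \<in> Hom \<one> (?v \<otimes>\<^sub>o c \<otimes>\<^sub>o d)"
      using dual_pairD(2)[OF dual_pair_nested_l] .
    show "evL ?v \<cdot> (idm ?v \<otimes> ?q)
        = ev_l_nested C (dL d) (dL c) \<cdot> (idm ?v \<otimes> idm (dL (dL c) \<otimes>\<^sub>o dL (dL d)))"
      using ldual_tensor(2)[of "dL d" "dL c"] comp_ident[OF e] by (simp add: tensor_ident)
    show "(idm ?v \<otimes> idm (c \<otimes>\<^sub>o d)) \<cdot> coev_l_nested C c d = coev_l_nested C c d"
      using ident_comp[OF k] by (simp add: tensor_ident)
  qed
  also have "\<dots> = evL (dL d) \<cdot> (idm (dL d) \<otimes>
      ((evL (dL c) \<otimes> idm (dL (dL d))) \<cdot> (idm (dL c) \<otimes> h) \<cdot> (coevL c \<otimes> idm d))) \<cdot> coevL d"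
    unfolding ev_l_nested_def coev_l_nested_def
    by (rule nested_trace[OF ev_l_hom coev_l_hom ev_l_hom coev_l_hom h'])
  finally show ?thesis by (simp only: trace_l_def ldual2_def)
qed

text \<open>The same two slides on the other side. Nested right duals put \<open>d\<close> on the
  inside, so now \<open>d\<close> is closed first.\<close>

lemma trace_r_rdual2_tensor:
  assumes h: "h \<in> Hom (c \<otimes>\<^sub>o d) (rdual2 C c \<otimes>\<^sub>o rdual2 C d)"
  shows "trace_r (c \<otimes>\<^sub>o d) (rdual2_tensor C c d \<cdot> h) =
    trace_r c ((idm (rdual2 C c) \<otimes> evR (dR d)) \<cdot> (h \<otimes> idm (dR d)) \<cdot> (idm c \<otimes> coevR d))"
proof -
  let ?p = "rdual_tensor_inv C c d" and ?q = "rdual_tensor C (dR d) (dR c)"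
  let ?v = "dR d \<otimes>\<^sub>o dR c"
  note h' = h[unfolded rdual2_def]
  note qh = comp_hom[OF rdual_tensor(1) h']
  have "trace_r (c \<otimes>\<^sub>o d) (rdual2_tensor C c d \<cdot> h)
      = trace_r (c \<otimes>\<^sub>o d) (rdual_mor C (dR (c \<otimes>\<^sub>o d)) ?v ?p \<cdot> (?q \<cdot> h))"
    unfolding rdual2_tensor_def
    by (simp only: comp_assoc[OF rdual_mor_hom[OF rdual_tensor_inv(1)] rdual_tensor(1) h'])
  also have "\<dots> = evR ?v \<cdot> ((?q \<cdot> h) \<otimes> idm ?v) \<cdot> coev_r_nested C c d"
    unfolding trace_r_def
    by (rule trace_slide_r[OF ev_r_hom ev_r_hom coev_r_hom rdual_mor_hom[OF rdual_tensor_inv(1)]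
          rdual_tensor_inv(1) qh ev_rdual_mor[OF rdual_tensor_inv(1)] rdual_tensor_inv(3)])
  also have "\<dots> = ev_r_nested C (dR d) (dR c) \<cdot> (h \<otimes> idm ?v) \<cdot> coev_r_nested C c d"
  proof (rule trace_slide_r[OF ev_r_hom _ _ rdual_tensor(1) ident_hom h'])
    show e: "ev_r_nested C (dR d) (dR c) \<in> Hom ((dR (dR c) \<otimes>\<^sub>o dR (dR d)) \<otimes>\<^sub>o ?v) \<one>"
      using dual_pairD(1)[OF dual_pair_nested_r] .
    show k: "coev_r_nested C c d \<in> Hom \<one> ((c \<otimes>\<^sub>o d) \<otimes>\<^sub>o ?v)"
      using dual_pairD(2)[OF dual_pair_nested_r] .
    show "evR ?v \<cdot> (?q \<otimes> idm ?v)
        = ev_r_nested C (dR d) (dR c) \<cdot> (idm (dR (dR c) \<otimes>\<^sub>o dR (dR d)) \<otimes> idm ?v)"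
      using rdual_tensor(2)[of "dR d" "dR c"] comp_ident[OF e] by (simp add: tensor_ident)
    show "(idm (c \<otimes>\<^sub>o d) \<otimes> idm ?v) \<cdot> coev_r_nested C c d = coev_r_nested C c d"
      using ident_comp[OF k] by (simp add: tensor_ident)
  qed
  also have "\<dots> = evR (dR c) \<cdot> (((idm (dR (dR c)) \<otimes> evR (dR d)) \<cdot> (h \<otimes> idm (dR d)) \<cdot>
      (idm c \<otimes> coevR d)) \<otimes> idm (dR c)) \<cdot> coevR c"
    unfolding ev_r_nested_def coev_r_nested_def
    by (rule nested_trace_r[OF ev_r_hom coev_r_hom ev_r_hom coev_r_hom h'])
  finally show ?thesis by (simp only: trace_r_def rdual2_def)
qed

lemma double_dual_iso_tensor:
  "double_dual_iso C (c \<otimes>\<^sub>o d) \<cdot> ldual2_tensor C c d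
    = rdual2_tensor C c d \<cdot> (double_dual_iso C c \<otimes> double_dual_iso C d)"
proof -
  let ?g = "double_dual_iso C"
  have gg: "?g c \<otimes> ?g d \<in> Hom (ldual2 C c \<otimes>\<^sub>o ldual2 C d) (rdual2 C c \<otimes>\<^sub>o rdual2 C d)"
    by (intro tensor_hom double_dual_iso_hom)
  show ?thesis
  proof (rule trace_r_eqI[OF comp_hom[OF double_dual_iso_hom ldual2_tensor_hom]
        comp_hom[OF rdual2_tensor_hom gg]])
    fix h assume h: "h \<in> Hom (c \<otimes>\<^sub>o d) (ldual2 C c \<otimes>\<^sub>o ldual2 C d)"
    \<comment> \<open>\<open>e\<close> is the evaluation with \<open>?g d\<close> built in, so that
      \<open>q\<close>, the right partial trace of \<open>h\<close> over \<open>d\<close> closed by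
      \<open>e\<close>, already contains \<open>?g d\<close> and still ends in
      \<open>ldual2 C c\<close>, where \<open>?g c\<close> can act. \<open>s\<close> is the left
      partial trace of \<open>h\<close> over \<open>c\<close>.\<close>
    define e where "e = evR (dR d) \<cdot> (?g d \<otimes> idm (dR d))"
    define s where "s = (evL (dL c) \<otimes> idm (ldual2 C d)) \<cdot> (idm (dL c) \<otimes> h) \<cdot> (coevL c \<otimes> idm d)"
    define q where "q = (idm (ldual2 C c) \<otimes> e) \<cdot> (h \<otimes> idm (dR d)) \<cdot> (idm c \<otimes> coevR d)"
    have e: "e \<in> Hom (ldual2 C d \<otimes>\<^sub>o dR d) \<one>"
      using comp_hom[OF ev_r_hom tensor_hom[OF double_dual_iso_hom[of d, unfolded rdual2_def] ident_hom]]
      by (simp add: e_def)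
    have evl: "evL (dL c) \<in> Hom (dL c \<otimes>\<^sub>o ldual2 C c) \<one>"
      using ev_l_hom by (simp add: ldual2_def)
    have "evL (dL c) \<otimes> idm (ldual2 C d) \<in> Hom (dL c \<otimes>\<^sub>o ldual2 C c \<otimes>\<^sub>o ldual2 C d) (ldual2 C d)"
      "coevL c \<otimes> idm d \<in> Hom d (dL c \<otimes>\<^sub>o c \<otimes>\<^sub>o d)"
      using tensor_hom[OF evl ident_hom, of "ldual2 C d"] tensor_hom[OF coev_l_hom ident_hom, of c d]
      by simp_all
    then have s: "s \<in> Hom d (ldual2 C d)"
      unfolding s_def by (rule comp_hom[OF comp_hom[OF _ tensor_hom[OF ident_hom h]]])
    have "idm (ldual2 C c) \<otimes> e \<in> Hom (ldual2 C c \<otimes>\<^sub>o ldual2 C d \<otimes>\<^sub>o dR d) (ldual2 C c)"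
      "h \<otimes> idm (dR d) \<in> Hom (c \<otimes>\<^sub>o d \<otimes>\<^sub>o dR d) (ldual2 C c \<otimes>\<^sub>o ldual2 C d \<otimes>\<^sub>o dR d)"
      "idm c \<otimes> coevR d \<in> Hom c (c \<otimes>\<^sub>o d \<otimes>\<^sub>o dR d)"
      using tensor_hom[OF ident_hom e, of "ldual2 C c"] tensor_hom[OF h ident_hom, of "dR d"]
        tensor_hom[OF ident_hom coev_r_hom, of c d]
      by simp_all
    then have q: "q \<in> Hom c (ldual2 C c)"
      unfolding q_def by (rule comp_hom[OF comp_hom])
    have "trace_r (c \<otimes>\<^sub>o d) (?g (c \<otimes>\<^sub>o d) \<cdot> ldual2_tensor C c d \<cdot> h)
        = trace_l (c \<otimes>\<^sub>o d) (ldual2_tensor C c d \<cdot> h)"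
      using double_dual_iso_trace[OF comp_hom[OF ldual2_tensor_hom h]]
        comp_assoc[OF double_dual_iso_hom ldual2_tensor_hom h] by simp
    \<comment> \<open>Closing \<open>c\<close> first leaves the left trace of \<open>s\<close> over
      \<open>d\<close>, which becomes a right trace at the price of inserting
      \<open>?g d\<close>.\<close>
    also have "\<dots> = trace_r d (?g d \<cdot> s)"
      using trace_l_ldual2_tensor[OF h] double_dual_iso_trace[OF s] by (simp add: s_def)
    also have "\<dots> = e \<cdot> (s \<otimes> idm (dR d)) \<cdot> coevR d"
    proof -
      have "s \<otimes> idm (dR d) \<in> Hom (d \<otimes>\<^sub>o dR d) (ldual2 C d \<otimes>\<^sub>o dR d)"
        by (rule tensor_hom[OF s ident_hom])
      then show ?thesis
        using trace_r_comp[OF double_dual_iso_hom s] comp_assoc[OF e _ coev_r_hom]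
        by (simp add: e_def)
    qed
    \<comment> \<open>The order of the two partial traces is exchanged, leaving \<open>c\<close> as
      the strand of the outer left trace.\<close>
    also have "\<dots> = trace_l c q"
      unfolding trace_l_def s_def q_def
      by (rule partial_traces[OF evl coev_l_hom e coev_r_hom h, symmetric])
    \<comment> \<open>The outer left trace becomes a right trace, which inserts \<open>?g c\<close>;
      both strands are now closed on the right.\<close>
    also have "\<dots> = trace_r c (?g c \<cdot> q)"
      by (rule double_dual_iso_trace[OF q, symmetric])
    also have "?g c \<cdot> q = (idm (rdual2 C c) \<otimes> evR (dR d)) \<cdot> (((?g c \<otimes> ?g d) \<cdot> h) \<otimes> idm (dR d)) \<cdot>
        (idm c \<otimes> coevR d)"
      unfolding q_def e_def
      by (rule partial_trace_comp[OF double_dual_iso_hom double_dual_iso_hom _ coev_r_hom h])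
        (simp add: rdual2_def ev_r_hom)
    also have "trace_r c \<dots> = trace_r (c \<otimes>\<^sub>o d) (rdual2_tensor C c d \<cdot> ((?g c \<otimes> ?g d) \<cdot> h))"
      by (rule trace_r_rdual2_tensor[OF comp_hom[OF gg h], symmetric])
    also have "\<dots> = trace_r (c \<otimes>\<^sub>o d) (rdual2_tensor C c d \<cdot> (?g c \<otimes> ?g d) \<cdot> h)"
      by (simp only: comp_assoc[OF rdual2_tensor_hom gg h])
    finally show "trace_r (c \<otimes>\<^sub>o d) (?g (c \<otimes>\<^sub>o d) \<cdot> ldual2_tensor C c d \<cdot> h)
        = trace_r (c \<otimes>\<^sub>o d) (rdual2_tensor C c d \<cdot> (?g c \<otimes> ?g d) \<cdot> h)" .
  qed
qed

text \<open>Sliding the dual of \<open>evL \<one>\<close> around the trace cancels the coevaluation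
  against \<open>evL \<one>\<close>. The remaining factor \<open>coevL \<one>\<close> of
  \<open>ldual2_unit\<close> then meets the other evaluation, and only \<open>h\<close>
  survives.\<close>

lemma trace_l_ldual2_unit:
  assumes h: "h \<in> Hom \<one> \<one>"
  shows "trace_l \<one> (ldual2_unit C \<cdot> h) = h"
proof -
  note kh = comp_hom[OF coev_l_unit_hom h]
  have "trace_l \<one> (ldual2_unit C \<cdot> h)
      = trace_l \<one> (ldual_mor C (dL \<one>) \<one> (evL \<one>) \<cdot> (coevL \<one> \<cdot> h))"
    unfolding ldual2_unit_def
    by (simp only: comp_assoc[OF ldual_mor_hom[OF ev_l_unit_hom] coev_l_unit_hom h])
  also have "\<dots> = evL \<one> \<cdot> (idm \<one> \<otimes> (coevL \<one> \<cdot> h)) \<cdot> idm \<one>"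
    unfolding trace_l_def
  proof (rule trace_slide[OF ev_l_hom ev_l_hom coev_l_hom ldual_mor_hom[OF ev_l_unit_hom]
        ev_l_unit_hom kh ev_ldual_mor[OF ev_l_unit_hom]])
    show "(evL \<one> \<otimes> idm \<one>) \<cdot> coevL \<one> = idm \<one>"
      by (simp only: tensor_unit[OF ev_l_unit_hom] evL_coevL_unit)
  qed
  also have "\<dots> = (evL \<one> \<cdot> coevL \<one>) \<cdot> h"
    using comp_assoc[OF ev_l_unit_hom coev_l_unit_hom h] comp_ident[OF comp_hom[OF ev_l_unit_hom kh]]
    by (simp add: unit_tensor[OF kh])
  finally show ?thesis by (simp only: evL_coevL_unit ident_comp[OF h])
qed

lemma trace_r_rdual2_unit:
  assumes h: "h \<in> Hom \<one> \<one>"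
  shows "trace_r \<one> (rdual2_unit C \<cdot> h) = h"
proof -
  note kh = comp_hom[OF coev_r_unit_hom h]
  have "trace_r \<one> (rdual2_unit C \<cdot> h)
      = trace_r \<one> (rdual_mor C (dR \<one>) \<one> (evR \<one>) \<cdot> (coevR \<one> \<cdot> h))"
    unfolding rdual2_unit_def
    by (simp only: comp_assoc[OF rdual_mor_hom[OF ev_r_unit_hom] coev_r_unit_hom h])
  also have "\<dots> = evR \<one> \<cdot> ((coevR \<one> \<cdot> h) \<otimes> idm \<one>) \<cdot> idm \<one>"
    unfolding trace_r_def
  proof (rule trace_slide_r[OF ev_r_hom ev_r_hom coev_r_hom rdual_mor_hom[OF ev_r_unit_hom]
        ev_r_unit_hom kh ev_rdual_mor[OF ev_r_unit_hom]])
    show "(idm \<one> \<otimes> evR \<one>) \<cdot> coevR \<one> = idm \<one>"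
      by (simp only: unit_tensor[OF ev_r_unit_hom] evR_coevR_unit)
  qed
  also have "\<dots> = (evR \<one> \<cdot> coevR \<one>) \<cdot> h"
    using comp_assoc[OF ev_r_unit_hom coev_r_unit_hom h] comp_ident[OF comp_hom[OF ev_r_unit_hom kh]]
    by (simp add: tensor_unit[OF kh])
  finally show ?thesis by (simp only: evR_coevR_unit ident_comp[OF h])
qed

text \<open>Both unit maps are normalised so that the trace of their composite with a scalar
  \<open>h\<close> is \<open>h\<close>; nondegeneracy does the rest.\<close>

lemma double_dual_iso_unit: "double_dual_iso C \<one> \<cdot> ldual2_unit C = rdual2_unit C"
proof (rule trace_r_eqI[OF comp_hom[OF double_dual_iso_hom ldual2_unit_hom] rdual2_unit_hom])
  fix h assume h: "h \<in> Hom \<one> \<one>"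
  show "trace_r \<one> (double_dual_iso C \<one> \<cdot> ldual2_unit C \<cdot> h) = trace_r \<one> (rdual2_unit C \<cdot> h)"
    by (simp only: comp_assoc[OF double_dual_iso_hom ldual2_unit_hom h]
        double_dual_iso_trace[OF comp_hom[OF ldual2_unit_hom h]]
        trace_l_ldual2_unit[OF h] trace_r_rdual2_unit[OF h])
qed

lemma double_dual_iso_monoidal:
  "monoidal_natural_iso C
     (ldual2 C) (ldual2_mor C) (ldual2_tensor C) (ldual2_unit C)
     (rdual2 C) (rdual2_mor C) (rdual2_tensor C) (rdual2_unit C)
     (double_dual_iso C)"
  unfolding monoidal_natural_iso_def
  using double_dual_iso_is_iso double_dual_iso_natural double_dual_iso_tensor double_dual_iso_unit
  by simp

end

theorem proposition4p8:
  fixes C :: "('o, 'm::ab_group_add) fusion_data" (structure)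
  assumes "fusion_category C"
  shows
    "(\<comment> \<open>(i)\<close>
       (\<forall>c. linear_iso_on (scale C) dual_scale
              (Hom c \<one>) (dual_space (scale C) (Hom \<one> c)) (pairing C c)) \<and>
       (\<forall>c. \<forall>f\<in>Hom c \<one>. \<forall>h\<in>Hom \<one> c. scale C (pairing C c f h) (idm \<one>) = f \<cdot> h) \<and>
       (\<forall>c d. \<forall>a\<in>Hom c d. \<forall>f\<in>Hom d \<one>.
          pairing C c (f \<cdot> a) = restrict0 (Hom \<one> c) (\<lambda>h. pairing C d f (a \<cdot> h))))
     \<and>
     (\<comment> \<open>(ii)\<close>
       natural_linear_iso C (scale C) (scale C)
         (chain_functor1 C) (chain_functor2 C) (chain_step1 C) \<and>
       natural_linear_iso C (scale C) dual_scale
         (chain_functor2 C) (chain_functor3 C) (chain_step2 C) \<and>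
       natural_linear_iso C dual_scale dual_scale
         (chain_functor3 C) (chain_functor4 C) (chain_step3 C) \<and>
       natural_linear_iso C dual_scale dual_scale
         (chain_functor4 C) (chain_functor5 C) (chain_step4 C) \<and>
       natural_linear_iso C dual_scale (scale C)
         (chain_functor5 C) (chain_functor6 C) (chain_step5 C) \<and>
       natural_linear_iso C (scale C) (scale C)
         (chain_functor6 C) (chain_functor7 C) (chain_step6 C) \<and>
       natural_linear_iso C (scale C) (scale C)
         (chain_functor1 C) (chain_functor7 C) (chain C) \<and>
       (\<forall>c. \<forall>k\<in>Hom (ldual2 C c) (rdual2 C c).
          (\<forall>x. \<forall>f\<in>Hom x (ldual2 C c). chain C c x f = k \<cdot> f) \<longleftrightarrow> k = double_dual_iso C c) \<and>
       monoidal_natural_iso C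
         (ldual2 C) (ldual2_mor C) (ldual2_tensor C) (ldual2_unit C)
         (rdual2 C) (rdual2_mor C) (rdual2_tensor C) (rdual2_unit C)
         (double_dual_iso C))
     \<and>
     (\<comment> \<open>(iii)\<close>
       \<forall>c. \<forall>k\<in>Hom (ldual2 C c) (rdual2 C c).
         (\<forall>x. \<forall>f\<in>Hom x (ldual2 C c). \<forall>h\<in>Hom c x.
            evR (dR c) \<cdot> ((k \<cdot> f \<cdot> h) \<otimes> idm (dR c)) \<cdot> coevR c
            = evL (dL c) \<cdot> (idm (dL c) \<otimes> (f \<cdot> h)) \<cdot> coevL c)
         \<longleftrightarrow> k = double_dual_iso C c)"
proof -
  interpret fusion_category C by (rule assms)
  show ?thesis
    by (intro conjI allI ballI)
      (rule pairing_linear_iso, erule (1) scale_pairing, erule (1) pairing_natural,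
        rule chain_step1_natural, rule chain_step2_natural, rule chain_step3_natural,
        rule chain_step4_natural, rule chain_step5_natural, rule chain_step6_natural,
        rule chain_natural, erule double_dual_iso_unique_chain, rule double_dual_iso_monoidal,
        erule double_dual_iso_unique_trace[unfolded trace_r_def trace_l_def])
qed

end
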